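(* Let $W$ be a finite irreducible Coxeter group, let $G_W$ be the associated Artin group, and let $\mathbf{X}_W$ be a classifying space for $G_W$. Let $A$ be a commutative unitary ring, and let $\mathcal{L}_q$ and $\mathcal{L}_q'$ be the local systems over $\mathbf{X}_W$ with coefficients in $A[q,q^{-1}]$ and $A[[q,q^{-1}]]$ respectively, in which each standard generator of $G_W$ acts as multiplication by $q$. Then $$H^*(\mathbf{X}_W,\mathcal{L}_q') = H^{*+1}(\mathbf{X}_W,\mathcal{L}_q),$$ i.e. for every integer $i$ the modules $H^i(\mathbf{X}_W,\mathcal{L}_q')$ and $H^{i+1}(\mathbf{X}_W,\mathcal{L}_q)$ are isomorphic. Equivalently, $H^*(G_W,A[[q,q^{-1}]])=H^{*+1}(G_W,A[q,q^{-1}])$, where each standard generator of $G_W$ acts on $A[[q,q^{-1}]]$ and on $A[q,q^{-1}]$ as multiplication by $q$.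
   Context: If $(W,S)$ is the Coxeter system with presentation $W=\langle s\in S\mid (ss')^{m(s,s')}=e\rangle$, the Artin group $G_W$ has standard generators $g_s$, $s\in S$, and relations $g_sg_{s'}g_sg_{s'}\cdots = g_{s'}g_sg_{s'}g_s\cdots$ ($m(s,s')$ factors on each side) for $s\neq s'$, $m(s,s')\ne+\infty$. $A[q,q^{-1}]$ is the ring of Laurent polynomials over $A$; $A[[q,q^{-1}]]$ is the $A[q,q^{-1}]$-module of all formal bi-infinite series $\sum_{i\in\mathbb{Z}}a_iq^i$, $a_i\in A$. *)

theory Defs
  imports "HOL-Algebra.Multiplicative_Group" "HOL-Algebra.Group_Action"
    "HOL-Algebra.AbelCoset" "HOL-Algebra.Module" "HOL-Homology.Homology"
begin

section \<open>Groups given by generators and relations\<close>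

text \<open>A word is a list of letters \<open>(s, True)\<close>, standing for \<open>s\<close>, and \<open>(s, False)\<close>, standing for
  the inverse of \<open>s\<close>. A relation \<open>l = r\<close> is the pair \<open>(l, r)\<close>.\<close>

type_synonym 's gword = "('s \<times> bool) list"

inductive_set pres_rel :: "'s set \<Rightarrow> ('s gword \<times> 's gword) set \<Rightarrow> ('s gword \<times> 's gword) set"
  for S :: "'s set" and R :: "('s gword \<times> 's gword) set" where
  refl: "w \<in> lists (S \<times> UNIV) \<Longrightarrow> (w, w) \<in> pres_rel S R"
| sym: "(v, w) \<in> pres_rel S R \<Longrightarrow> (w, v) \<in> pres_rel S R"
| trans: "(u, v) \<in> pres_rel S R \<Longrightarrow> (v, w) \<in> pres_rel S R \<Longrightarrow> (u, w) \<in> pres_rel S R"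
| cancel: "u \<in> lists (S \<times> UNIV) \<Longrightarrow> v \<in> lists (S \<times> UNIV) \<Longrightarrow> s \<in> S \<Longrightarrow>
    (u @ [(s, b), (s, \<not> b)] @ v, u @ v) \<in> pres_rel S R"
| rel: "u \<in> lists (S \<times> UNIV) \<Longrightarrow> v \<in> lists (S \<times> UNIV) \<Longrightarrow> (l, r) \<in> R \<Longrightarrow>
    l \<in> lists (S \<times> UNIV) \<Longrightarrow> r \<in> lists (S \<times> UNIV) \<Longrightarrow>
    (u @ l @ v, u @ r @ v) \<in> pres_rel S R"

definition presented_group ::
  "'s set \<Rightarrow> ('s gword \<times> 's gword) set \<Rightarrow> 's gword set monoid" where
  "presented_group S R =
    \<lparr>carrier = lists (S \<times> UNIV) // pres_rel S R,
     mult = (\<lambda>U V. \<Union>x\<in>U. \<Union>y\<in>V. pres_rel S R `` {x @ y}),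
     one = pres_rel S R `` {[]}\<rparr>"

definition pres_gen :: "'s set \<Rightarrow> ('s gword \<times> 's gword) set \<Rightarrow> 's \<Rightarrow> 's gword set" where
  "pres_gen S R s = pres_rel S R `` {[(s, True)]}"


section \<open>Coxeter systems and Artin groups\<close>

text \<open>As usual for \<^const>\<open>group.ord\<close>, the value \<open>0\<close> means infinite order, i.e. \<open>m(s,t) = +\<infinity>\<close>.\<close>

definition coxeter_m :: "('w, 'z) monoid_scheme \<Rightarrow> 'w \<Rightarrow> 'w \<Rightarrow> nat" where
  "coxeter_m W s t = group.ord W (s \<otimes>\<^bsub>W\<^esub> t)"

definition coxeter_relations ::
  "('w, 'z) monoid_scheme \<Rightarrow> 'w set \<Rightarrow> ('w gword \<times> 'w gword) set" where
  "coxeter_relations W S =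
    {(concat (replicate (coxeter_m W s t) [(s, True), (t, True)]), []) | s t.
       s \<in> S \<and> t \<in> S \<and> coxeter_m W s t \<noteq> 0}"

text \<open>Coxeter systems in the sense of Bourbaki: \<open>S\<close> consists of involutions of \<open>W\<close>, and \<open>W\<close> is
  presented by \<open>S\<close> and the relations \<open>(st)\<^bsup>m(s,t)\<^esup> = e\<close>, where \<open>m(s,t)\<close> is the order of \<open>st\<close>
  (so that the relations with \<open>s = t\<close> read \<open>s\<^sup>2 = e\<close>).\<close>

definition coxeter_system :: "('w, 'z) monoid_scheme \<Rightarrow> 'w set \<Rightarrow> bool" where
  "coxeter_system W S \<longleftrightarrow>
     group W \<and> S \<subseteq> carrier W \<and> (\<forall>s\<in>S. group.ord W s = 2) \<and>
     (\<exists>h \<in> iso (presented_group S (coxeter_relations W S)) W.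
        \<forall>s\<in>S. h (pres_gen S (coxeter_relations W S) s) = s)"

definition coxeter_graph :: "('w, 'z) monoid_scheme \<Rightarrow> 'w set \<Rightarrow> 'w rel" where
  "coxeter_graph W S = {(s, t). s \<in> S \<and> t \<in> S \<and> s \<noteq> t \<and> coxeter_m W s t \<noteq> 2}"

definition irreducible_coxeter :: "('w, 'z) monoid_scheme \<Rightarrow> 'w set \<Rightarrow> bool" where
  "irreducible_coxeter W S \<longleftrightarrow> S \<noteq> {} \<and> S \<times> S \<subseteq> (coxeter_graph W S)\<^sup>*"

fun alternating :: "nat \<Rightarrow> 's \<Rightarrow> 's \<Rightarrow> 's gword" where
  "alternating 0 s t = []"
| "alternating (Suc n) s t = (s, True) # alternating n t s"

definition artin_relations ::
  "('w, 'z) monoid_scheme \<Rightarrow> 'w set \<Rightarrow> ('w gword \<times> 'w gword) set" where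
  "artin_relations W S =
    {(alternating (coxeter_m W s t) s t, alternating (coxeter_m W s t) t s) | s t.
       s \<in> S \<and> t \<in> S \<and> s \<noteq> t \<and> coxeter_m W s t \<noteq> 0}"

definition artin_group :: "('w, 'z) monoid_scheme \<Rightarrow> 'w set \<Rightarrow> 'w gword set monoid" where
  "artin_group W S = presented_group S (artin_relations W S)"

definition artin_gen :: "('w, 'z) monoid_scheme \<Rightarrow> 'w set \<Rightarrow> 'w \<Rightarrow> 'w gword set" where
  "artin_gen W S s = pres_gen S (artin_relations W S) s"


section \<open>Modules\<close>

text \<open>The record type of modules extends that of rings; the fields \<open>mult\<close> and \<open>one\<close> play no role
  in the notion of module and are left undefined below.\<close>

definition module_isomorphic ::
  "('r, 'y) ring_scheme \<Rightarrow> ('r, 'm, 'u) module_scheme \<Rightarrow> ('r, 'n, 'v) module_scheme \<Rightarrow> bool" where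
  "module_isomorphic R M N \<longleftrightarrow>
     (\<exists>h. bij_betw h (carrier M) (carrier N) \<and>
          (\<forall>x\<in>carrier M. \<forall>y\<in>carrier M. h (x \<oplus>\<^bsub>M\<^esub> y) = h x \<oplus>\<^bsub>N\<^esub> h y) \<and>
          (\<forall>r\<in>carrier R. \<forall>x\<in>carrier M. h (r \<odot>\<^bsub>M\<^esub> x) = r \<odot>\<^bsub>N\<^esub> h x))"

definition quotient_module ::
  "('r, 'm, 'u) module_scheme \<Rightarrow> 'm set \<Rightarrow> ('r, 'm set) module" where
  "quotient_module M B =
    \<lparr>carrier = a_rcosets\<^bsub>M\<^esub> B, mult = undefined, one = undefined,
     zero = B, add = set_add M,
     smult = (\<lambda>r X. \<Union>x\<in>X. B +>\<^bsub>M\<^esub> (r \<odot>\<^bsub>M\<^esub> x))\<rparr>"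

definition linear_action ::
  "('g, 'z) monoid_scheme \<Rightarrow> ('r, 'y) ring_scheme \<Rightarrow> ('r, 'm, 'u) module_scheme \<Rightarrow>
     ('g \<Rightarrow> 'm \<Rightarrow> 'm) \<Rightarrow> bool" where
  "linear_action G R M \<rho> \<longleftrightarrow>
     group_action G (carrier M) \<rho> \<and>
     (\<forall>g\<in>carrier G.
        (\<forall>x\<in>carrier M. \<forall>y\<in>carrier M. \<rho> g (x \<oplus>\<^bsub>M\<^esub> y) = \<rho> g x \<oplus>\<^bsub>M\<^esub> \<rho> g y) \<and>
        (\<forall>r\<in>carrier R. \<forall>x\<in>carrier M. \<rho> g (r \<odot>\<^bsub>M\<^esub> x) = r \<odot>\<^bsub>M\<^esub> \<rho> g x))"


section \<open>Laurent polynomials and bi-infinite series\<close>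

text \<open>The function \<open>a\<close> stands for the formal series with coefficient \<open>a i\<close> at \<open>q\<^bsup>i\<^esup>\<close>.\<close>

definition laurent_mult :: "('a, 'z) ring_scheme \<Rightarrow> (int \<Rightarrow> 'a) \<Rightarrow> (int \<Rightarrow> 'a) \<Rightarrow> int \<Rightarrow> 'a" where
  "laurent_mult A a b = (\<lambda>i. \<Oplus>\<^bsub>A\<^esub>j\<in>{j. a j \<noteq> \<zero>\<^bsub>A\<^esub>}. a j \<otimes>\<^bsub>A\<^esub> b (i - j))"

definition laurent_poly_ring :: "('a, 'z) ring_scheme \<Rightarrow> (int \<Rightarrow> 'a) ring" where
  "laurent_poly_ring A =
    \<lparr>carrier = {a. (\<forall>i. a i \<in> carrier A) \<and> finite {i. a i \<noteq> \<zero>\<^bsub>A\<^esub>}},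
     mult = laurent_mult A,
     one = (\<lambda>i. if i = 0 then \<one>\<^bsub>A\<^esub> else \<zero>\<^bsub>A\<^esub>),
     zero = (\<lambda>i. \<zero>\<^bsub>A\<^esub>),
     add = (\<lambda>a b i. a i \<oplus>\<^bsub>A\<^esub> b i)\<rparr>"

definition laurent_q :: "('a, 'z) ring_scheme \<Rightarrow> int \<Rightarrow> 'a" where
  "laurent_q A = (\<lambda>i. if i = 1 then \<one>\<^bsub>A\<^esub> else \<zero>\<^bsub>A\<^esub>)"

definition biinfinite_series_module ::
  "('a, 'z) ring_scheme \<Rightarrow> (int \<Rightarrow> 'a, int \<Rightarrow> 'a) module" where
  "biinfinite_series_module A =
    \<lparr>carrier = {a. \<forall>i. a i \<in> carrier A}, mult = undefined, one = undefined,
     zero = (\<lambda>i. \<zero>\<^bsub>A\<^esub>), add = (\<lambda>a b i. a i \<oplus>\<^bsub>A\<^esub> b i), smult = laurent_mult A\<rparr>"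

definition laurent_poly_module ::
  "('a, 'z) ring_scheme \<Rightarrow> (int \<Rightarrow> 'a, int \<Rightarrow> 'a) module" where
  "laurent_poly_module A =
    (biinfinite_series_module A)\<lparr>carrier := carrier (laurent_poly_ring A)\<rparr>"


section \<open>Cohomology\<close>

text \<open>Cochain complexes are indexed by the natural numbers and extended by \<open>0\<close> in negative
  degrees; cohomology is indexed by the integers.\<close>

definition cocycles ::
  "(nat \<Rightarrow> ('r, 'c, 'u) module_scheme) \<Rightarrow> (nat \<Rightarrow> 'c \<Rightarrow> 'c) \<Rightarrow> int \<Rightarrow> 'c set" where
  "cocycles C d i =
    (if i < 0 then {\<zero>\<^bsub>C 0\<^esub>}
     else {f \<in> carrier (C (nat i)). d (nat i) f = \<zero>\<^bsub>C (Suc (nat i))\<^esub>})"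

definition coboundaries ::
  "(nat \<Rightarrow> ('r, 'c, 'u) module_scheme) \<Rightarrow> (nat \<Rightarrow> 'c \<Rightarrow> 'c) \<Rightarrow> int \<Rightarrow> 'c set" where
  "coboundaries C d i =
    (if i \<le> 0 then {\<zero>\<^bsub>C 0\<^esub>} else d (nat (i - 1)) ` carrier (C (nat (i - 1))))"

definition cohomology ::
  "(nat \<Rightarrow> ('r, 'c, 'u) module_scheme) \<Rightarrow> (nat \<Rightarrow> 'c \<Rightarrow> 'c) \<Rightarrow> int \<Rightarrow> ('r, 'c set) module" where
  "cohomology C d i =
    quotient_module ((C (nat i))\<lparr>carrier := cocycles C d i\<rparr>) (coboundaries C d i)"

text \<open>Let \<open>X\<close> be a semi-simplicial \<open>G\<close>-set, with action \<open>act n\<close> on \<open>X n\<close> and face maps \<open>face n k\<close>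
  from \<open>X n\<close> to \<open>X (n - 1)\<close>. The \<open>\<int>[G]\<close>-homomorphisms from the free abelian group on \<open>X n\<close> to \<open>M\<close>
  are the \<open>G\<close>-equivariant maps from \<open>X n\<close> to \<open>M\<close>.\<close>

definition equivariant_cochains ::
  "('g, 'z) monoid_scheme \<Rightarrow> (nat \<Rightarrow> 'x set) \<Rightarrow> (nat \<Rightarrow> 'g \<Rightarrow> 'x \<Rightarrow> 'x) \<Rightarrow>
     ('r, 'm, 'u) module_scheme \<Rightarrow> ('g \<Rightarrow> 'm \<Rightarrow> 'm) \<Rightarrow> nat \<Rightarrow> ('r, 'x \<Rightarrow> 'm) module" where
  "equivariant_cochains G X act M \<rho> n =
    \<lparr>carrier = {f \<in> X n \<rightarrow>\<^sub>E carrier M. \<forall>g\<in>carrier G. \<forall>x\<in>X n. f (act n g x) = \<rho> g (f x)},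
     mult = undefined, one = undefined,
     zero = (\<lambda>x\<in>X n. \<zero>\<^bsub>M\<^esub>),
     add = (\<lambda>f f'. \<lambda>x\<in>X n. f x \<oplus>\<^bsub>M\<^esub> f' x),
     smult = (\<lambda>r f. \<lambda>x\<in>X n. r \<odot>\<^bsub>M\<^esub> f x)\<rparr>"

definition coboundary_map ::
  "(nat \<Rightarrow> 'x set) \<Rightarrow> (nat \<Rightarrow> nat \<Rightarrow> 'x \<Rightarrow> 'x) \<Rightarrow> ('r, 'm, 'u) module_scheme \<Rightarrow>
     nat \<Rightarrow> ('x \<Rightarrow> 'm) \<Rightarrow> 'x \<Rightarrow> 'm" where
  "coboundary_map X face M n f =
    (\<lambda>x\<in>X (Suc n). \<Oplus>\<^bsub>M\<^esub>k\<in>{..Suc n}. add_pow M ((-1::int) ^ k) (f (face (Suc n) k x)))"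

text \<open>Group cohomology, by means of homogeneous cochains on tuples \<open>(g\<^sub>0, \<dots>, g\<^sub>n)\<close>, i.e. equivariant
  cochains on the standard free resolution.\<close>

definition group_tuples :: "('g, 'z) monoid_scheme \<Rightarrow> nat \<Rightarrow> 'g list set" where
  "group_tuples G n = {gs \<in> lists (carrier G). length gs = Suc n}"

definition group_cohomology ::
  "('g, 'z) monoid_scheme \<Rightarrow> ('r, 'm, 'u) module_scheme \<Rightarrow> ('g \<Rightarrow> 'm \<Rightarrow> 'm) \<Rightarrow>
     int \<Rightarrow> ('r, ('g list \<Rightarrow> 'm) set) module" where
  "group_cohomology G M \<rho> =
    cohomology
      (equivariant_cochains G (group_tuples G) (\<lambda>n g. map (\<lambda>h. g \<otimes>\<^bsub>G\<^esub> h)) M \<rho>)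
      (coboundary_map (group_tuples G) (\<lambda>n k gs. take k gs @ drop (Suc k) gs) M)"

text \<open>A classifying space \<open>X\<close> of the discrete group \<open>G\<close>, presented as the base of a regular covering
  \<open>p\<close> with contractible total space \<open>E\<close> and group of deck transformations \<open>G\<close>. Thus \<open>E\<close> is the
  universal covering of \<open>X\<close>, and \<open>\<phi>\<close> identifies \<open>G\<close> with the fundamental group of \<open>X\<close>.\<close>

definition classifying_space ::
  "('g, 'z) monoid_scheme \<Rightarrow> 'x topology \<Rightarrow> 'e topology \<Rightarrow> ('e \<Rightarrow> 'x) \<Rightarrow> ('g \<Rightarrow> 'e \<Rightarrow> 'e) \<Rightarrow> bool" where
  "classifying_space G X E p \<phi> \<longleftrightarrow>
     topspace E \<noteq> {} \<and> contractible_space E \<and>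
     group_action G (topspace E) \<phi> \<and>
     (\<forall>g\<in>carrier G. continuous_map E E (\<phi> g)) \<and>
     (\<forall>e\<in>topspace E. \<exists>U. openin E U \<and> e \<in> U \<and>
        (\<forall>g\<in>carrier G. g \<noteq> \<one>\<^bsub>G\<^esub> \<longrightarrow> \<phi> g ` U \<inter> U = {})) \<and>
     quotient_map E X p \<and>
     (\<forall>e\<in>topspace E. \<forall>e'\<in>topspace E. p e = p e' \<longleftrightarrow> (\<exists>g\<in>carrier G. \<phi> g e = e'))"

text \<open>Singular cohomology of the base of such a covering with coefficients in the local system
  given by the \<open>G\<close>-module \<open>M\<close>: the cohomology of the complex of \<open>\<int>[G]\<close>-homomorphisms from the singular
  chains of the universal covering \<open>E\<close> to \<open>M\<close>.\<close>

definition local_cohomology ::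
  "('g, 'z) monoid_scheme \<Rightarrow> 'e topology \<Rightarrow> ('g \<Rightarrow> 'e \<Rightarrow> 'e) \<Rightarrow>
     ('r, 'm, 'u) module_scheme \<Rightarrow> ('g \<Rightarrow> 'm \<Rightarrow> 'm) \<Rightarrow>
     int \<Rightarrow> ('r, (((nat \<Rightarrow> real) \<Rightarrow> 'e) \<Rightarrow> 'm) set) module" where
  "local_cohomology G E \<phi> M \<rho> =
    cohomology
      (equivariant_cochains G (\<lambda>n. singular_simplex_set n E) (\<lambda>n g. simplex_map n (\<phi> g)) M \<rho>)
      (coboundary_map (\<lambda>n. singular_simplex_set n E) singular_face M)"

end

theory Submission
  imports Defs
begin

text \<open>
  The bi-infinite series \<open>A[[q, q\<^bsup>-1\<^esup>]]\<close> are the sum of the two rings of formal Laurent series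
  \<open>A((q))\<close> and \<open>A((q\<^bsup>-1\<^esup>))\<close>, and the Laurent polynomials are their intersection. All these modules
  are stable under \<open>q\<close>, so there is a Mayer--Vietoris sequence for the cohomology of \<open>G\<^sub>W\<close>, and the
  theorem says that its connecting homomorphism is an isomorphism. It therefore suffices that the
  cohomology with coefficients in \<open>A((q))\<close> and in \<open>A((q\<^bsup>-1\<^esup>))\<close> vanishes in every degree
  (\<open>acyclic_cover.cohomology_shift\<close>).

  The vanishing comes from the centre of \<open>G\<^sub>W\<close>. As \<open>W\<close> is finite, it has a longest element; its
  lift \<open>\<Delta>\<close> to \<open>G\<^sub>W\<close> permutes the standard generators by conjugation, and \<open>\<Delta>\<^sup>2\<close> is central. Thus
  \<open>\<Delta>\<^sup>2\<close> is a central product of \<open>L > 0\<close> standard generators, and acts on coefficients as \<open>q\<^bsup>L\<^esup>\<close>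
  (\<open>central_positive_word\<close>). A central element acts trivially on cohomology, because translation by
  it is an equivariant self-map of the resolution that is equivariantly chain homotopic to the
  identity (\<open>homotopy_exists\<close>). Hence \<open>q\<^bsup>L\<^esup> - 1\<close> annihilates the cohomology; but by the geometric
  series it is bijective on \<open>A((q))\<close> and on \<open>A((q\<^bsup>-1\<^esup>))\<close>, so the cohomology is zero
  (\<open>cocycle_is_coboundary\<close>).

  The lift of an element of \<open>W\<close> to \<open>G\<^sub>W\<close> is well defined by Matsumoto's theorem, which is derived
  below from the presentation of \<open>W\<close> by means of the parity of reflections in a word.

  Both kinds of cohomology are cohomology of equivariant cochains on a semi-simplicial \<open>G\<^sub>W\<close>-set
  which is free and whose chain complex is acyclic: tuples of group elements in one case, singular
  simplices of a contractible covering space in the other. The homological argument is carried out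
  once, for all such sets (locale \<open>free_acyclic_gset\<close>).
\<close>

section \<open>Presented groups\<close>

lemma pres_rel_lists:
  assumes "(u, v) \<in> pres_rel S R"
  shows "u \<in> lists (S \<times> UNIV) \<and> v \<in> lists (S \<times> UNIV)"
  using assms by (induction rule: pres_rel.induct) auto

lemma map_fst_lists: "u \<in> lists (S \<times> UNIV) \<Longrightarrow> map fst u \<in> lists S"
  by (induction u) auto

lemma equiv_pres_rel: "equiv (lists (S \<times> UNIV)) (pres_rel S R)"
proof (rule equivI)
  show "pres_rel S R \<subseteq> lists (S \<times> UNIV) \<times> lists (S \<times> UNIV)"
    by (rule subrelI) (simp only: mem_Sigma_iff pres_rel_lists)
  show "refl_on (lists (S \<times> UNIV)) (pres_rel S R)"
    by (rule refl_onI) (rule pres_rel.refl)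
  show "sym (pres_rel S R)" by (rule symI) (rule pres_rel.sym)
  show "trans (pres_rel S R)" by (rule transI) (rule pres_rel.trans)
qed

lemma pres_rel_append:
  assumes "(a, b) \<in> pres_rel S R" "u \<in> lists (S \<times> UNIV)" "v \<in> lists (S \<times> UNIV)"
  shows "(u @ a @ v, u @ b @ v) \<in> pres_rel S R"
  using assms(1)
proof (induction rule: pres_rel.induct)
  case (refl w)
  then show ?case using assms by (intro pres_rel.refl) auto
next
  case (sym v w)
  then show ?case by (blast intro: pres_rel.sym)
next
  case (trans a b c)
  then show ?case by (blast intro: pres_rel.trans)
next
  case (cancel a b s x)
  then show ?case using assms pres_rel.cancel[of "u @ a" S "b @ v" s x R] by simp
next
  case (rel a b l r)
  then show ?case using assms pres_rel.rel[of "u @ a" S "b @ v" l r R] by simp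
qed

lemma pres_rel_append2:
  assumes "(a, b) \<in> pres_rel S R" "(c, d) \<in> pres_rel S R"
  shows "(a @ c, b @ d) \<in> pres_rel S R"
proof -
  have "(a @ c, b @ c) \<in> pres_rel S R"
    using pres_rel_append[OF assms(1), of "[]" c] pres_rel_lists[OF assms(2)] by simp
  moreover have "(b @ c, b @ d) \<in> pres_rel S R"
    using pres_rel_append[OF assms(2), of b "[]"] pres_rel_lists[OF assms(1)] by simp
  ultimately show ?thesis by (rule pres_rel.trans)
qed

abbreviation pres_class :: "'s set \<Rightarrow> ('s gword \<times> 's gword) set \<Rightarrow> 's gword \<Rightarrow> 's gword set" where
  "pres_class S R u \<equiv> pres_rel S R `` {u}"

lemma pres_class_eq_iff:
  assumes "u \<in> lists (S \<times> UNIV)" "v \<in> lists (S \<times> UNIV)"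
  shows "pres_class S R u = pres_class S R v \<longleftrightarrow> (u, v) \<in> pres_rel S R"
  using eq_equiv_class_iff[OF equiv_pres_rel assms] .

lemma carrier_presented_group:
  "carrier (presented_group S R) = pres_class S R ` lists (S \<times> UNIV)"
  by (auto simp: presented_group_def quotient_def)

lemma one_presented_group: "\<one>\<^bsub>presented_group S R\<^esub> = pres_class S R []"
  by (simp add: presented_group_def)

lemma mult_presented_group:
  assumes "u \<in> lists (S \<times> UNIV)" "v \<in> lists (S \<times> UNIV)"
  shows "pres_class S R u \<otimes>\<^bsub>presented_group S R\<^esub> pres_class S R v = pres_class S R (u @ v)"
proof -
  have "congruent2 (pres_rel S R) (pres_rel S R) (\<lambda>x y. pres_class S R (x @ y))"
    unfolding congruent2_def by (auto intro!: equiv_class_eq[OF equiv_pres_rel] pres_rel_append2)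
  from UN_equiv_class2[OF equiv_pres_rel equiv_pres_rel this assms] show ?thesis
    by (simp add: presented_group_def)
qed

section \<open>The reflection cocycle and the exchange condition\<close>

fun alt :: "nat \<Rightarrow> 's \<Rightarrow> 's \<Rightarrow> 's list" where
  "alt 0 s t = []"
| "alt (Suc n) s t = s # alt n t s"

lemma length_alt [simp]: "length (alt n s t) = n"
  by (induction n s t rule: alt.induct) auto

lemma set_alt: "set (alt n s t) \<subseteq> {s, t}"
  by (induction n s t rule: alt.induct) auto

lemma alternating_alt: "alternating n s t = map (\<lambda>x. (x, True)) (alt n s t)"
  by (induction n s t rule: alt.induct) auto

lemma alt_even: "alt (2 * n) s t = concat (replicate n [s, t])"
  by (induction n) auto

locale coxeter = group W for W :: "('w, 'z) monoid_scheme" (structure) +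
  fixes S :: "'w set"
  assumes cox: "coxeter_system W S" and fin: "finite (carrier W)"
begin

definition ev :: "'w list \<Rightarrow> 'w" where
  "ev u = foldr (\<otimes>) u \<one>"

lemma ev_simps [simp]: "ev [] = \<one>" "ev (s # u) = s \<otimes> ev u"
  by (simp_all add: ev_def)

lemma S_carrier: "s \<in> S \<Longrightarrow> s \<in> carrier W"
  using cox by (auto simp: coxeter_system_def)

lemma S_sq: "s \<in> S \<Longrightarrow> s \<otimes> s = \<one>"
  using cox pow_ord_eq_1[of s] S_carrier[of s] by (simp add: coxeter_system_def numeral_2_eq_2)

lemma S_ne_one: "s \<in> S \<Longrightarrow> s \<noteq> \<one>"
  using cox by (auto simp: coxeter_system_def)

lemma S_sq_left: "s \<in> S \<Longrightarrow> x \<in> carrier W \<Longrightarrow> s \<otimes> (s \<otimes> x) = x"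
  by (metis S_carrier S_sq l_one m_assoc)

lemma S_sq_right: "s \<in> S \<Longrightarrow> x \<in> carrier W \<Longrightarrow> x \<otimes> s \<otimes> s = x"
  by (metis S_carrier S_sq r_one m_assoc)

lemma S_inv: "s \<in> S \<Longrightarrow> inv s = s"
  using S_carrier S_sq inv_equality by blast

lemma ev_closed [simp]: "u \<in> lists S \<Longrightarrow> ev u \<in> carrier W"
  by (induction u) (auto intro: S_carrier)

lemma ev_append: "u \<in> lists S \<Longrightarrow> v \<in> lists S \<Longrightarrow> ev (u @ v) = ev u \<otimes> ev v"
  by (induction u) (auto simp: S_carrier m_assoc)

lemma ev_rev: "u \<in> lists S \<Longrightarrow> ev (rev u) = inv (ev u)"
proof (induction u)
  case (Cons s u)
  then have "rev u \<in> lists S" by (simp add: in_lists_conv_set)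
  then show ?case using Cons ev_append[of "rev u" "[s]"] S_carrier[of s] by (simp add: inv_mult_group S_inv)
qed simp

text \<open>Since every \<open>s \<in> S\<close> is an involution, words without inverse letters already represent all
  of \<open>W\<close>; elements of \<open>W\<close> are written as such words from here on.\<close>

lemma coxeter_presentation:
  shows ex_word: "w \<in> carrier W \<Longrightarrow> \<exists>u\<in>lists S. ev u = w"
    and ev_eq_imp_pres_rel: "u \<in> lists S \<Longrightarrow> v \<in> lists S \<Longrightarrow> ev u = ev v \<Longrightarrow>
      (map (\<lambda>s. (s, True)) u, map (\<lambda>s. (s, True)) v) \<in> pres_rel S (coxeter_relations W S)"
proof -
  define R where "R = coxeter_relations W S"
  define P where "P = presented_group S R"
  obtain h where h: "h \<in> iso P W" and hS: "\<And>s. s \<in> S \<Longrightarrow> h (pres_gen S R s) = s"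
    using cox by (auto simp: coxeter_system_def P_def R_def)
  have h_mult: "h (pres_class S R (u @ v)) = h (pres_class S R u) \<otimes> h (pres_class S R v)"
    if "u \<in> lists (S \<times> UNIV)" "v \<in> lists (S \<times> UNIV)" for u v
  proof -
    have "h (pres_class S R u \<otimes>\<^bsub>P\<^esub> pres_class S R v) = h (pres_class S R u) \<otimes> h (pres_class S R v)"
      using h that by (intro hom_mult) (auto simp: iso_def P_def carrier_presented_group)
    then show ?thesis using that by (simp add: P_def mult_presented_group)
  qed
  have h_closed: "h (pres_class S R u) \<in> carrier W" if "u \<in> lists (S \<times> UNIV)" for u
    using h that by (auto simp: iso_def hom_def P_def carrier_presented_group)
  have h_Nil: "h (pres_class S R []) = \<one>"
    using h_mult[of "[]" "[]"] h_closed[of "[]"] by (simp add: l_cancel_one)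
  have h_letter: "h (pres_class S R [(s, b)]) = s" if s: "s \<in> S" for s b
  proof (cases b)
    case True
    then show ?thesis using hS[OF s] by (simp add: pres_gen_def)
  next
    case False
    have "pres_class S R [(s, True), (s, False)] = pres_class S R []"
      using s pres_rel.cancel[of "[]" S "[]" s True R] by (subst pres_class_eq_iff) auto
    then have "s \<otimes> h (pres_class S R [(s, False)]) = \<one>"
      using s h_mult[of "[(s, True)]" "[(s, False)]"] hS[OF s] h_Nil by (simp add: pres_gen_def)
    then have "h (pres_class S R [(s, False)]) = inv s"
      using s h_closed[of "[(s, False)]"] S_carrier[OF s] by (intro inv_equality[symmetric]) (auto simp: inv_comm)
    then show ?thesis using False s by (simp add: S_inv)
  qed
  have h_ev: "h (pres_class S R u) = ev (map fst u)" if "u \<in> lists (S \<times> UNIV)" for u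
    using that
  proof (induction u)
    case Nil
    show ?case by (simp add: h_Nil)
  next
    case (Cons x u)
    then show ?case using h_mult[of "[x]" u] h_letter[of "fst x" "snd x"] by auto
  qed
  show "\<exists>u\<in>lists S. ev u = w" if w: "w \<in> carrier W" for w
  proof -
    obtain u where u: "u \<in> lists (S \<times> UNIV)" "w = h (pres_class S R u)"
      using h w by (auto simp: iso_def bij_betw_def P_def carrier_presented_group)
    then have "map fst u \<in> lists S" by (simp add: map_fst_lists)
    then show ?thesis using u h_ev by auto
  qed
  show "(map (\<lambda>s. (s, True)) u, map (\<lambda>s. (s, True)) v) \<in> pres_rel S (coxeter_relations W S)"
    if "u \<in> lists S" "v \<in> lists S" "ev u = ev v" for u v
  proof -
    let ?t = "map (\<lambda>s. (s, True))"
    have l: "?t u \<in> lists (S \<times> UNIV)" "?t v \<in> lists (S \<times> UNIV)" using that by auto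
    have "h (pres_class S R (?t u)) = h (pres_class S R (?t v))"
      using that l by (simp add: h_ev comp_def)
    moreover have "inj_on h (carrier P)" using h by (auto simp: iso_def bij_betw_def)
    ultimately have "pres_class S R (?t u) = pres_class S R (?t v)"
      using l by (auto simp: P_def carrier_presented_group dest: inj_onD)
    then show ?thesis using l by (simp add: pres_class_eq_iff R_def)
  qed
qed

text \<open>For a word \<open>s\<^sub>1 \<dots> s\<^sub>k\<close> these are the elements that occur an odd number of times in the list
  of reflections \<open>s\<^sub>1 \<dots> s\<^sub>i \<dots> s\<^sub>1\<close>. On group elements this becomes the set of inversions of \<open>w\<close>,
  a cocycle on \<open>W\<close> with values in sets of reflections; it replaces the root system in what
  follows.\<close>

fun cocyc :: "'w list \<Rightarrow> 'w \<Rightarrow> bool" where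
  "cocyc [] x = False"
| "cocyc (s # u) x = ((x = s) \<noteq> cocyc u (s \<otimes> x \<otimes> s))"

lemma cocyc_append:
  "u \<in> lists S \<Longrightarrow> v \<in> lists S \<Longrightarrow> x \<in> carrier W \<Longrightarrow>
   cocyc (u @ v) x = (cocyc u x \<noteq> cocyc v (inv (ev u) \<otimes> x \<otimes> ev u))"
  by (induction u arbitrary: x) (auto simp: S_carrier S_inv inv_mult_group m_assoc)

text \<open>A reflection that occurs among the \<open>s\<^sub>1 \<dots> s\<^sub>i \<dots> s\<^sub>1\<close> deletes the letter \<open>s\<^sub>i\<close> when it
  multiplies the word from the left.\<close>

lemma exchange:
  "u \<in> lists S \<Longrightarrow> x \<in> carrier W \<Longrightarrow> cocyc u x \<Longrightarrow>
   \<exists>v\<in>lists S. length u = Suc (length v) \<and> ev v = x \<otimes> ev u"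
proof (induction u arbitrary: x)
  case Nil
  then show ?case by simp
next
  case (Cons s u)
  have s: "s \<in> S" "s \<in> carrier W" and u: "u \<in> lists S" using Cons.prems S_carrier by auto
  show ?case
  proof (cases "x = s")
    case True
    then show ?thesis using u s by (intro bexI[of _ u]) (auto simp: S_sq_left)
  next
    case False
    then have "cocyc u (s \<otimes> x \<otimes> s)" using Cons.prems by simp
    then obtain v where v: "v \<in> lists S" "length u = Suc (length v)" "ev v = s \<otimes> x \<otimes> s \<otimes> ev u"
      using Cons.IH[of "s \<otimes> x \<otimes> s"] u s Cons.prems by auto
    have "ev (s # v) = x \<otimes> ev (s # u)"
      using v s u Cons.prems by (simp add: m_assoc S_sq_left)
    then show ?thesis using v s by (intro bexI[of _ "s # v"]) auto
  qed
qed

text \<open>The reflections of the alternating word \<open>s t s \<dots>\<close>; they repeat with period \<open>m(s,t)\<close>.\<close>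

definition alt_refl :: "'w \<Rightarrow> 'w \<Rightarrow> nat \<Rightarrow> 'w" where
  "alt_refl s t i = (s \<otimes> t) [^] i \<otimes> s"

lemma alt_refl_closed: "s \<in> S \<Longrightarrow> t \<in> S \<Longrightarrow> alt_refl s t i \<in> carrier W"
  by (simp add: alt_refl_def S_carrier)

lemma alt_refl_Suc:
  assumes "s \<in> S" "t \<in> S" "x \<in> carrier W"
  shows "s \<otimes> x \<otimes> s = alt_refl t s i \<longleftrightarrow> x = alt_refl s t (Suc i)"
proof -
  have st: "s \<in> carrier W" "t \<in> carrier W" using assms S_carrier by auto
  have p: "s \<otimes> (t \<otimes> s) [^] i = (s \<otimes> t) [^] i \<otimes> s" for i :: nat
  proof (induction i)
    case (Suc i)
    have "s \<otimes> (t \<otimes> s) [^] Suc i = s \<otimes> (t \<otimes> s) [^] i \<otimes> (t \<otimes> s)" using st by (simp add: m_assoc)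
    also have "\<dots> = (s \<otimes> t) [^] i \<otimes> s \<otimes> (t \<otimes> s)" using Suc by simp
    finally show ?case using st by (simp add: m_assoc)
  qed (use st in simp)
  have "s \<otimes> alt_refl t s i \<otimes> s = alt_refl s t (Suc i)"
  proof -
    have "s \<otimes> alt_refl t s i \<otimes> s = s \<otimes> (t \<otimes> s) [^] i \<otimes> t \<otimes> s" using st by (simp add: alt_refl_def m_assoc)
    then show ?thesis using st by (simp add: p) (simp add: alt_refl_def m_assoc)
  qed
  moreover have "s \<otimes> x \<otimes> s = y \<longleftrightarrow> x = s \<otimes> y \<otimes> s" if "y \<in> carrier W" for y
    using st assms that by (metis S_sq_left S_sq_right m_assoc m_closed)
  ultimately show ?thesis using alt_refl_closed assms by simp
qed

lemma cocyc_alt: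
  "s \<in> S \<Longrightarrow> t \<in> S \<Longrightarrow> x \<in> carrier W \<Longrightarrow>
   cocyc (alt k s t) x = odd (card {i. i < k \<and> x = alt_refl s t i})"
proof (induction k s t arbitrary: x rule: alt.induct)
  case (1 s t)
  then show ?case by simp
next
  case (2 k s t)
  have st: "s \<in> carrier W" "t \<in> carrier W" using 2 S_carrier by auto
  have "{i. i < Suc k \<and> x = alt_refl s t i} =
     {i. i = 0 \<and> x = s} \<union> Suc ` {i. i < k \<and> x = alt_refl s t (Suc i)}"
  proof (rule Set.set_eqI)
    fix i show "(i \<in> {i. i < Suc k \<and> x = alt_refl s t i}) =
     (i \<in> {i. i = 0 \<and> x = s} \<union> Suc ` {i. i < k \<and> x = alt_refl s t (Suc i)})"
      using st by (cases i) (auto simp: alt_refl_def)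
  qed
  moreover have "card ({i. i = 0 \<and> x = s} \<union> Suc ` {i. i < k \<and> x = alt_refl s t (Suc i)}) =
     card {i::nat. i = 0 \<and> x = s} + card (Suc ` {i. i < k \<and> x = alt_refl s t (Suc i)})"
    by (rule card_Un_disjoint) auto
  moreover have "card {i::nat. i = 0 \<and> x = s} = (if x = s then 1 else 0)" by auto
  moreover have "card (Suc ` {i. i < k \<and> x = alt_refl s t (Suc i)}) = card {i. i < k \<and> x = alt_refl s t (Suc i)}"
    by (intro card_image) auto
  moreover have "cocyc (alt k t s) (s \<otimes> x \<otimes> s) = odd (card {i. i < k \<and> x = alt_refl s t (Suc i)})"
    using 2 st by (simp add: alt_refl_Suc)
  ultimately show ?case by simp
qed

lemma ord_pos: "s \<in> S \<Longrightarrow> t \<in> S \<Longrightarrow> 0 < coxeter_m W s t"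
  unfolding coxeter_m_def using fin S_carrier by (intro ord_ge_1[THEN less_le_trans[rotated]]) auto

lemma alt_closed: "s \<in> S \<Longrightarrow> t \<in> S \<Longrightarrow> alt k s t \<in> lists S"
  using set_alt[of k s t] by (auto simp: in_lists_conv_set)

lemma ev_alt_shift:
  assumes "s \<in> S" "t \<in> S"
  shows "ev (alt (2 * k + j) s t) = (s \<otimes> t) [^] k \<otimes> ev (alt j s t)"
proof (induction k)
  case 0
  then show ?case using assms by (simp add: alt_closed)
next
  case (Suc k)
  have st: "s \<in> carrier W" "t \<in> carrier W" using assms S_carrier by auto
  have "ev (alt (2 * Suc k + j) s t) = (s \<otimes> t) \<otimes> ((s \<otimes> t) [^] k \<otimes> ev (alt j s t))"
    using assms st Suc by (simp add: m_assoc alt_closed)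
  also have "\<dots> = (s \<otimes> t) [^] Suc k \<otimes> ev (alt j s t)"
    using assms st by (subst nat_pow_Suc2) (auto simp: m_assoc alt_closed)
  finally show ?case .
qed

lemma ev_alt_even: "s \<in> S \<Longrightarrow> t \<in> S \<Longrightarrow> ev (alt (2 * k) s t) = (s \<otimes> t) [^] k"
  using ev_alt_shift[of s t k 0] by (simp add: S_carrier)

lemma coxeter_m_pow: "s \<in> S \<Longrightarrow> t \<in> S \<Longrightarrow> (s \<otimes> t) [^] coxeter_m W s t = \<one>"
  unfolding coxeter_m_def by (intro pow_ord_eq_1) (auto simp: S_carrier)

lemma even_card_periodic:
  fixes P :: "nat \<Rightarrow> bool"
  assumes "\<And>i. P (m + i) = P i"
  shows "even (card {i. i < 2 * m \<and> P i})"
proof -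
  have "{i. i < 2 * m \<and> P i} = {i. i < m \<and> P i} \<union> (\<lambda>i. m + i) ` {i. i < m \<and> P i}"
  proof (rule Set.set_eqI)
    fix i show "(i \<in> {i. i < 2 * m \<and> P i}) = (i \<in> {i. i < m \<and> P i} \<union> (\<lambda>i. m + i) ` {i. i < m \<and> P i})"
      using assms[of "i - m"] assms by (cases "i < m") (auto simp: image_iff intro!: exI[of _ "i - m"])
  qed
  moreover have "card ({i. i < m \<and> P i} \<union> (\<lambda>i. m + i) ` {i. i < m \<and> P i}) =
     card {i. i < m \<and> P i} + card ((\<lambda>i. m + i) ` {i. i < m \<and> P i})"
    by (rule card_Un_disjoint) auto
  moreover have "card ((\<lambda>i. m + i) ` {i. i < m \<and> P i}) = card {i. i < m \<and> P i}"
    by (intro card_image) auto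
  ultimately show ?thesis by simp
qed

text \<open>Along a Coxeter relation \<open>(st)\<^bsup>m\<^esup> = e\<close> every reflection of the word \<open>(st)\<^bsup>m\<^esup>\<close> occurs exactly
  twice as often as in its first half, so the parity does not change: the cocycle is a function on
  \<open>W\<close>.\<close>

lemma cocyc_cong:
  assumes "u \<in> lists S" "v \<in> lists S" "ev u = ev v" "x \<in> carrier W"
  shows "cocyc u x = cocyc v x"
proof -
  have *: "ev (map fst a) = ev (map fst b) \<and> (\<forall>x\<in>carrier W. cocyc (map fst a) x = cocyc (map fst b) x)"
    if "(a, b) \<in> pres_rel S (coxeter_relations W S)" for a b
    using that
  proof (induction rule: pres_rel.induct)
    case (cancel u v s b)
    then have "map fst u \<in> lists S" "map fst v \<in> lists S" by (simp_all add: map_fst_lists)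
    moreover have "s \<otimes> (s \<otimes> x \<otimes> s) \<otimes> s = x" if "x \<in> carrier W" for x
      using \<open>s \<in> S\<close> that by (simp add: m_assoc S_carrier S_sq_left S_sq)
    moreover have "s \<otimes> x \<otimes> s = s \<longleftrightarrow> x = s" if "x \<in> carrier W" for x
      using \<open>s \<in> S\<close> that by (metis S_carrier S_sq_right S_sq_left m_closed)
    ultimately show ?case
      using \<open>s \<in> S\<close> by (auto simp: ev_append cocyc_append S_sq_left S_carrier)
  next
    case (rel u v l r)
    from \<open>(l, r) \<in> coxeter_relations W S\<close>
    obtain s t where st: "s \<in> S" "t \<in> S" "r = []"
      and l: "l = concat (replicate (coxeter_m W s t) [(s, True), (t, True)])"
      by (auto simp: coxeter_relations_def)
    have ml: "map fst l = alt (2 * coxeter_m W s t) s t"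
      by (simp add: l alt_even map_concat)
    have "alt_refl s t (coxeter_m W s t + i) = alt_refl s t i" for i
      using st by (simp add: alt_refl_def nat_pow_mult[symmetric] coxeter_m_pow S_carrier)
    then have 1: "\<not> cocyc (map fst l) x" if "x \<in> carrier W" for x
      using even_card_periodic[of "\<lambda>i. x = alt_refl s t i" "coxeter_m W s t"] st that
      by (simp add: ml cocyc_alt)
    have 2: "ev (map fst l) = \<one>" using st by (simp add: ml ev_alt_even coxeter_m_pow)
    have "map fst u \<in> lists S" "map fst v \<in> lists S" "map fst l \<in> lists S" using rel by (simp_all add: map_fst_lists)
    then show ?case using 1 2 \<open>r = []\<close> by (auto simp: ev_append cocyc_append)
  qed auto
  show ?thesis using *[OF ev_eq_imp_pres_rel[OF assms(1-3)]] assms(4) by (simp add: comp_def)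
qed

section \<open>Length and reduced words\<close>

definition len :: "'w \<Rightarrow> nat" where
  "len w = (LEAST n. \<exists>u\<in>lists S. length u = n \<and> ev u = w)"

definition reduced :: "'w list \<Rightarrow> bool" where
  "reduced u \<longleftrightarrow> u \<in> lists S \<and> length u = len (ev u)"

lemma len_le: "u \<in> lists S \<Longrightarrow> len (ev u) \<le> length u"
  unfolding len_def by (rule Least_le) auto

lemma ex_reduced:
  assumes "w \<in> carrier W"
  obtains u where "reduced u" "ev u = w"
proof -
  have "\<exists>n. \<exists>u\<in>lists S. length u = n \<and> ev u = w" using ex_word[OF assms] by auto
  from LeastI_ex[OF this] show ?thesis using that by (auto simp: reduced_def len_def)
qed

lemma len_mult_le:
  assumes "x \<in> carrier W" "y \<in> carrier W"
  shows "len (x \<otimes> y) \<le> len x + len y"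
proof -
  obtain u v where "reduced u" "ev u = x" "reduced v" "ev v = y" using assms ex_reduced by metis
  then show ?thesis using len_le[of "u @ v"] by (auto simp: reduced_def ev_append)
qed

lemma len_inv_le:
  assumes "x \<in> carrier W"
  shows "len (inv x) \<le> len x"
proof -
  obtain u where u: "reduced u" "ev u = x" using assms ex_reduced by metis
  then have "rev u \<in> lists S" by (simp add: reduced_def in_lists_conv_set)
  then show ?thesis using u len_le[of "rev u"] by (auto simp: reduced_def ev_rev)
qed

lemma len_eq_0: "x \<in> carrier W \<Longrightarrow> len x = 0 \<Longrightarrow> x = \<one>"
  by (metis ev_simps(1) ex_reduced length_0_conv reduced_def)

lemma len_cocyc:
  assumes "u \<in> lists S" "x \<in> carrier W" "cocyc u x"
  shows "len (x \<otimes> ev u) < len (ev u)"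
proof -
  obtain v where v: "reduced v" "ev v = ev u" using assms ex_reduced ev_closed by metis
  then have "cocyc v x" using assms cocyc_cong[of v u] by (auto simp: reduced_def)
  then obtain v' where "v' \<in> lists S" "length v = Suc (length v')" "ev v' = x \<otimes> ev v"
    using exchange[of v x] assms v by (auto simp: reduced_def)
  then show ?thesis using len_le[of v'] v by (simp add: reduced_def)
qed

text \<open>As \<open>s\<close> is an inversion of exactly one of \<open>w\<close> and \<open>sw\<close>, the exchange condition decides which
  of the two is shorter.\<close>

lemma len_ascent:
  assumes "u \<in> lists S" "s \<in> S" "\<not> cocyc u s"
  shows "len (s \<otimes> ev u) = Suc (len (ev u))"
proof -
  have "cocyc (s # u) s" using assms by (simp add: S_sq S_carrier)
  then have "len (s \<otimes> ev (s # u)) < len (ev (s # u))"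
    using assms by (intro len_cocyc) (auto simp: S_carrier)
  then have "len (ev u) < len (s \<otimes> ev u)" using assms by (simp add: S_sq_left)
  moreover have "len (s \<otimes> ev u) \<le> Suc (len (ev u))"
    using len_mult_le[of s "ev u"] len_le[of "[s]"] assms by (simp add: S_carrier)
  ultimately show ?thesis by simp
qed

lemma len_gen: "s \<in> S \<Longrightarrow> len s = 1"
  using len_le[of "[s]"] len_eq_0[of s] by (force simp: S_carrier S_ne_one)

lemma reduced_ConsD:
  assumes "reduced (s # u)"
  shows "s \<in> S" "reduced u" "\<not> cocyc u s"
proof -
  show s: "s \<in> S" using assms by (simp add: reduced_def)
  have u: "u \<in> lists S" using assms by (simp add: reduced_def)
  have l: "len (s \<otimes> ev u) = Suc (length u)" using assms by (simp add: reduced_def)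
  have "len (s \<otimes> ev u) \<le> Suc (len (ev u))"
    using len_mult_le[of s "ev u"] s u len_gen[OF s] by (simp add: S_carrier)
  then show "reduced u" using l len_le[OF u] u by (simp add: reduced_def)
  show "\<not> cocyc u s" using len_cocyc[OF u _ , of s] l len_le[OF u] s by (auto simp: S_carrier)
qed

section \<open>Dihedral subgroups\<close>

lemma coxeter_m_commute:
  assumes "s \<in> S" "t \<in> S" shows "coxeter_m W t s = coxeter_m W s t"
proof -
  have "t \<otimes> s = inv (s \<otimes> t)" using assms by (simp add: inv_mult_group S_carrier S_inv)
  then show ?thesis using assms by (simp add: coxeter_m_def ord_inv S_carrier)
qed

lemma ev_alt_period:
  assumes "s \<in> S" "t \<in> S"
  shows "ev (alt (2 * coxeter_m W s t * i + j) s t) = ev (alt j s t)"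
proof -
  have "(s \<otimes> t) [^] (coxeter_m W s t * i) = \<one>"
    using assms by (simp add: nat_pow_pow[symmetric] coxeter_m_pow S_carrier)
  then show ?thesis
    using ev_alt_shift[of s t "coxeter_m W s t * i" j] assms by (simp add: alt_closed mult.assoc)
qed

text \<open>Going round the \<open>2m\<close>-gon of the dihedral group in the other direction.\<close>

lemma ev_alt_flip:
  assumes "s \<in> S" "t \<in> S" "k \<le> 2 * coxeter_m W s t"
  shows "ev (alt k t s) = ev (alt (2 * coxeter_m W s t - k) s t)"
  using assms
proof (induction k arbitrary: s t)
  case 0
  then show ?case by (simp add: ev_alt_even coxeter_m_pow)
next
  case (Suc k)
  let ?m = "coxeter_m W s t"
  have "2 * ?m - k = Suc (2 * ?m - Suc k)" using Suc.prems by simp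
  then have "ev (alt k s t) = t \<otimes> ev (alt (2 * ?m - Suc k) s t)"
    using Suc.IH[of t s] Suc.prems by (simp add: coxeter_m_commute)
  then show ?case using Suc.prems by (simp add: S_sq_left alt_closed)
qed

lemma ev_braid: "s \<in> S \<Longrightarrow> t \<in> S \<Longrightarrow> ev (alt (coxeter_m W s t) t s) = ev (alt (coxeter_m W s t) s t)"
  using ev_alt_flip[of s t "coxeter_m W s t"] by simp

lemma dihedral_alt:
  assumes "s \<in> S" "t \<in> S" "u \<in> lists {s, t}"
  shows "\<exists>k < 2 * coxeter_m W s t. ev u = ev (alt k s t) \<or> ev u = ev (alt k t s)"
proof -
  have "\<exists>k. ev u = ev (alt k s t) \<or> ev u = ev (alt k t s)"
    using assms(3)
  proof (induction u)
    case Nil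
    have "ev [] = ev (alt 0 s t)" by simp
    then show ?case by blast
  next
    case (Cons a u)
    have step: "\<exists>k. ev (a # u) = ev (alt k x y) \<or> ev (a # u) = ev (alt k y x)"
      if k: "ev u = ev (alt k x y)" and xy: "x \<in> S" "y \<in> S" "a = x \<or> a = y" for k x y
    proof (cases "a = y")
      case True
      then have "ev (a # u) = ev (alt (Suc k) y x)" using k by simp
      then show ?thesis by blast
    next
      case False
      then have a: "a = x" using xy by simp
      show ?thesis
      proof (cases k)
        case 0
        then have "ev (a # u) = ev (alt 1 x y)" using a k by simp
        then show ?thesis by blast
      next
        case (Suc j)
        then have "ev (a # u) = ev (alt j y x)" using a k xy by (simp add: S_sq_left alt_closed)
        then show ?thesis by blast
      qed
    qed
    from Cons obtain k where "ev u = ev (alt k s t) \<or> ev u = ev (alt k t s)" by auto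
    then show ?case using step[of k s t] step[of k t s] Cons.hyps assms by blast
  qed
  then obtain k where k: "ev u = ev (alt k s t) \<or> ev u = ev (alt k t s)" by blast
  let ?m = "coxeter_m W s t"
  have "k = 2 * ?m * (k div (2 * ?m)) + k mod (2 * ?m)" by simp
  then have "ev (alt k s t) = ev (alt (k mod (2 * ?m)) s t)" "ev (alt k t s) = ev (alt (k mod (2 * ?m)) t s)"
    using ev_alt_period[of s t "k div (2 * ?m)" "k mod (2 * ?m)"]
      ev_alt_period[of t s "k div (2 * ?m)" "k mod (2 * ?m)"] assms
    by (simp_all add: coxeter_m_commute)
  moreover have "k mod (2 * ?m) < 2 * ?m" using ord_pos[of s t] assms by simp
  ultimately show ?thesis using k by metis
qed

lemma alt_refl_eq_first:
  assumes "s \<in> S" "t \<in> S"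
  shows "s = alt_refl s t i \<longleftrightarrow> coxeter_m W s t dvd i"
proof -
  have "s = alt_refl s t i \<longleftrightarrow> (s \<otimes> t) [^] i = \<one>"
    unfolding alt_refl_def using assms by (auto simp: S_carrier dest: sym)
  then show ?thesis using assms by (simp add: pow_eq_id coxeter_m_def S_carrier)
qed

lemma alt_refl_eq_second:
  assumes "s \<in> S" "t \<in> S"
  shows "t = alt_refl s t i \<longleftrightarrow> coxeter_m W s t dvd Suc i"
proof -
  have st: "s \<in> carrier W" "t \<in> carrier W" using assms S_carrier by auto
  have "t = alt_refl s t i \<longleftrightarrow> t \<otimes> t = alt_refl s t i \<otimes> t"
    using st alt_refl_closed[OF assms] by simp
  also have "\<dots> \<longleftrightarrow> (s \<otimes> t) [^] Suc i = \<one>"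
    using st assms by (auto simp: alt_refl_def m_assoc S_sq)
  finally show ?thesis using pow_eq_id[of "s \<otimes> t" "Suc i"] st unfolding coxeter_m_def by simp
qed

text \<open>Among the alternating words of length \<open>k < 2m\<close> only the longest element of the dihedral group,
  \<open>k = m\<close>, has both generators as inversions: if \<open>k < m\<close> the second generator is missing, and
  if \<open>m < k < 2m\<close> the first one occurs twice.\<close>

lemma alt_top:
  assumes "s \<in> S" "t \<in> S" "k < 2 * coxeter_m W s t"
    and "cocyc (alt k s t) s" "cocyc (alt k s t) t"
  shows "k = coxeter_m W s t"
proof -
  let ?m = "coxeter_m W s t"
  have o: "odd (card {i. i < k \<and> ?m dvd i})" "odd (card {i. i < k \<and> ?m dvd Suc i})"
    using assms by (simp_all add: cocyc_alt S_carrier alt_refl_eq_first alt_refl_eq_second)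
  from o(2) obtain i where "i < k" "?m dvd Suc i" by (metis (mono_tags, lifting) card.empty empty_Collect_eq even_zero)
  then have "?m \<le> k" using dvd_imp_le[of ?m "Suc i"] by simp
  moreover have "\<not> ?m < k"
  proof
    assume "?m < k"
    have "{i. i < k \<and> ?m dvd i} = {0, ?m}"
    proof (rule Set.set_eqI)
      fix i show "(i \<in> {i. i < k \<and> ?m dvd i}) = (i \<in> {0, ?m})"
      proof (cases "?m dvd i \<and> i < k")
        case True
        then obtain c where c: "i = ?m * c" by (auto elim: dvdE)
        with True assms(3) have "?m * c < ?m * 2" by linarith
        then have "c < 2" by (simp only: mult_less_cancel1)
        then have "c = 0 \<or> c = 1" by auto
        then show ?thesis using c True by auto
      next
        case False
        then show ?thesis using \<open>?m < k\<close> by auto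
      qed
    qed
    moreover have "?m \<noteq> 0" using ord_pos assms by simp
    ultimately show False using o(1) by simp
  qed
  ultimately show ?thesis by simp
qed

lemma dihedral_top:
  assumes "s \<in> S" "t \<in> S" "u \<in> lists {s, t}" "cocyc u s" "cocyc u t"
  shows "ev u = ev (alt (coxeter_m W s t) s t)"
proof -
  have u: "u \<in> lists S" using assms by (auto simp: in_lists_conv_set)
  obtain k where k: "k < 2 * coxeter_m W s t" "ev u = ev (alt k s t) \<or> ev u = ev (alt k t s)"
    using dihedral_alt[OF assms(1-3)] by blast
  from k(2) show ?thesis
  proof
    assume e: "ev u = ev (alt k s t)"
    then have "cocyc (alt k s t) s" "cocyc (alt k s t) t"
      using assms u cocyc_cong[of u "alt k s t"] by (simp_all add: alt_closed S_carrier)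
    then show ?thesis using alt_top[of s t k] assms k e by simp
  next
    assume e: "ev u = ev (alt k t s)"
    then have "cocyc (alt k t s) s" "cocyc (alt k t s) t"
      using assms u cocyc_cong[of u "alt k t s"] by (simp_all add: alt_closed S_carrier)
    then show ?thesis using alt_top[of t s k] assms k e by (simp add: coxeter_m_commute ev_braid)
  qed
qed

text \<open>The words for minimal representatives of the right cosets of \<open>\<langle>s, t\<rangle>\<close> in \<open>W\<close>.\<close>

definition dihedral_free :: "'w \<Rightarrow> 'w \<Rightarrow> 'w list \<Rightarrow> bool" where
  "dihedral_free s t v \<longleftrightarrow> (\<forall>x\<in>lists {s, t}. \<not> cocyc v (ev x))"

lemma coset_representative:
  assumes st: "s \<in> S" "t \<in> S" and w: "w \<in> carrier W"
  obtains d v where "d \<in> lists {s, t}" "reduced v" "ev (d @ v) = w" "dihedral_free s t v"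
proof -
  have sub: "d \<in> lists S" if "d \<in> lists {s, t}" for d using that st by (auto simp: in_lists_conv_set)
  obtain d where d: "d \<in> lists {s, t}"
    and least: "\<And>d'. d' \<in> lists {s, t} \<Longrightarrow> len (ev d \<otimes> w) \<le> len (ev d' \<otimes> w)"
    using ex_has_least_nat[of "\<lambda>d. d \<in> lists {s, t}" "[]" "\<lambda>d. len (ev d \<otimes> w)"] by auto
  obtain v where v: "reduced v" "ev v = ev d \<otimes> w" using ex_reduced sub[OF d] w by (metis ev_closed m_closed)
  have vS: "v \<in> lists S" using v by (simp add: reduced_def)
  have r: "rev d \<in> lists {s, t}" using d by (simp add: in_lists_conv_set)
  have "ev (rev d @ v) = w"
    using v vS sub[OF r] sub[OF d] w by (simp add: ev_append ev_rev m_assoc[symmetric])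
  moreover have "dihedral_free s t v"
    unfolding dihedral_free_def
  proof (intro ballI notI)
    fix x assume x: "x \<in> lists {s, t}" and c: "cocyc v (ev x)"
    have "len (ev x \<otimes> ev v) < len (ev v)" using len_cocyc[OF vS _ c] sub[OF x] by simp
    moreover have "ev x \<otimes> ev v = ev (x @ d) \<otimes> w"
      using v sub[OF x] sub[OF d] w by (simp add: ev_append m_assoc)
    moreover have "x @ d \<in> lists {s, t}" using x d by simp
    ultimately show False using least[of "x @ d"] v by simp
  qed
  ultimately show ?thesis using that v r by blast
qed

text \<open>The cocycle identity conjugates \<open>x\<close> by \<open>d\<close>, which stays inside \<open>\<langle>s, t\<rangle>\<close>; there a minimal
  representative has no inversions.\<close>

lemma cocyc_dihedral_append:
  assumes "s \<in> S" "t \<in> S" "d \<in> lists {s, t}" "v \<in> lists S" "dihedral_free s t v" "x = s \<or> x = t"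
  shows "cocyc (d @ v) x = cocyc d x"
proof -
  have d: "d \<in> lists S" "rev d \<in> lists S" using assms by (auto simp: in_lists_conv_set)
  have x: "x \<in> S" using assms by auto
  have "rev d @ x # d \<in> lists {s, t}" using assms by (auto simp: in_lists_conv_set)
  moreover have "ev (rev d @ x # d) = inv (ev d) \<otimes> x \<otimes> ev d"
    using d x by (simp add: ev_append ev_rev m_assoc S_carrier)
  ultimately have "\<not> cocyc v (inv (ev d) \<otimes> x \<otimes> ev d)"
    using assms(5) by (metis dihedral_free_def)
  then show ?thesis using cocyc_append[of d v x] d assms x by (simp add: S_carrier)
qed

lemma len_alt_append:
  assumes "s \<in> S" "t \<in> S" "v \<in> lists S" "dihedral_free s t v" "k \<le> coxeter_m W s t"
  shows "len (ev (alt k s t @ v)) = k + len (ev v)"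
  using assms
proof (induction k arbitrary: s t)
  case 0
  then show ?case by simp
next
  case (Suc k)
  have free: "dihedral_free t s v" using Suc.prems by (simp add: dihedral_free_def insert_commute)
  have a: "alt k t s \<in> lists {t, s}" using set_alt[of k t s] by (auto simp: in_lists_conv_set)
  have none: "{i. i < k \<and> coxeter_m W t s dvd Suc i} = {}"
    using Suc.prems by (auto simp: coxeter_m_commute dest: dvd_imp_le)
  then have "\<not> cocyc (alt k t s) s"
    using Suc.prems by (simp only: cocyc_alt S_carrier alt_refl_eq_second none) simp
  then have "\<not> cocyc (alt k t s @ v) s"
    using cocyc_dihedral_append[of t s "alt k t s" v s] free a Suc.prems by simp
  then have "len (s \<otimes> ev (alt k t s @ v)) = Suc (len (ev (alt k t s @ v)))"
    using Suc.prems by (intro len_ascent) (auto simp: alt_closed)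
  then show ?case using Suc.IH[of t s] Suc.prems free by (simp add: coxeter_m_commute)
qed

section \<open>Matsumoto's theorem and the Garside element\<close>

abbreviation pos :: "'w list \<Rightarrow> 'w gword" where
  "pos u \<equiv> map (\<lambda>s. (s, True)) u"

definition artin_eq :: "'w list \<Rightarrow> 'w list \<Rightarrow> bool" where
  "artin_eq u v \<longleftrightarrow> (pos u, pos v) \<in> pres_rel S (artin_relations W S)"

lemma artin_eq_trans: "artin_eq u v \<Longrightarrow> artin_eq v w \<Longrightarrow> artin_eq u w"
  unfolding artin_eq_def by (rule pres_rel.trans)

lemma artin_eq_sym: "artin_eq u v \<Longrightarrow> artin_eq v u"
  unfolding artin_eq_def by (rule pres_rel.sym)

lemma pos_lists: "u \<in> lists S \<Longrightarrow> pos u \<in> lists (S \<times> UNIV)"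
  by (induction u) auto

lemma artin_eq_append:
  assumes "artin_eq u v" "a \<in> lists S" "b \<in> lists S"
  shows "artin_eq (a @ u @ b) (a @ v @ b)"
  using pres_rel_append[of "pos u" "pos v" S _ "pos a" "pos b"] assms
  by (simp add: artin_eq_def pos_lists)

lemma artin_eq_braid:
  assumes "s \<in> S" "t \<in> S" "s \<noteq> t"
  shows "artin_eq (alt (coxeter_m W s t) s t) (alt (coxeter_m W s t) t s)"
proof -
  have "(pos (alt (coxeter_m W s t) s t), pos (alt (coxeter_m W s t) t s)) \<in> artin_relations W S"
    using assms ord_pos[of s t] unfolding artin_relations_def alternating_alt by blast
  from pres_rel.rel[OF _ _ this, of "[]" S "[]"] show ?thesis
    using assms by (simp add: artin_eq_def pos_lists alt_closed)
qed

text \<open>Induction on the length. If the words start with different letters \<open>s\<close> and \<open>t\<close>, both are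
  inversions of \<open>w\<close>, so \<open>w\<close> is the longest element of \<open>\<langle>s, t\<rangle>\<close> times a minimal coset representative
  \<open>y\<close>. Writing the longest element as \<open>s t s \<dots>\<close> and as \<open>t s t \<dots>\<close> gives two reduced words for \<open>w\<close>
  which differ by a braid relation, and each shares its first letter with one of the given words.\<close>

theorem matsumoto:
  assumes "reduced u" "reduced v" "ev u = ev v"
  shows "artin_eq u v"
  using assms
proof (induction "length u" arbitrary: u v)
  case 0
  then have "u = []" "v = []" by (auto simp: reduced_def)
  then show ?case by (auto simp: artin_eq_def intro: pres_rel.refl)
next
  case (Suc n)
  have "length v = Suc n" using Suc by (simp add: reduced_def)
  then obtain s a t b where u: "u = s # a" and v: "v = t # b"
    using Suc.hyps(2) by (metis length_Suc_conv)
  have st: "s \<in> S" "t \<in> S" and red: "reduced a" "reduced b"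
    using reduced_ConsD Suc.prems u v by blast+
  have lists: "a \<in> lists S" "b \<in> lists S" using red by (auto simp: reduced_def)
  have na: "n = length a" "n = length b" using Suc.hyps u v \<open>length v = Suc n\<close> by auto
  show ?case
  proof (cases "s = t")
    case True
    then have "ev a = ev b" using Suc.prems u v st lists by (simp add: S_carrier)
    then have "artin_eq a b" using Suc.hyps(1) na red by blast
    then show ?thesis using artin_eq_append[of a b "[s]" "[]"] True u v st by simp
  next
    case False
    let ?m = "coxeter_m W s t"
    obtain d y where d: "d \<in> lists {s, t}" and y: "reduced y" "dihedral_free s t y"
      and dy: "ev (d @ y) = ev u"
      using coset_representative[OF st, of "ev u"] Suc.prems by (metis ev_closed reduced_def)
    have ylist: "y \<in> lists S" using y by (simp add: reduced_def)
    have dS: "d \<in> lists S" using d st by (auto simp: in_lists_conv_set)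
    have "cocyc u s" "cocyc v t"
      using reduced_ConsD(3) Suc.prems u v st by (auto simp: S_sq S_carrier)
    then have "cocyc (d @ y) s" "cocyc (d @ y) t"
      using cocyc_cong[of "d @ y" u] cocyc_cong[of "d @ y" v] dy Suc.prems dS ylist st
      by (auto simp: reduced_def S_carrier)
    then have "cocyc d s" "cocyc d t"
      using cocyc_dihedral_append[OF st d ylist y(2)] by auto
    then have evd: "ev d = ev (alt ?m s t)" using dihedral_top st d by blast
    have side: "artin_eq (x # c) (alt ?m x z @ y)"
      if xz: "x \<in> S" "z \<in> S" "dihedral_free x z y" "coxeter_m W x z = ?m"
        and c: "reduced (x # c)" "ev (x # c) = ev u" and e: "ev (alt ?m x z) = ev d" for x z c
    proof -
      obtain k where k: "?m = Suc k" using ord_pos[OF st] by (cases ?m) auto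
      let ?c' = "alt k z x @ y"
      have cc: "x # ?c' = alt ?m x z @ y" by (simp add: k)
      have ec: "ev (x # ?c') = ev u"
        unfolding cc using e dy dS ylist xz by (simp add: ev_append alt_closed)
      have "len (ev (alt ?m x z @ y)) = ?m + len (ev y)"
        using len_alt_append[of x z y ?m] xz ylist by simp
      then have "reduced (x # ?c')"
        unfolding cc using y xz ylist by (simp add: reduced_def alt_closed)
      then have "reduced ?c'" by (rule reduced_ConsD)
      moreover have "reduced c" using c reduced_ConsD by blast
      moreover have "ev c = ev ?c'"
      proof -
        have "x \<otimes> ev c = x \<otimes> ev ?c'" using ec c by simp
        then show ?thesis using xz \<open>reduced c\<close> \<open>reduced ?c'\<close> by (simp add: reduced_def S_carrier)
      qed
      moreover have "n = length c"
        using c Suc.hyps(2) Suc.prems(1) unfolding reduced_def by (metis Suc_inject length_Cons)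
      ultimately have "artin_eq c ?c'" using Suc.hyps(1) by blast
      then have "artin_eq (x # c) (x # ?c')" using artin_eq_append[of c ?c' "[x]" "[]"] xz by simp
      then show ?thesis unfolding cc .
    qed
    have "artin_eq u (alt ?m s t @ y)"
      unfolding u using side[of s t a] st y Suc.prems evd u by simp
    moreover have "artin_eq v (alt ?m t s @ y)"
      unfolding v using side[of t s b] st y Suc.prems evd v
      by (simp add: coxeter_m_commute dihedral_free_def insert_commute ev_braid)
    moreover have "artin_eq (alt ?m s t @ y) (alt ?m t s @ y)"
      using artin_eq_append[OF artin_eq_braid[OF st False], of "[]" y] ylist by simp
    ultimately show ?thesis by (blast intro: artin_eq_trans artin_eq_sym)
  qed
qed

text \<open>If \<open>u\<close> can be lengthened to \<open>s u\<close>, then \<open>s\<close> is an inversion of the longest element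
  \<open>w\<^sub>0 = u y\<close> but not of \<open>u\<close>, and the exchange condition removes a letter from \<open>y\<close>.\<close>

lemma longest_factor:
  assumes w0: "w0 \<in> carrier W" "\<And>x. x \<in> carrier W \<Longrightarrow> len x \<le> len w0" and "reduced u"
  shows "\<exists>y\<in>carrier W. w0 = ev u \<otimes> y \<and> len w0 = len (ev u) + len y"
  using assms(3)
proof (induction u)
  case Nil
  have "len \<one> = 0" using len_le[of "[]"] by simp
  then show ?case using w0 by auto
next
  case (Cons s u)
  then have s: "s \<in> S" and u: "reduced u" "u \<in> lists S" and nd: "\<not> cocyc u s"
    using reduced_ConsD by (auto simp: reduced_def)
  obtain y where y: "y \<in> carrier W" "w0 = ev u \<otimes> y" "len w0 = len (ev u) + len y"
    using Cons.IH u by blast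
  obtain v where v: "v \<in> lists S" "ev v = y" using ex_word y by blast
  let ?x = "inv (ev u) \<otimes> s \<otimes> ev u"
  have x: "?x \<in> carrier W" using u s by (simp add: S_carrier)
  have "cocyc (u @ v) s"
  proof (rule ccontr)
    assume "\<not> cocyc (u @ v) s"
    then have "len (s \<otimes> ev (u @ v)) = Suc (len (ev (u @ v)))" using u v s by (intro len_ascent) auto
    then show False using w0(2)[of "s \<otimes> w0"] w0(1) u v y s by (simp add: ev_append S_carrier)
  qed
  then have "cocyc v ?x" using nd cocyc_append[of u v s] u v s by (simp add: S_carrier)
  then have l: "len (?x \<otimes> y) < len y" using len_cocyc[of v ?x] v x by simp
  have e: "w0 = ev (s # u) \<otimes> (?x \<otimes> y)"
    using y u s by (simp add: m_assoc S_carrier) (simp add: m_assoc[symmetric] S_carrier S_sq)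
  have "len w0 \<le> len (ev (s # u)) + len (?x \<otimes> y)"
    unfolding e using x y u s by (intro len_mult_le) (auto simp: S_carrier)
  moreover have "len (ev (s # u)) = Suc (len (ev u))" using len_ascent u s nd by simp
  ultimately have "len w0 = len (ev (s # u)) + len (?x \<otimes> y)" using l y by simp
  then show ?case using e x y by blast
qed

text \<open>For a generator \<open>s\<close>, factor the longest element as \<open>w\<^sub>0 = s y = y t\<close> with reduced products; then
  \<open>t\<close> is again a generator. By Matsumoto's theorem the lift satisfies \<open>\<Delta> = g\<^sub>s Y = Y g\<^sub>t\<close>, hence
  \<open>g\<^sub>s \<Delta> = \<Delta> g\<^sub>t\<close>. As \<open>w\<^sub>0\<close> is an involution, doing this twice returns to \<open>s\<close>.\<close>

theorem central_positive_word:
  assumes "S \<noteq> {}"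
  obtains u where "u \<in> lists S" "u \<noteq> []" "\<And>s. s \<in> S \<Longrightarrow> artin_eq ([s] @ u) (u @ [s])"
proof -
  have "\<exists>w0\<in>carrier W. \<forall>x\<in>carrier W. len x \<le> len w0"
  proof -
    have "finite (len ` carrier W)" "len ` carrier W \<noteq> {}" using fin by auto
    then have "Max (len ` carrier W) \<in> len ` carrier W" "\<And>x. x \<in> carrier W \<Longrightarrow> len x \<le> Max (len ` carrier W)"
      by (auto intro: Max_in)
    then show ?thesis by (metis (no_types, lifting) imageE)
  qed
  then obtain w0 where w0: "w0 \<in> carrier W" and max: "\<And>x. x \<in> carrier W \<Longrightarrow> len x \<le> len w0" by blast
  have factor: "\<exists>y\<in>carrier W. w0 = x \<otimes> y \<and> len w0 = len x + len y" if "x \<in> carrier W" for x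
    using longest_factor[OF w0 max] ex_reduced[OF that] by metis
  obtain u where u: "reduced u" "ev u = w0" using ex_reduced w0 by blast
  have uS: "u \<in> lists S" using u by (simp add: reduced_def)
  have conj: "\<exists>t\<in>S. artin_eq ([s] @ u) (u @ [t]) \<and> s \<otimes> w0 = w0 \<otimes> t" if s: "s \<in> S" for s
  proof -
    obtain y where y: "y \<in> carrier W" "w0 = s \<otimes> y" "len w0 = len s + len y"
      using factor s S_carrier by blast
    obtain z where z: "z \<in> carrier W" "w0 = y \<otimes> z" "len w0 = len y + len z"
      using factor y by blast
    have "len z = 1" using y z len_gen[OF s] by simp
    moreover obtain zw where zw: "reduced zw" "ev zw = z" using ex_reduced z by blast
    ultimately have "length zw = 1" by (simp add: reduced_def)
    then obtain t where t: "zw = [t]" by (auto simp: length_Suc_conv)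
    then have tS: "t \<in> S" "z = t" using zw by (auto simp: reduced_def S_carrier)
    obtain b where b: "reduced b" "ev b = y" using ex_reduced y by blast
    have bS: "b \<in> lists S" using b by (simp add: reduced_def)
    have "reduced (s # b)" using b bS s y len_gen[OF s] by (simp add: reduced_def)
    moreover have "ev (b @ [t]) = w0" using b bS tS z by (simp add: ev_append S_carrier)
    then have "reduced (b @ [t])" using b bS tS z len_gen[of t] by (simp add: reduced_def)
    moreover have "ev (s # b) = w0" using b y by simp
    ultimately have 1: "artin_eq (s # b) u" "artin_eq u (b @ [t])"
      using u \<open>ev (b @ [t]) = w0\<close> by (auto intro!: matsumoto)
    have "artin_eq ([s] @ u) ([s] @ b @ [t])"
      using artin_eq_append[OF 1(2), of "[s]" "[]"] s by simp
    moreover have "artin_eq ([s] @ b @ [t]) (u @ [t])"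
      using artin_eq_append[OF 1(1), of "[]" "[t]"] tS by simp
    ultimately have "artin_eq ([s] @ u) (u @ [t])" by (rule artin_eq_trans)
    moreover have "s \<otimes> w0 = w0 \<otimes> t"
    proof -
      have "s \<otimes> (y \<otimes> t) = s \<otimes> y \<otimes> t" using s y tS by (simp add: m_assoc S_carrier)
      then show ?thesis using y(2) z(2) tS(2) by metis
    qed
    ultimately show ?thesis using tS by blast
  qed
  \<comment> \<open>factoring \<open>w\<^sub>0 = w\<^sub>0\<^bsup>-1\<^esup> y\<close> leaves no length for \<open>y\<close>\<close>
  have sq: "w0 \<otimes> w0 = \<one>"
  proof -
    obtain y where y: "y \<in> carrier W" "w0 = inv w0 \<otimes> y" "len w0 = len (inv w0) + len y"
      using factor w0 by blast
    have "len w0 \<le> len (inv w0)" using len_inv_le[of "inv w0"] w0 by simp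
    then have "y = \<one>" using y len_eq_0 by simp
    then have "w0 = inv w0" using y w0 by simp
    then show ?thesis using w0 by (metis r_inv)
  qed
  have "artin_eq ([s] @ (u @ u)) ((u @ u) @ [s])" if s: "s \<in> S" for s
  proof -
    obtain t where t: "t \<in> S" "artin_eq ([s] @ u) (u @ [t])" "s \<otimes> w0 = w0 \<otimes> t" using conj s by blast
    obtain r where r: "r \<in> S" "artin_eq ([t] @ u) (u @ [r])" "t \<otimes> w0 = w0 \<otimes> r" using conj t by blast
    have "s = s \<otimes> (w0 \<otimes> w0)" using sq s by (simp add: S_carrier)
    also have "\<dots> = w0 \<otimes> (t \<otimes> w0)" using s t w0 by (simp add: m_assoc[symmetric] S_carrier)
    also have "\<dots> = r" using sq r w0 by (simp add: m_assoc[symmetric] S_carrier)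
    finally have "s = r" .
    have "artin_eq ([s] @ u @ u) (u @ [t] @ u)"
      using artin_eq_append[OF t(2), of "[]" u] uS by simp
    moreover have "artin_eq (u @ [t] @ u) (u @ u @ [r])"
      using artin_eq_append[OF r(2), of u "[]"] uS by simp
    ultimately show ?thesis using \<open>s = r\<close> by (auto intro: artin_eq_trans)
  qed
  moreover have "u \<noteq> []"
  proof
    assume "u = []"
    then have "len w0 = 0" using u by (simp add: reduced_def)
    moreover obtain s where "s \<in> S" using assms by blast
    ultimately show False using max[of s] len_gen[of s] by (simp add: S_carrier)
  qed
  ultimately show ?thesis using that[of "u @ u"] uS by simp
qed

end

section \<open>Quotient modules and a Mayer--Vietoris isomorphism\<close>

lemma (in abelian_group) additive_subgroup_criterion:
  assumes "Q \<subseteq> carrier G" "\<zero> \<in> Q" "\<And>x y. x \<in> Q \<Longrightarrow> y \<in> Q \<Longrightarrow> x \<oplus> y \<in> Q" "\<And>x. x \<in> Q \<Longrightarrow> \<ominus> x \<in> Q"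
  shows "additive_subgroup Q G"
  using assms by (intro additive_subgroupI add.subgroupI) (auto simp: a_inv_def)

lemma (in abelian_group) additive_subgroup_restrict:
  assumes "additive_subgroup D G" "additive_subgroup Q G" "D \<subseteq> Q"
  shows "additive_subgroup D (G\<lparr>carrier := Q\<rparr>)"
  using add.subgroup_incl assms by (auto simp: additive_subgroup_def)

lemma (in abelian_group) a_inv_restrict:
  assumes "additive_subgroup Q G" "x \<in> Q"
  shows "\<ominus>\<^bsub>G\<lparr>carrier := Q\<rparr>\<^esub> x = \<ominus> x"
  using add.m_inv_consistent[OF additive_subgroup.a_subgroup[OF assms(1)] assms(2)] by (simp add: a_inv_def)

lemma abelian_group_restrict:
  assumes "abelian_group N" "additive_subgroup Q N"
  shows "abelian_group (N\<lparr>carrier := Q\<rparr>)"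
proof -
  interpret N: abelian_group N by fact
  interpret Q: additive_subgroup Q N by fact
  have "\<exists>y\<in>Q. y \<oplus>\<^bsub>N\<^esub> x = \<zero>\<^bsub>N\<^esub>" if "x \<in> Q" for x
    using that Q.a_subset N.l_neg by (intro bexI[of _ "\<ominus>\<^bsub>N\<^esub> x"]) auto
  moreover have "\<And>x. x \<in> Q \<Longrightarrow> x \<in> carrier N" by auto
  ultimately show ?thesis
    by (intro abelian_groupI) (simp_all add: N.a_assoc, simp add: N.a_comm)
qed

lemma (in abelian_subgroup) a_coset_eq_iff:
  assumes "x \<in> carrier G" "y \<in> carrier G"
  shows "H +> x = H +> y \<longleftrightarrow> x \<ominus> y \<in> H"
proof -
  have "H +> x = H +> y \<longleftrightarrow> x \<in> H +> y"
    using a_rcos_self[OF assms(1)] a_repr_independence'[OF _ assms(2)] by metis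
  then show ?thesis using a_rcos_module[OF assms(2,1)] by (simp add: minus_eq)
qed

lemma quotient_module_laws:
  fixes M (structure)
  assumes M: "abelian_group M" "additive_subgroup D M"
  shows "carrier (quotient_module M D) = (\<lambda>x. D +> x) ` carrier M"
    and "x \<in> carrier M \<Longrightarrow> y \<in> carrier M \<Longrightarrow>
      (D +> x) \<oplus>\<^bsub>quotient_module M D\<^esub> (D +> y) = D +> (x \<oplus> y)"
    and "x \<in> carrier M \<Longrightarrow> (\<And>y. y \<in> carrier M \<Longrightarrow> r \<odot> y \<in> carrier M) \<Longrightarrow>
      (\<And>y. y \<in> D \<Longrightarrow> r \<odot> y \<in> D) \<Longrightarrow>
      (\<And>y. y \<in> D \<Longrightarrow> r \<odot> (y \<oplus> x) = r \<odot> y \<oplus> r \<odot> x) \<Longrightarrow>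
      r \<odot>\<^bsub>quotient_module M D\<^esub> (D +> x) = D +> (r \<odot> x)"
proof -
  interpret M: abelian_group M by fact
  interpret D: abelian_subgroup D M using M by (intro abelian_subgroupI3)
  show "carrier (quotient_module M D) = (\<lambda>x. D +> x) ` carrier M"
    by (auto simp: quotient_module_def A_RCOSETS_def')
  show "(D +> x) \<oplus>\<^bsub>quotient_module M D\<^esub> (D +> y) = D +> (x \<oplus> y)"
    if "x \<in> carrier M" "y \<in> carrier M"
    using D.a_rcos_sum that by (simp add: quotient_module_def)
  assume x: "x \<in> carrier M" and r: "\<And>y. y \<in> carrier M \<Longrightarrow> r \<odot> y \<in> carrier M"
    "\<And>y. y \<in> D \<Longrightarrow> r \<odot> y \<in> D"
    "\<And>y. y \<in> D \<Longrightarrow> r \<odot> (y \<oplus> x) = r \<odot> y \<oplus> r \<odot> x"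
  have "D +> (r \<odot> y) = D +> (r \<odot> x)" if y: "y \<in> D +> x" for y
  proof -
    obtain d where d: "d \<in> D" "y = d \<oplus> x" using y by (auto simp: a_r_coset_def')
    have c: "r \<odot> d \<in> carrier M" "r \<odot> x \<in> carrier M" using r(1) x d(1) by auto
    have "r \<odot> y = r \<odot> d \<oplus> r \<odot> x" using r(3)[OF d(1)] d(2) by simp
    then have "r \<odot> y \<ominus> r \<odot> x = r \<odot> d" using c by (simp add: M.minus_eq M.a_assoc M.r_neg)
    then show ?thesis
      using D.a_coset_eq_iff[of "r \<odot> y" "r \<odot> x"] r(2)[OF d(1)] c \<open>r \<odot> y = _\<close> by simp
  qed
  then have "(\<Union>y\<in>D +> x. D +> (r \<odot> y)) = D +> (r \<odot> x)"
    by (intro UN_constant_eq[OF D.a_rcos_self[OF x]]) blast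
  then show "r \<odot>\<^bsub>quotient_module M D\<^esub> (D +> x) = D +> (r \<odot> x)"
    by (simp add: quotient_module_def)
qed

text \<open>Connecting homomorphisms are defined through choices. To avoid well-definedness arguments for
  a chosen function, the isomorphism is obtained from the additive relation \<open>E\<close> of all pairs that
  correspond to each other under some choice.\<close>

lemma quotient_module_isomorphic:
  fixes M :: "('r, 'm, 'u) module_scheme" (structure) and M' :: "('r, 'n, 'v) module_scheme"
  assumes M: "abelian_group M" "additive_subgroup D M"
    and M': "abelian_group M'" "additive_subgroup D' M'"
    and sm: "\<And>r x. r \<in> carrier R \<Longrightarrow> x \<in> carrier M \<Longrightarrow> r \<odot> x \<in> carrier M"
      "\<And>r x y. r \<in> carrier R \<Longrightarrow> x \<in> carrier M \<Longrightarrow> y \<in> carrier M \<Longrightarrow>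
         r \<odot> (x \<oplus> y) = r \<odot> x \<oplus> r \<odot> y"
      "\<And>r x. r \<in> carrier R \<Longrightarrow> x \<in> D \<Longrightarrow> r \<odot> x \<in> D"
    and sm': "\<And>r x. r \<in> carrier R \<Longrightarrow> x \<in> carrier M' \<Longrightarrow> r \<odot>\<^bsub>M'\<^esub> x \<in> carrier M'"
      "\<And>r x y. r \<in> carrier R \<Longrightarrow> x \<in> carrier M' \<Longrightarrow> y \<in> carrier M' \<Longrightarrow>
         r \<odot>\<^bsub>M'\<^esub> (x \<oplus>\<^bsub>M'\<^esub> y) = r \<odot>\<^bsub>M'\<^esub> x \<oplus>\<^bsub>M'\<^esub> r \<odot>\<^bsub>M'\<^esub> y"
      "\<And>r x. r \<in> carrier R \<Longrightarrow> x \<in> D' \<Longrightarrow> r \<odot>\<^bsub>M'\<^esub> x \<in> D'"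
    and E: "\<And>x y. E x y \<Longrightarrow> x \<in> carrier M \<and> y \<in> carrier M'"
    and E_add: "\<And>x y x' y'. E x y \<Longrightarrow> E x' y' \<Longrightarrow> E (x \<oplus> x') (y \<oplus>\<^bsub>M'\<^esub> y')"
    and E_neg: "\<And>x y. E x y \<Longrightarrow> E (\<ominus> x) (\<ominus>\<^bsub>M'\<^esub> y)"
    and E_smult: "\<And>r x y. r \<in> carrier R \<Longrightarrow> E x y \<Longrightarrow> E (r \<odot> x) (r \<odot>\<^bsub>M'\<^esub> y)"
    and total: "\<And>x. x \<in> carrier M \<Longrightarrow> \<exists>y. E x y" "\<And>y. y \<in> carrier M' \<Longrightarrow> \<exists>x. E x y"
    and E_iff: "\<And>x y. E x y \<Longrightarrow> x \<in> D \<longleftrightarrow> y \<in> D'"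
  shows "module_isomorphic R (quotient_module M D) (quotient_module M' D')"
proof -
  interpret M: abelian_group M by fact
  interpret D: abelian_subgroup D M using M by (intro abelian_subgroupI3)
  interpret M': abelian_group M' by fact
  interpret D': abelian_subgroup D' M' using M' by (intro abelian_subgroupI3)
  note laws = quotient_module_laws[OF M] and laws' = quotient_module_laws[OF M']
  have wd: "D +> x = D +> x' \<longleftrightarrow> D' +>\<^bsub>M'\<^esub> y = D' +>\<^bsub>M'\<^esub> y'" if "E x y" "E x' y'" for x y x' y'
    using E_iff[OF E_add[OF that(1) E_neg[OF that(2)]]] E[OF that(1)] E[OF that(2)]
    by (simp add: D.a_coset_eq_iff D'.a_coset_eq_iff M.minus_eq M'.minus_eq)
  define h where "h X = D' +>\<^bsub>M'\<^esub> (SOME y. \<exists>x. X = D +> x \<and> E x y)" for X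
  have h: "h (D +> x) = D' +>\<^bsub>M'\<^esub> y" if e: "E x y" for x y
  proof -
    let ?P = "\<lambda>y. \<exists>x'. D +> x = D +> x' \<and> E x' y"
    have "?P (SOME y. ?P y)" by (rule someI[of ?P y]) (use e in blast)
    then obtain x' where "D +> x = D +> x'" "E x' (SOME y. ?P y)" by (elim exE conjE)
    then show ?thesis using wd[OF e, of x' "SOME y. ?P y"] by (simp add: h_def)
  qed
  have rep: "\<exists>x y. X = D +> x \<and> E x y" if "X \<in> carrier (quotient_module M D)" for X
    using that total(1) unfolding laws(1) by blast
  have "bij_betw h (carrier (quotient_module M D)) (carrier (quotient_module M' D'))"
    unfolding bij_betw_def
  proof
    show "inj_on h (carrier (quotient_module M D))"
    proof (rule inj_onI)
      fix X X' assume X: "X \<in> carrier (quotient_module M D)" "X' \<in> carrier (quotient_module M D)" and e: "h X = h X'"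
      from X obtain x y x' y' where "X = D +> x" "E x y" "X' = D +> x'" "E x' y'"
        using rep[OF X(1)] rep[OF X(2)] by (elim exE conjE)
      then show "X = X'" using wd[of x y x' y'] e by (simp add: h)
    qed
    show "h ` carrier (quotient_module M D) = carrier (quotient_module M' D')"
    proof (intro equalityI subsetI)
      fix Y assume "Y \<in> h ` carrier (quotient_module M D)"
      then obtain X where "X \<in> carrier (quotient_module M D)" "Y = h X" by blast
      then show "Y \<in> carrier (quotient_module M' D')" using rep[of X] h E by (auto simp: laws')
    next
      fix Y assume "Y \<in> carrier (quotient_module M' D')"
      then obtain x y where "Y = D' +>\<^bsub>M'\<^esub> y" "E x y" using total(2) unfolding laws'(1) by blast
      then show "Y \<in> h ` carrier (quotient_module M D)"
        using h E by (intro image_eqI[of _ _ "D +> x"]) (auto simp: laws)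
    qed
  qed
  moreover have "h (X \<oplus>\<^bsub>quotient_module M D\<^esub> X') = h X \<oplus>\<^bsub>quotient_module M' D'\<^esub> h X'"
    if X: "X \<in> carrier (quotient_module M D)" "X' \<in> carrier (quotient_module M D)" for X X'
  proof -
    obtain x y x' y' where e: "X = D +> x" "E x y" "X' = D +> x'" "E x' y'"
      using rep[OF X(1)] rep[OF X(2)] by (elim exE conjE)
    then show ?thesis using E[OF e(2)] E[OF e(4)] by (simp add: laws laws' h[OF E_add[OF e(2,4)]] h)
  qed
  moreover have "h (r \<odot>\<^bsub>quotient_module M D\<^esub> X) = r \<odot>\<^bsub>quotient_module M' D'\<^esub> h X"
    if X: "X \<in> carrier (quotient_module M D)" and r: "r \<in> carrier R" for r X
  proof -
    obtain x y where e: "X = D +> x" "E x y" using rep[OF X] by (elim exE conjE)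
    then show ?thesis using E[OF e(2)] by (simp add: laws(3) laws'(3) sm[OF r] sm'[OF r] h[OF E_smult[OF r e(2)]] h)
  qed
  ultimately show ?thesis unfolding module_isomorphic_def by blast
qed

text \<open>A cochain complex \<open>C\<close> that is the sum of two acyclic subcomplexes \<open>F True\<close> and \<open>F False\<close>.\<close>

locale acyclic_cover =
  fixes R :: "('r, 'y) ring_scheme" and C :: "nat \<Rightarrow> ('r, 'c, 'u) module_scheme"
    and d :: "nat \<Rightarrow> 'c \<Rightarrow> 'c" and F :: "bool \<Rightarrow> nat \<Rightarrow> 'c set"
  assumes group: "\<And>n. abelian_group (C n)"
    and d_closed: "\<And>n f. f \<in> carrier (C n) \<Longrightarrow> d n f \<in> carrier (C (Suc n))"
    and d_add: "\<And>n f g. f \<in> carrier (C n) \<Longrightarrow> g \<in> carrier (C n) \<Longrightarrow>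
          d n (f \<oplus>\<^bsub>C n\<^esub> g) = d n f \<oplus>\<^bsub>C (Suc n)\<^esub> d n g"
    and d_smult: "\<And>n r f. r \<in> carrier R \<Longrightarrow> f \<in> carrier (C n) \<Longrightarrow>
          d n (r \<odot>\<^bsub>C n\<^esub> f) = r \<odot>\<^bsub>C (Suc n)\<^esub> d n f"
    and d_d: "\<And>n f. f \<in> carrier (C n) \<Longrightarrow> d (Suc n) (d n f) = \<zero>\<^bsub>C (Suc (Suc n))\<^esub>"
    and smult_closed: "\<And>n r f. r \<in> carrier R \<Longrightarrow> f \<in> carrier (C n) \<Longrightarrow> r \<odot>\<^bsub>C n\<^esub> f \<in> carrier (C n)"
    and smult_add: "\<And>n r f g. r \<in> carrier R \<Longrightarrow> f \<in> carrier (C n) \<Longrightarrow> g \<in> carrier (C n) \<Longrightarrow>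
          r \<odot>\<^bsub>C n\<^esub> (f \<oplus>\<^bsub>C n\<^esub> g) = r \<odot>\<^bsub>C n\<^esub> f \<oplus>\<^bsub>C n\<^esub> r \<odot>\<^bsub>C n\<^esub> g"
    and sub: "\<And>b n. additive_subgroup (F b n) (C n)"
    and sub_smult: "\<And>b n r f. r \<in> carrier R \<Longrightarrow> f \<in> F b n \<Longrightarrow> r \<odot>\<^bsub>C n\<^esub> f \<in> F b n"
    and sub_d: "\<And>b n f. f \<in> F b n \<Longrightarrow> d n f \<in> F b (Suc n)"
    and cover: "\<And>n f. f \<in> carrier (C n) \<Longrightarrow> \<exists>u\<in>F True n. \<exists>v\<in>F False n. f = u \<oplus>\<^bsub>C n\<^esub> v"
    and acyclic_0: "\<And>b f. f \<in> F b 0 \<Longrightarrow> d 0 f = \<zero>\<^bsub>C (Suc 0)\<^esub> \<Longrightarrow> f = \<zero>\<^bsub>C 0\<^esub>"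
    and acyclic_Suc: "\<And>b n f. f \<in> F b (Suc n) \<Longrightarrow> d (Suc n) f = \<zero>\<^bsub>C (Suc (Suc n))\<^esub> \<Longrightarrow> \<exists>e\<in>F b n. d n e = f"
begin

lemma F_carrier: "f \<in> F b n \<Longrightarrow> f \<in> carrier (C n)"
  using additive_subgroup.a_Hcarr[OF sub] .

lemma d_zero: "d n \<zero>\<^bsub>C n\<^esub> = \<zero>\<^bsub>C (Suc n)\<^esub>"
proof -
  interpret C: abelian_group "C n" by (rule group)
  interpret C': abelian_group "C (Suc n)" by (rule group)
  have "d n \<zero>\<^bsub>C n\<^esub> \<oplus>\<^bsub>C (Suc n)\<^esub> d n \<zero>\<^bsub>C n\<^esub> = d n \<zero>\<^bsub>C n\<^esub>"
    using d_add[of "\<zero>\<^bsub>C n\<^esub>" n "\<zero>\<^bsub>C n\<^esub>"] by simp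
  then show ?thesis using d_closed[OF C.zero_closed] by (metis C'.add.l_cancel_one)
qed

lemma d_neg: "f \<in> carrier (C n) \<Longrightarrow> d n (\<ominus>\<^bsub>C n\<^esub> f) = \<ominus>\<^bsub>C (Suc n)\<^esub> d n f"
proof -
  assume f: "f \<in> carrier (C n)"
  interpret C: abelian_group "C n" by (rule group)
  interpret C': abelian_group "C (Suc n)" by (rule group)
  have "d n (\<ominus>\<^bsub>C n\<^esub> f) \<oplus>\<^bsub>C (Suc n)\<^esub> d n f = \<zero>\<^bsub>C (Suc n)\<^esub>"
    using f d_add[of "\<ominus>\<^bsub>C n\<^esub> f" n f] by (simp add: C.l_neg d_zero)
  then show ?thesis using f by (intro C'.minus_equality[symmetric]) (auto intro: d_closed)
qed

lemma smult_zero: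
  assumes "r \<in> carrier R" shows "r \<odot>\<^bsub>C n\<^esub> \<zero>\<^bsub>C n\<^esub> = \<zero>\<^bsub>C n\<^esub>"
proof -
  interpret C: abelian_group "C n" by (rule group)
  have "r \<odot>\<^bsub>C n\<^esub> \<zero>\<^bsub>C n\<^esub> \<oplus>\<^bsub>C n\<^esub> r \<odot>\<^bsub>C n\<^esub> \<zero>\<^bsub>C n\<^esub> = r \<odot>\<^bsub>C n\<^esub> \<zero>\<^bsub>C n\<^esub>"
    using smult_add[OF assms, of "\<zero>\<^bsub>C n\<^esub>" n "\<zero>\<^bsub>C n\<^esub>"] by simp
  then show ?thesis using smult_closed[OF assms C.zero_closed] by (metis C.add.l_cancel_one)
qed

lemma d_kernel: "additive_subgroup {f \<in> carrier (C n). d n f = \<zero>\<^bsub>C (Suc n)\<^esub>} (C n)"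
proof -
  interpret C: abelian_group "C n" by (rule group)
  interpret C': abelian_group "C (Suc n)" by (rule group)
  show ?thesis by (rule C.additive_subgroup_criterion) (auto simp: d_add d_neg d_zero)
qed

lemma d_image:
  assumes "additive_subgroup Q (C n)" shows "additive_subgroup (d n ` Q) (C (Suc n))"
proof -
  interpret C: abelian_group "C n" by (rule group)
  interpret C': abelian_group "C (Suc n)" by (rule group)
  interpret Q: additive_subgroup Q "C n" by fact
  show ?thesis
  proof (rule C'.additive_subgroup_criterion)
    show "d n ` Q \<subseteq> carrier (C (Suc n))" by (auto simp: d_closed)
    show "\<zero>\<^bsub>C (Suc n)\<^esub> \<in> d n ` Q" by (rule image_eqI[of _ _ "\<zero>\<^bsub>C n\<^esub>"]) (simp_all add: d_zero)
  next
    fix x y assume "x \<in> d n ` Q" "y \<in> d n ` Q"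
    then obtain p r where "p \<in> Q" "r \<in> Q" "x = d n p" "y = d n r" by blast
    then show "x \<oplus>\<^bsub>C (Suc n)\<^esub> y \<in> d n ` Q" by (intro image_eqI[of _ _ "p \<oplus>\<^bsub>C n\<^esub> r"]) (auto simp: d_add)
  next
    fix x assume "x \<in> d n ` Q"
    then obtain p where "p \<in> Q" "x = d n p" by blast
    then show "\<ominus>\<^bsub>C (Suc n)\<^esub> x \<in> d n ` Q" by (intro image_eqI[of _ _ "\<ominus>\<^bsub>C n\<^esub> p"]) (auto simp: d_neg)
  qed
qed

text \<open>A coboundary \<open>d a\<close> splits along with \<open>a\<close>; conversely two cocycles of the subcomplexes are
  coboundaries there. In degree \<open>0\<close> both sides say that \<open>f = 0\<close>.\<close>

lemma coboundary_iff_split: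
  "f \<in> coboundaries C d (int n) \<longleftrightarrow>
     (\<exists>u\<in>F True n. \<exists>v\<in>F False n. d n u = \<zero>\<^bsub>C (Suc n)\<^esub> \<and> d n v = \<zero>\<^bsub>C (Suc n)\<^esub> \<and> f = u \<oplus>\<^bsub>C n\<^esub> v)"
  (is "_ \<longleftrightarrow> ?split f")
proof -
  interpret C: abelian_group "C n" by (rule group)
  show ?thesis
  proof (cases n)
    case 0
    interpret C0: abelian_group "C 0" by (rule group)
    have "?split f \<longleftrightarrow> f = \<zero>\<^bsub>C 0\<^esub>"
    proof
      assume "?split f"
      then obtain u v where uv: "u \<in> F True 0" "v \<in> F False 0" "d 0 u = \<zero>\<^bsub>C (Suc 0)\<^esub>" "d 0 v = \<zero>\<^bsub>C (Suc 0)\<^esub>"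
        "f = u \<oplus>\<^bsub>C 0\<^esub> v" using 0 by auto
      then have "u = \<zero>\<^bsub>C 0\<^esub>" "v = \<zero>\<^bsub>C 0\<^esub>" using acyclic_0 by auto
      then show "f = \<zero>\<^bsub>C 0\<^esub>" using uv(5) by simp
    next
      assume "f = \<zero>\<^bsub>C 0\<^esub>"
      then show "?split f"
        using 0 additive_subgroup.zero_closed[OF sub]
        by (intro bexI[of _ "\<zero>\<^bsub>C n\<^esub>"]) (auto simp: d_zero)
    qed
    then show ?thesis by (simp add: coboundaries_def 0)
  next
    case (Suc m)
    interpret Cm: abelian_group "C m" by (rule group)
    have "?split (d m a)" if a: "a \<in> carrier (C m)" for a
    proof -
      obtain u v where uv: "u \<in> F True m" "v \<in> F False m" "a = u \<oplus>\<^bsub>C m\<^esub> v" using cover[OF a] by blast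
      then have "d m a = d m u \<oplus>\<^bsub>C n\<^esub> d m v" using d_add Suc by (simp add: F_carrier)
      moreover have "d n (d m u) = \<zero>\<^bsub>C (Suc n)\<^esub>" "d n (d m v) = \<zero>\<^bsub>C (Suc n)\<^esub>"
        using uv Suc by (simp_all add: d_d F_carrier)
      ultimately show ?thesis using uv sub_d Suc by metis
    qed
    moreover have "u \<oplus>\<^bsub>C n\<^esub> v \<in> d m ` carrier (C m)"
      if uv: "u \<in> F True n" "v \<in> F False n" "d n u = \<zero>\<^bsub>C (Suc n)\<^esub>" "d n v = \<zero>\<^bsub>C (Suc n)\<^esub>" for u v
    proof -
      obtain a b where ab: "a \<in> F True m" "d m a = u" "b \<in> F False m" "d m b = v"
        using acyclic_Suc uv Suc by metis
      have "u \<oplus>\<^bsub>C n\<^esub> v = d m (a \<oplus>\<^bsub>C m\<^esub> b)" using ab Suc by (simp add: d_add F_carrier)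
      then show ?thesis using ab by (simp add: F_carrier)
    qed
    ultimately show ?thesis by (auto simp: coboundaries_def Suc)
  qed
qed

text \<open>If \<open>f = u + v\<close> is a cocycle with \<open>u\<close> and \<open>v\<close> in the two subcomplexes, then \<open>d u = - d v\<close> lies in
  their intersection; the connecting homomorphism sends the class of \<open>f\<close> to that of \<open>d u\<close>. The
  index \<open>-1\<close> is included: it says that the intersection has no cohomology in degree \<open>0\<close>.\<close>

theorem cohomology_shift:
  fixes d' :: "nat \<Rightarrow> 'c \<Rightarrow> 'c"
  assumes d': "\<And>n f. f \<in> F True n \<inter> F False n \<Longrightarrow> d' n f = d n f"
  shows "module_isomorphic R (cohomology C d i)
           (cohomology (\<lambda>n. (C n)\<lparr>carrier := F True n \<inter> F False n\<rparr>) d' (i + 1))"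
proof (cases "i < 0")
  let ?P = "\<lambda>n. (C n)\<lparr>carrier := F True n \<inter> F False n\<rparr>"
  case True
  have "\<zero>\<^bsub>C 0\<^esub> \<in> F b 0" for b using additive_subgroup.zero_closed[OF sub] .
  then have "cocycles ?P d' (i + 1) = {\<zero>\<^bsub>C 0\<^esub>}"
    using True acyclic_0 d' d_zero by (auto simp: cocycles_def)
  then have "cohomology ?P d' (i + 1) = cohomology C d i"
    using True by (simp add: cohomology_def cocycles_def coboundaries_def)
  then show ?thesis unfolding module_isomorphic_def by (simp, intro exI[of _ id]) auto
next
  let ?P = "\<lambda>n. (C n)\<lparr>carrier := F True n \<inter> F False n\<rparr>"
  case False
  define n where "n = nat i"
  have i: "i = int n" and n1: "nat (i + 1) = Suc n" using False by (auto simp: n_def)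
  interpret C: abelian_group "C n" by (rule group)
  interpret C': abelian_group "C (Suc n)" by (rule group)
  interpret F1: additive_subgroup "F True n" "C n" by (rule sub)
  interpret F2: additive_subgroup "F False n" "C n" by (rule sub)
  interpret F1': additive_subgroup "F True (Suc n)" "C (Suc n)" by (rule sub)
  interpret F2': additive_subgroup "F False (Suc n)" "C (Suc n)" by (rule sub)
  define Z where "Z = {f \<in> carrier (C n). d n f = \<zero>\<^bsub>C (Suc n)\<^esub>}"
  define B where "B = coboundaries C d i"
  define Z' where "Z' = {f \<in> F True (Suc n) \<inter> F False (Suc n). d (Suc n) f = \<zero>\<^bsub>C (Suc (Suc n))\<^esub>}"
  define B' where "B' = d n ` (F True n \<inter> F False n)"
  let ?M = "(C n)\<lparr>carrier := Z\<rparr>" and ?M' = "(C (Suc n))\<lparr>carrier := Z'\<rparr>"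
  have coh: "cohomology C d i = quotient_module ?M B"
    by (simp add: cohomology_def B_def Z_def cocycles_def i)
  have coh': "cohomology ?P d' (i + 1) = quotient_module ?M' B'"
  proof -
    have "cocycles ?P d' (i + 1) = Z'" using d' by (auto simp: cocycles_def n1 Z'_def i nat_add_distrib)
    moreover have "coboundaries ?P d' (i + 1) = B'"
      using d' by (auto simp: coboundaries_def B'_def i intro!: image_cong)
    ultimately show ?thesis by (simp add: cohomology_def n1)
  qed
  have B_sub: "additive_subgroup B (C n)"
  proof (cases n)
    case 0
    interpret C0: abelian_group "C 0" by (rule group)
    show ?thesis using 0 by (intro C.additive_subgroup_criterion) (auto simp: B_def coboundaries_def i)
  next
    case (Suc m)
    interpret Cm: abelian_group "C m" by (rule group)
    have "additive_subgroup (carrier (C m)) (C m)" by (rule Cm.additive_subgroup_criterion) auto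
    from d_image[OF this] show ?thesis by (simp add: B_def coboundaries_def i Suc)
  qed
  have B_Z: "B \<subseteq> Z" unfolding B_def i by (auto simp: coboundary_iff_split Z_def F_carrier d_add)
  have int: "additive_subgroup (F True m \<inter> F False m) (C m)" for m
    using additive_subgroup.a_subgroup[OF sub] abelian_group.a_group[OF group]
    by (intro additive_subgroupI group.subgroups_Inter_pair)
  have Z_sub: "additive_subgroup Z (C n)" unfolding Z_def by (rule d_kernel)
  have Z'_sub: "additive_subgroup Z' (C (Suc n))"
  proof -
    have "Z' = (F True (Suc n) \<inter> F False (Suc n)) \<inter> {f \<in> carrier (C (Suc n)). d (Suc n) f = \<zero>\<^bsub>C (Suc (Suc n))\<^esub>}"
      by (auto simp: Z'_def)
    then show ?thesis
      using C'.add.subgroups_Inter_pair[OF additive_subgroup.a_subgroup[OF int[of "Suc n"]]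
        additive_subgroup.a_subgroup[OF d_kernel[of "Suc n"]]] by (simp add: additive_subgroup_def)
  qed
  have B'_sub: "additive_subgroup B' (C (Suc n))" unfolding B'_def by (rule d_image[OF int])
  have B'_Z': "B' \<subseteq> Z'" by (auto simp: B'_def Z'_def sub_d d_d)
  \<comment> \<open>the relation that induces the connecting homomorphism\<close>
  define E where "E f c \<longleftrightarrow> (\<exists>u\<in>F True n. \<exists>v\<in>F False n. f = u \<oplus>\<^bsub>C n\<^esub> v \<and> c = d n u \<and> c = \<ominus>\<^bsub>C (Suc n)\<^esub> d n v)" for f c
  show ?thesis
    unfolding coh coh'
  proof (rule quotient_module_isomorphic[where E = E])
    show "abelian_group ?M" "abelian_group ?M'"
      using abelian_group_restrict group Z_sub Z'_sub by blast+
    show "additive_subgroup B ?M" by (rule C.additive_subgroup_restrict[OF B_sub Z_sub B_Z])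
    show "additive_subgroup B' ?M'" by (rule C'.additive_subgroup_restrict[OF B'_sub Z'_sub B'_Z'])
  next
    fix r f assume r: "r \<in> carrier R"
    show "r \<odot>\<^bsub>?M\<^esub> f \<in> carrier ?M" if "f \<in> carrier ?M"
      using that r by (simp add: Z_def smult_closed d_smult smult_zero)
    show "r \<odot>\<^bsub>?M'\<^esub> f \<in> carrier ?M'" if "f \<in> carrier ?M'"
      using that r by (simp add: Z'_def sub_smult d_smult smult_zero)
    show "r \<odot>\<^bsub>?M\<^esub> f \<in> B" if "f \<in> B"
    proof -
      from \<open>f \<in> B\<close>[unfolded B_def i coboundary_iff_split] obtain u v where
        uv: "u \<in> F True n" "v \<in> F False n" "d n u = \<zero>\<^bsub>C (Suc n)\<^esub>" "d n v = \<zero>\<^bsub>C (Suc n)\<^esub>" "f = u \<oplus>\<^bsub>C n\<^esub> v"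
        by blast
      then have "r \<odot>\<^bsub>C n\<^esub> f = r \<odot>\<^bsub>C n\<^esub> u \<oplus>\<^bsub>C n\<^esub> r \<odot>\<^bsub>C n\<^esub> v" using r by (simp add: smult_add)
      moreover have "d n (r \<odot>\<^bsub>C n\<^esub> u) = \<zero>\<^bsub>C (Suc n)\<^esub>" "d n (r \<odot>\<^bsub>C n\<^esub> v) = \<zero>\<^bsub>C (Suc n)\<^esub>"
        using uv r by (simp_all add: d_smult smult_zero)
      ultimately show ?thesis unfolding B_def i coboundary_iff_split using uv(1,2) sub_smult[OF r] by simp blast
    qed
    show "r \<odot>\<^bsub>?M'\<^esub> f \<in> B'" if "f \<in> B'"
    proof -
      obtain p where "p \<in> F True n \<inter> F False n" "f = d n p" using \<open>f \<in> B'\<close> by (auto simp: B'_def)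
      then show ?thesis
        unfolding B'_def using r by (intro image_eqI[of _ _ "r \<odot>\<^bsub>C n\<^esub> p"]) (auto simp: d_smult sub_smult)
    qed
    show "E (r \<odot>\<^bsub>?M\<^esub> f) (r \<odot>\<^bsub>?M'\<^esub> c)" if "E f c" for c
    proof -
      obtain u v where uv: "u \<in> F True n" "v \<in> F False n" "f = u \<oplus>\<^bsub>C n\<^esub> v" "c = d n u" "c = d n (\<ominus>\<^bsub>C n\<^esub> v)"
        using \<open>E f c\<close> by (auto simp: E_def d_neg)
      have "r \<odot>\<^bsub>C n\<^esub> (\<ominus>\<^bsub>C n\<^esub> v) = \<ominus>\<^bsub>C n\<^esub> (r \<odot>\<^bsub>C n\<^esub> v)"
        using r uv smult_add[OF r, of "\<ominus>\<^bsub>C n\<^esub> v" n v] smult_closed[OF r]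
        by (intro C.minus_equality[symmetric]) (auto simp: C.l_neg smult_zero)
      then have "r \<odot>\<^bsub>C (Suc n)\<^esub> c = \<ominus>\<^bsub>C (Suc n)\<^esub> d n (r \<odot>\<^bsub>C n\<^esub> v)"
        unfolding uv(5) using r uv(2) d_neg[of "r \<odot>\<^bsub>C n\<^esub> v" n] d_smult[OF r, of "\<ominus>\<^bsub>C n\<^esub> v" n]
        by (simp add: smult_closed)
      moreover have "r \<odot>\<^bsub>C (Suc n)\<^esub> c = d n (r \<odot>\<^bsub>C n\<^esub> u)" unfolding uv(4) using r uv(1) by (simp add: d_smult)
      moreover have "r \<odot>\<^bsub>C n\<^esub> f = r \<odot>\<^bsub>C n\<^esub> u \<oplus>\<^bsub>C n\<^esub> r \<odot>\<^bsub>C n\<^esub> v" using r uv by (simp add: smult_add)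
      ultimately show ?thesis unfolding E_def using uv(1,2) sub_smult[OF r] by simp metis
    qed
  next
    fix r f g assume "r \<in> carrier R"
    then show "f \<in> carrier ?M \<Longrightarrow> g \<in> carrier ?M \<Longrightarrow> r \<odot>\<^bsub>?M\<^esub> (f \<oplus>\<^bsub>?M\<^esub> g) = r \<odot>\<^bsub>?M\<^esub> f \<oplus>\<^bsub>?M\<^esub> r \<odot>\<^bsub>?M\<^esub> g"
      "f \<in> carrier ?M' \<Longrightarrow> g \<in> carrier ?M' \<Longrightarrow> r \<odot>\<^bsub>?M'\<^esub> (f \<oplus>\<^bsub>?M'\<^esub> g) = r \<odot>\<^bsub>?M'\<^esub> f \<oplus>\<^bsub>?M'\<^esub> r \<odot>\<^bsub>?M'\<^esub> g"
      by (simp_all add: smult_add Z_def Z'_def)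
  next
    fix f c assume e: "E f c"
    then obtain u v where uv: "u \<in> F True n" "v \<in> F False n" "f = u \<oplus>\<^bsub>C n\<^esub> v" "c = d n u" "c = \<ominus>\<^bsub>C (Suc n)\<^esub> d n v"
      by (auto simp: E_def)
    have dv: "d n v = \<ominus>\<^bsub>C (Suc n)\<^esub> d n u" using uv d_closed[of v n] by (metis C'.minus_minus F_carrier)
    have "f \<in> Z" using uv by (simp add: Z_def d_add dv C'.r_neg d_closed)
    moreover have "d n v \<in> F False (Suc n)" using uv(2) by (rule sub_d)
    then have "c \<in> F False (Suc n)" unfolding uv(5) by simp
    moreover have "c \<in> F True (Suc n)" unfolding uv(4) using uv(1) by (rule sub_d)
    ultimately have mem: "f \<in> Z" "c \<in> Z'" using uv(1,4) by (simp_all add: Z'_def d_d)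
    then show "f \<in> carrier ?M \<and> c \<in> carrier ?M'" by simp
    have "\<ominus>\<^bsub>C n\<^esub> f = \<ominus>\<^bsub>C n\<^esub> u \<oplus>\<^bsub>C n\<^esub> \<ominus>\<^bsub>C n\<^esub> v" using uv by (simp add: C.minus_add)
    moreover have "\<ominus>\<^bsub>C (Suc n)\<^esub> c = d n (\<ominus>\<^bsub>C n\<^esub> u)" "\<ominus>\<^bsub>C (Suc n)\<^esub> c = \<ominus>\<^bsub>C (Suc n)\<^esub> d n (\<ominus>\<^bsub>C n\<^esub> v)"
      using uv(1,2) unfolding uv(4) by (simp_all add: d_neg dv d_closed)
    ultimately have "E (\<ominus>\<^bsub>C n\<^esub> f) (\<ominus>\<^bsub>C (Suc n)\<^esub> c)" unfolding E_def using uv(1,2) by blast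
    then show "E (\<ominus>\<^bsub>?M\<^esub> f) (\<ominus>\<^bsub>?M'\<^esub> c)"
      using mem by (simp add: C.a_inv_restrict[OF Z_sub] C'.a_inv_restrict[OF Z'_sub])
    show "f \<in> B \<longleftrightarrow> c \<in> B'"
    proof
      assume "f \<in> B"
      from this[unfolded B_def i coboundary_iff_split] obtain u' v' where
        uv': "u' \<in> F True n" "v' \<in> F False n" "d n u' = \<zero>\<^bsub>C (Suc n)\<^esub>" "f = u' \<oplus>\<^bsub>C n\<^esub> v'" by blast
      have p: "u \<ominus>\<^bsub>C n\<^esub> u' = v' \<ominus>\<^bsub>C n\<^esub> v"
      proof -
        have c: "u \<in> carrier (C n)" "v \<in> carrier (C n)" "u' \<in> carrier (C n)" "v' \<in> carrier (C n)"
          using uv(1,2) uv'(1,2) by simp_all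
        have "u = (u \<oplus>\<^bsub>C n\<^esub> v) \<ominus>\<^bsub>C n\<^esub> v" using c by (simp add: C.minus_eq C.a_assoc C.r_neg)
        also have "\<dots> = u' \<oplus>\<^bsub>C n\<^esub> (v' \<ominus>\<^bsub>C n\<^esub> v)"
          unfolding uv(3)[symmetric] uv'(4) using c by (simp add: C.minus_eq C.a_assoc)
        also have "\<dots> = (v' \<ominus>\<^bsub>C n\<^esub> v) \<oplus>\<^bsub>C n\<^esub> u'" using c by (simp add: C.a_comm)
        finally have "u \<ominus>\<^bsub>C n\<^esub> u' = ((v' \<ominus>\<^bsub>C n\<^esub> v) \<oplus>\<^bsub>C n\<^esub> u') \<ominus>\<^bsub>C n\<^esub> u'" by (rule arg_cong)
        then show ?thesis using c by (simp add: C.minus_eq C.a_assoc C.r_neg)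
      qed
      have "u \<ominus>\<^bsub>C n\<^esub> u' \<in> F True n" using uv uv' by (simp add: C.minus_eq)
      moreover have "u \<ominus>\<^bsub>C n\<^esub> u' \<in> F False n" unfolding p using uv uv' by (simp add: C.minus_eq)
      moreover have "c = d n (u \<ominus>\<^bsub>C n\<^esub> u')" using uv uv' by (simp add: C.minus_eq d_add d_neg d_closed)
      ultimately show "c \<in> B'" unfolding B'_def by blast
    next
      assume "c \<in> B'"
      then obtain p where p: "p \<in> F True n" "p \<in> F False n" "c = d n p" by (auto simp: B'_def)
      let ?u = "u \<oplus>\<^bsub>C n\<^esub> \<ominus>\<^bsub>C n\<^esub> p" and ?v = "p \<oplus>\<^bsub>C n\<^esub> v"
      have "?u \<in> F True n" "?v \<in> F False n" using p uv by auto
      moreover have "d n ?u = \<zero>\<^bsub>C (Suc n)\<^esub>" "d n ?v = \<zero>\<^bsub>C (Suc n)\<^esub>"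
        using p(1) uv(1,2) p(3)[unfolded uv(4)] by (simp_all add: d_add d_neg d_closed dv C'.r_neg)
      moreover have "f = ?u \<oplus>\<^bsub>C n\<^esub> ?v" using p uv by (simp add: C.a_assoc C.r_neg1)
      ultimately show "f \<in> B" unfolding B_def i coboundary_iff_split by blast
    qed
    fix f' c' assume "E f' c'"
    then obtain u' v' where uv': "u' \<in> F True n" "v' \<in> F False n" "f' = u' \<oplus>\<^bsub>C n\<^esub> v'" "c' = d n u'"
      "c' = \<ominus>\<^bsub>C (Suc n)\<^esub> d n v'" by (auto simp: E_def)
    have "f \<oplus>\<^bsub>C n\<^esub> f' = (u \<oplus>\<^bsub>C n\<^esub> u') \<oplus>\<^bsub>C n\<^esub> (v \<oplus>\<^bsub>C n\<^esub> v')" using uv uv' by (simp add: C.a_ac)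
    moreover have "c \<oplus>\<^bsub>C (Suc n)\<^esub> c' = d n (u \<oplus>\<^bsub>C n\<^esub> u')" unfolding uv(4) uv'(4) using uv(1) uv'(1) by (simp add: d_add)
    moreover have "c \<oplus>\<^bsub>C (Suc n)\<^esub> c' = \<ominus>\<^bsub>C (Suc n)\<^esub> d n (v \<oplus>\<^bsub>C n\<^esub> v')"
      unfolding uv(5) uv'(5) using uv(2) uv'(2) by (simp add: d_add C'.minus_add d_closed)
    ultimately have "E (f \<oplus>\<^bsub>C n\<^esub> f') (c \<oplus>\<^bsub>C (Suc n)\<^esub> c')"
      unfolding E_def using F1.a_closed[OF uv(1) uv'(1)] F2.a_closed[OF uv(2) uv'(2)] by blast
    then show "E (f \<oplus>\<^bsub>?M\<^esub> f') (c \<oplus>\<^bsub>?M'\<^esub> c')" by simp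
  next
    fix f assume "f \<in> carrier ?M"
    then have f: "f \<in> carrier (C n)" "d n f = \<zero>\<^bsub>C (Suc n)\<^esub>" by (auto simp: Z_def)
    obtain u v where uv: "u \<in> F True n" "v \<in> F False n" "f = u \<oplus>\<^bsub>C n\<^esub> v" using cover[OF f(1)] by blast
    then have "d n u \<oplus>\<^bsub>C (Suc n)\<^esub> d n v = \<zero>\<^bsub>C (Suc n)\<^esub>" using f(2) by (simp add: d_add)
    then have "d n u = \<ominus>\<^bsub>C (Suc n)\<^esub> d n v"
      using uv by (intro C'.minus_equality[symmetric]) (auto simp: d_closed)
    then show "\<exists>c. E f c" unfolding E_def using uv by blast
  next
    fix c assume "c \<in> carrier ?M'"
    then have c: "c \<in> F True (Suc n)" "c \<in> F False (Suc n)" "d (Suc n) c = \<zero>\<^bsub>C (Suc (Suc n))\<^esub>"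
      by (auto simp: Z'_def)
    obtain a b where ab: "a \<in> F True n" "d n a = c" "b \<in> F False n" "d n b = c"
      using acyclic_Suc[OF c(1,3)] acyclic_Suc[OF c(2,3)] by blast
    have "c = \<ominus>\<^bsub>C (Suc n)\<^esub> d n (\<ominus>\<^bsub>C n\<^esub> b)" using ab c by (simp add: d_neg)
    then have "E (a \<oplus>\<^bsub>C n\<^esub> \<ominus>\<^bsub>C n\<^esub> b) c" 
      unfolding E_def by (intro bexI[OF _ ab(1)] bexI[OF _ F2.a_inv_closed[OF ab(3)]]) (simp add: ab(2))
    then show "\<exists>f. E f c" ..
  qed
qed

end

section \<open>Cochains as functions on chains\<close>

text \<open>The additive extension of a cochain from simplices to integral chains. On chains supported in
  \<open>X\<close> it is unique by the universal property of free abelian groups, so the choice is harmless.\<close>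

definition pairing :: "('a, 'b) ring_scheme \<Rightarrow> 'x set \<Rightarrow> ('x \<Rightarrow> 'a) \<Rightarrow> ('x \<Rightarrow>\<^sub>0 int) \<Rightarrow> 'a" where
  "pairing M X f = (SOME h. h \<in> hom (free_Abelian_group X) (add_monoid M) \<and> (\<forall>x\<in>X. h (frag_of x) = f x))"

context abelian_group
begin

lemma pairing_hom:
  assumes "f \<in> X \<rightarrow> carrier G"
  shows "pairing G X f \<in> hom (free_Abelian_group X) (add_monoid G)"
    and pairing_of: "x \<in> X \<Longrightarrow> pairing G X f (frag_of x) = f x"
proof -
  have "\<exists>h. h \<in> hom (free_Abelian_group X) (add_monoid G) \<and> (\<forall>x\<in>X. h (frag_of x) = f x)"
    using comm_group.free_Abelian_group_universal[OF a_comm_group, of f X] assms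
    by (metis (no_types, lifting) image_subsetI partial_object.select_convs(1) Pi_mem)
  from someI_ex[OF this]
  show "pairing G X f \<in> hom (free_Abelian_group X) (add_monoid G)"
    and "x \<in> X \<Longrightarrow> pairing G X f (frag_of x) = f x"
    by (auto simp: pairing_def)
qed

lemma pairing_group_hom:
  assumes "f \<in> X \<rightarrow> carrier G"
  shows "group_hom (free_Abelian_group X) (add_monoid G) (pairing G X f)"
  using pairing_hom[OF assms] a_group by (auto simp: group_hom_def group_hom_axioms_def)

lemma pairing_closed: "f \<in> X \<rightarrow> carrier G \<Longrightarrow> Poly_Mapping.keys c \<subseteq> X \<Longrightarrow> pairing G X f c \<in> carrier G"
  using group_hom.hom_closed[OF pairing_group_hom, of f X c] by simp

lemma pairing_0: "f \<in> X \<rightarrow> carrier G \<Longrightarrow> pairing G X f 0 = \<zero>"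
  using group_hom.hom_one[OF pairing_group_hom, of f X] by simp

lemma pairing_add:
  "f \<in> X \<rightarrow> carrier G \<Longrightarrow> Poly_Mapping.keys a \<subseteq> X \<Longrightarrow> Poly_Mapping.keys b \<subseteq> X \<Longrightarrow>
   pairing G X f (a + b) = pairing G X f a \<oplus> pairing G X f b"
  using group_hom.hom_mult[OF pairing_group_hom, of f X a b] by simp

lemma pairing_diff:
  assumes "f \<in> X \<rightarrow> carrier G" "Poly_Mapping.keys a \<subseteq> X" "Poly_Mapping.keys b \<subseteq> X"
  shows "pairing G X f (a - b) = pairing G X f a \<ominus> pairing G X f b"
proof -
  have "pairing G X f (- b) = \<ominus> pairing G X f b"
    using group_hom.hom_inv[OF pairing_group_hom[OF assms(1)], of b] assms by (simp add: a_inv_def)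
  then show ?thesis using pairing_add[of f X a "- b"] assms by (simp add: minus_eq)
qed

lemma pairing_cmul:
  assumes "f \<in> X \<rightarrow> carrier G" "Poly_Mapping.keys a \<subseteq> X"
  shows "pairing G X f (frag_cmul k a) = [k] \<cdot> pairing G X f a"
  using group_hom.hom_int_pow[OF pairing_group_hom[OF assms(1)], of a k] assms by (simp add: add_pow_def)

lemma pairing_sum:
  assumes "f \<in> X \<rightarrow> carrier G" "finite I" "\<And>i. i \<in> I \<Longrightarrow> Poly_Mapping.keys (c i) \<subseteq> X"
  shows "pairing G X f (\<Sum>i\<in>I. c i) = (\<Oplus>i\<in>I. pairing G X f (c i))"
  using assms(2,3)
proof (induction I rule: finite_induct)
  case (insert i I)
  have "Poly_Mapping.keys (\<Sum>i\<in>I. c i) \<subseteq> X" using insert keys_sum[of c I] by blast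
  then show ?case using insert assms(1) by (simp add: pairing_add pairing_closed)
qed (simp add: pairing_0 assms(1))

end

lemma additive_zero:
  fixes M (structure)
  assumes "abelian_group M" and closed: "\<And>x. x \<in> carrier M \<Longrightarrow> u x \<in> carrier M"
    and add: "\<And>x y. x \<in> carrier M \<Longrightarrow> y \<in> carrier M \<Longrightarrow> u (x \<oplus> y) = u x \<oplus> u y"
  shows "u \<zero> = \<zero>"
proof -
  interpret M: abelian_group M by fact
  have "u \<zero> \<oplus> u \<zero> = u \<zero>" using add[of "\<zero>" "\<zero>"] by simp
  then show ?thesis using closed[OF M.zero_closed] by (metis M.add.l_cancel_one)
qed

lemma additive_minus:
  fixes M (structure)
  assumes "abelian_group M" and closed: "\<And>x. x \<in> carrier M \<Longrightarrow> u x \<in> carrier M"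
    and add: "\<And>x y. x \<in> carrier M \<Longrightarrow> y \<in> carrier M \<Longrightarrow> u (x \<oplus> y) = u x \<oplus> u y"
    and ab: "a \<in> carrier M" "b \<in> carrier M"
  shows "u (a \<ominus> b) = u a \<ominus> u b"
proof -
  interpret M: abelian_group M by fact
  have e: "u a = u (a \<ominus> b) \<oplus> u b"
    using ab add[of "a \<ominus> b" b] by (simp add: M.minus_eq M.a_assoc M.l_neg)
  show ?thesis
    unfolding e using ab closed[of b] closed[of "a \<ominus> b"] by (simp add: M.minus_eq M.a_assoc M.r_neg)
qed

text \<open>Both sides are additive in \<open>c\<close> and agree on generators.\<close>

lemma pairing_natural:
  assumes "abelian_group M" "abelian_group M'" "f \<in> X \<rightarrow> carrier M" "Poly_Mapping.keys c \<subseteq> X"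
    and u: "\<And>x. x \<in> carrier M \<Longrightarrow> u x \<in> carrier M'"
      "\<And>x y. x \<in> carrier M \<Longrightarrow> y \<in> carrier M \<Longrightarrow> u (x \<oplus>\<^bsub>M\<^esub> y) = u x \<oplus>\<^bsub>M'\<^esub> u y"
    and h: "\<And>x. x \<in> X \<Longrightarrow> h x = u (f x)"
  shows "pairing M' X h c = u (pairing M X f c)"
proof -
  interpret M: abelian_group M by fact
  interpret M': abelian_group M' by fact
  have hX: "h \<in> X \<rightarrow> carrier M'" using assms by (auto simp: Pi_iff)
  interpret u: abelian_group_hom M M' u
    by (intro abelian_group_homI group_hom.intro group_hom_axioms.intro)
       (use u M.a_group M'.a_group M.abelian_group_axioms M'.abelian_group_axioms in \<open>auto simp: hom_def\<close>)
  show ?thesis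
  proof (rule free_Abelian_group_induct[OF assms(4)])
    show "pairing M' X h 0 = u (pairing M X f 0)"
      by (simp add: M.pairing_0[OF assms(3)] M'.pairing_0[OF hX])
    show "pairing M' X h (a - b) = u (pairing M X f (a - b))"
      if "Poly_Mapping.keys a \<subseteq> X" "Poly_Mapping.keys b \<subseteq> X"
        "pairing M' X h a = u (pairing M X f a)" "pairing M' X h b = u (pairing M X f b)" for a b
      using that
      by (simp add: M.pairing_diff[OF assms(3)] M'.pairing_diff[OF hX] M.minus_eq M'.minus_eq M.pairing_closed[OF assms(3)])
    show "pairing M' X h (frag_of x) = u (pairing M X f (frag_of x))" if "x \<in> X" for x
      using that by (simp add: M.pairing_of[OF assms(3)] M'.pairing_of[OF hX] h)
  qed
qed

lemma pairing_restrict: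
  assumes "abelian_group N" "additive_subgroup Q N" "f \<in> X \<rightarrow> Q" "Poly_Mapping.keys c \<subseteq> X"
  shows "pairing (N\<lparr>carrier := Q\<rparr>) X f c = pairing N X f c"
proof -
  interpret Q: additive_subgroup Q N by fact
  show ?thesis
    by (rule pairing_natural[of "N\<lparr>carrier := Q\<rparr>" N f X c id f, simplified, symmetric])
       (use assms abelian_group_restrict in auto)
qed

definition chain_bd :: "(nat \<Rightarrow> nat \<Rightarrow> 'x \<Rightarrow> 'x) \<Rightarrow> nat \<Rightarrow> ('x \<Rightarrow>\<^sub>0 int) \<Rightarrow> 'x \<Rightarrow>\<^sub>0 int" where
  "chain_bd face n = frag_extend (\<lambda>x. \<Sum>k\<le>Suc n. frag_cmul ((-1) ^ k) (frag_of (face (Suc n) k x)))"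

lemma chain_bd_0 [simp]: "chain_bd face n 0 = 0"
  and chain_bd_diff: "chain_bd face n (a - b) = chain_bd face n a - chain_bd face n b"
  by (simp_all add: chain_bd_def frag_extend_diff)

lemma coboundary_map_pairing:
  assumes "abelian_group M" "f \<in> X n \<rightarrow> carrier M" "x \<in> X (Suc n)"
    and "\<And>k. k \<le> Suc n \<Longrightarrow> face (Suc n) k x \<in> X n"
  shows "coboundary_map X face M n f x = pairing M (X n) f (chain_bd face n (frag_of x))"
proof -
  interpret abelian_group M by fact
  have "pairing M (X n) f (chain_bd face n (frag_of x)) =
     (\<Oplus>\<^bsub>M\<^esub>k\<in>{..Suc n}. pairing M (X n) f (frag_cmul ((-1) ^ k) (frag_of (face (Suc n) k x))))"
    using assms by (simp only: chain_bd_def frag_extend_of, intro pairing_sum) (auto split: if_splits)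
  also have "\<dots> = (\<Oplus>\<^bsub>M\<^esub>k\<in>{..Suc n}. add_pow M ((-1::int) ^ k) (f (face (Suc n) k x)))"
    using assms by (intro finsum_cong') (auto simp: pairing_cmul pairing_of Pi_iff)
  finally show ?thesis using assms by (simp add: coboundary_map_def)
qed

section \<open>Equivariant chain homotopies\<close>

definition coefficient_action ::
  "('g, 'z) monoid_scheme \<Rightarrow> ('m, 'u) ring_scheme \<Rightarrow> ('g \<Rightarrow> 'm \<Rightarrow> 'm) \<Rightarrow> bool" where
  "coefficient_action G M \<rho> \<longleftrightarrow> abelian_group M \<and>
     (\<forall>g\<in>carrier G. \<forall>x\<in>carrier M. \<rho> g x \<in> carrier M) \<and>
     (\<forall>g\<in>carrier G. \<forall>x\<in>carrier M. \<forall>y\<in>carrier M. \<rho> g (x \<oplus>\<^bsub>M\<^esub> y) = \<rho> g x \<oplus>\<^bsub>M\<^esub> \<rho> g y) \<and>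
     (\<forall>g\<in>carrier G. \<forall>h\<in>carrier G. \<forall>x\<in>carrier M. \<rho> (g \<otimes>\<^bsub>G\<^esub> h) x = \<rho> g (\<rho> h x))"

lemma coefficient_actionD:
  assumes "coefficient_action G M \<rho>"
  shows "abelian_group M" "\<And>g x. g \<in> carrier G \<Longrightarrow> x \<in> carrier M \<Longrightarrow> \<rho> g x \<in> carrier M"
    "\<And>g x y. g \<in> carrier G \<Longrightarrow> x \<in> carrier M \<Longrightarrow> y \<in> carrier M \<Longrightarrow> \<rho> g (x \<oplus>\<^bsub>M\<^esub> y) = \<rho> g x \<oplus>\<^bsub>M\<^esub> \<rho> g y"
    "\<And>g h x. g \<in> carrier G \<Longrightarrow> h \<in> carrier G \<Longrightarrow> x \<in> carrier M \<Longrightarrow> \<rho> (g \<otimes>\<^bsub>G\<^esub> h) x = \<rho> g (\<rho> h x)"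
  using assms by (simp_all add: coefficient_action_def)

text \<open>A free semi-simplicial \<open>G\<close>-set whose chains form a resolution of \<open>\<int>\<close> by free
  \<open>\<int>[G]\<close>-modules. Exactness in degree \<open>0\<close> is expressed by the requirement that any two vertices are
  homologous.\<close>

locale free_acyclic_gset = group G for G :: "('g, 'z) monoid_scheme" (structure) +
  fixes X :: "nat \<Rightarrow> 'x set" and act :: "nat \<Rightarrow> 'g \<Rightarrow> 'x \<Rightarrow> 'x" and face :: "nat \<Rightarrow> nat \<Rightarrow> 'x \<Rightarrow> 'x"
  assumes act_closed: "\<And>n g x. g \<in> carrier G \<Longrightarrow> x \<in> X n \<Longrightarrow> act n g x \<in> X n"
    and act_mult: "\<And>n g h x. g \<in> carrier G \<Longrightarrow> h \<in> carrier G \<Longrightarrow> x \<in> X n \<Longrightarrow>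
          act n (g \<otimes> h) x = act n g (act n h x)"
    and act_one: "\<And>n x. x \<in> X n \<Longrightarrow> act n \<one> x = x"
    and act_free: "\<And>n g x. g \<in> carrier G \<Longrightarrow> x \<in> X n \<Longrightarrow> act n g x = x \<Longrightarrow> g = \<one>"
    and face_closed: "\<And>n k x. x \<in> X (Suc n) \<Longrightarrow> k \<le> Suc n \<Longrightarrow> face (Suc n) k x \<in> X n"
    and face_act: "\<And>n k g x. g \<in> carrier G \<Longrightarrow> x \<in> X (Suc n) \<Longrightarrow> k \<le> Suc n \<Longrightarrow>
          face (Suc n) k (act (Suc n) g x) = act n g (face (Suc n) k x)"
    and bd_bd: "\<And>n x. x \<in> X (Suc (Suc n)) \<Longrightarrow> chain_bd face n (chain_bd face (Suc n) (frag_of x)) = 0"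
    and chain_acyclic_0: "\<And>x y. x \<in> X 0 \<Longrightarrow> y \<in> X 0 \<Longrightarrow>
          \<exists>c. Poly_Mapping.keys c \<subseteq> X (Suc 0) \<and> chain_bd face 0 c = frag_of y - frag_of x"
    and chain_acyclic_Suc: "\<And>n c. Poly_Mapping.keys c \<subseteq> X (Suc n) \<Longrightarrow> chain_bd face n c = 0 \<Longrightarrow>
          \<exists>e. Poly_Mapping.keys e \<subseteq> X (Suc (Suc n)) \<and> chain_bd face (Suc n) e = c"
begin

abbreviation (input) cochains :: "('r, 'm, 'u) module_scheme \<Rightarrow> ('g \<Rightarrow> 'm \<Rightarrow> 'm) \<Rightarrow> nat \<Rightarrow> ('r, 'x \<Rightarrow> 'm) module" where
  "cochains \<equiv> equivariant_cochains G X act"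

abbreviation (input) cobd :: "('r, 'm, 'u) module_scheme \<Rightarrow> nat \<Rightarrow> ('x \<Rightarrow> 'm) \<Rightarrow> 'x \<Rightarrow> 'm" where
  "cobd \<equiv> coboundary_map X face"

abbreviation (input) bd :: "nat \<Rightarrow> ('x \<Rightarrow>\<^sub>0 int) \<Rightarrow> 'x \<Rightarrow>\<^sub>0 int" where
  "bd \<equiv> chain_bd face"

abbreviation chains :: "nat \<Rightarrow> ('x \<Rightarrow>\<^sub>0 int) set" where
  "chains n \<equiv> {c. Poly_Mapping.keys c \<subseteq> X n}"

definition act_chain :: "nat \<Rightarrow> 'g \<Rightarrow> ('x \<Rightarrow>\<^sub>0 int) \<Rightarrow> 'x \<Rightarrow>\<^sub>0 int" where
  "act_chain n g = frag_extend (\<lambda>x. frag_of (act n g x))"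

lemma chain_induct [consumes 1, case_names zero diff of]:
  assumes "c \<in> chains n" "P 0" "\<And>a b. a \<in> chains n \<Longrightarrow> b \<in> chains n \<Longrightarrow> P a \<Longrightarrow> P b \<Longrightarrow> P (a - b)"
    "\<And>x. x \<in> X n \<Longrightarrow> P (frag_of x)"
  shows "P c"
  using assms free_Abelian_group_induct[of c "X n" P] by simp

lemma chains_diff: "a \<in> chains n \<Longrightarrow> b \<in> chains n \<Longrightarrow> a - b \<in> chains n"
  using keys_diff[of a b] by blast

lemma chains_extend:
  assumes "\<And>x. x \<in> X m \<Longrightarrow> f x \<in> chains n" "c \<in> chains m" shows "frag_extend f c \<in> chains n"
  using assms keys_frag_extend[of f c] by blast

lemma chains_bd: "c \<in> chains (Suc n) \<Longrightarrow> bd n c \<in> chains n"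
  unfolding chain_bd_def
proof (rule chains_extend)
  fix x assume "x \<in> X (Suc n)"
  then show "(\<Sum>k\<le>Suc n. frag_cmul ((-1) ^ k) (frag_of (face (Suc n) k x))) \<in> chains n"
    using keys_sum[of "\<lambda>k. frag_cmul ((-1) ^ k) (frag_of (face (Suc n) k x))" "{..Suc n}"] face_closed[of x n]
    by (auto split: if_splits)
qed

lemma chains_act: "g \<in> carrier G \<Longrightarrow> c \<in> chains n \<Longrightarrow> act_chain n g c \<in> chains n"
  unfolding act_chain_def by (rule chains_extend) (auto intro: act_closed)

lemma act_chain_diff: "act_chain n g (a - b) = act_chain n g a - act_chain n g b"
  by (simp add: act_chain_def frag_extend_diff)

lemma act_chain_of [simp]: "act_chain n g (frag_of x) = frag_of (act n g x)"
  by (simp add: act_chain_def)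

lemma act_chain_0 [simp]: "act_chain n g 0 = 0"
  by (simp add: act_chain_def)

lemma bd_act:
  assumes "g \<in> carrier G" "c \<in> chains (Suc n)"
  shows "bd n (act_chain (Suc n) g c) = act_chain n g (bd n c)"
  using assms(2)
proof (induction c rule: chain_induct)
  case (of x)
  have "bd n (act_chain (Suc n) g (frag_of x)) =
     (\<Sum>k\<le>Suc n. frag_cmul ((-1) ^ k) (frag_of (act n g (face (Suc n) k x))))"
    using assms of by (simp add: chain_bd_def face_act cong: sum.cong_simp)
  also have "\<dots> = act_chain n g (bd n (frag_of x))"
    unfolding chain_bd_def act_chain_def
    by (subst frag_extend_of) (simp only: frag_extend_sum finite_atMost o_def frag_extend_cmul frag_extend_of)
  finally show ?case .
qed (auto simp: chain_bd_diff act_chain_diff)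

lemma act_chain_mult:
  assumes "g \<in> carrier G" "h \<in> carrier G" "c \<in> chains n"
  shows "act_chain n (g \<otimes> h) c = act_chain n g (act_chain n h c)"
  using assms(3) by (induction c rule: chain_induct) (auto simp: act_chain_diff act_mult assms)

text \<open>This is the projectivity of free \<open>\<int>[G]\<close>-modules: values may be chosen at representatives of the
  orbits, and freeness of the action makes their translates unambiguous.\<close>

lemma equivariant_choice:
  fixes Y :: "'y set" and B :: "'g \<Rightarrow> 'y \<Rightarrow> 'y" and P :: "'x \<Rightarrow> 'y \<Rightarrow> bool"
  assumes B_closed: "\<And>g y. g \<in> carrier G \<Longrightarrow> y \<in> Y \<Longrightarrow> B g y \<in> Y"
    and B_mult: "\<And>g h y. g \<in> carrier G \<Longrightarrow> h \<in> carrier G \<Longrightarrow> y \<in> Y \<Longrightarrow> B (g \<otimes> h) y = B g (B h y)"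
    and P_act: "\<And>g x y. g \<in> carrier G \<Longrightarrow> x \<in> X n \<Longrightarrow> y \<in> Y \<Longrightarrow> P x y \<Longrightarrow> P (act n g x) (B g y)"
    and ex: "\<And>x. x \<in> X n \<Longrightarrow> \<exists>y\<in>Y. P x y"
  obtains F where "\<And>x. x \<in> X n \<Longrightarrow> F x \<in> Y" "\<And>x. x \<in> X n \<Longrightarrow> P x (F x)"
    "\<And>g x. g \<in> carrier G \<Longrightarrow> x \<in> X n \<Longrightarrow> F (act n g x) = B g (F x)"
proof -
  define rep where "rep x = (SOME r. r \<in> X n \<and> (\<exists>g\<in>carrier G. x = act n g r))" for x
  define \<gamma> where "\<gamma> x = (SOME g. g \<in> carrier G \<and> x = act n g (rep x))" for x
  define F where "F x = B (\<gamma> x) (SOME y. y \<in> Y \<and> P (rep x) y)" for x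
  have rep: "rep x \<in> X n \<and> (\<exists>g\<in>carrier G. x = act n g (rep x))" if "x \<in> X n" for x
    unfolding rep_def by (rule someI[of _ x]) (use that act_one in force)
  have \<gamma>: "\<gamma> x \<in> carrier G" "act n (\<gamma> x) (rep x) = x" if "x \<in> X n" for x
  proof -
    have "\<gamma> x \<in> carrier G \<and> x = act n (\<gamma> x) (rep x)"
      unfolding \<gamma>_def by (rule someI_ex) (use rep[OF that] in blast)
    then show "\<gamma> x \<in> carrier G" "act n (\<gamma> x) (rep x) = x" by simp_all
  qed
  have rep_act: "rep (act n g x) = rep x" if "g \<in> carrier G" "x \<in> X n" for g x
  proof -
    have "(\<exists>h\<in>carrier G. act n g x = act n h r) \<longleftrightarrow> (\<exists>h\<in>carrier G. x = act n h r)" if r: "r \<in> X n" for r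
    proof
      assume "\<exists>h\<in>carrier G. act n g x = act n h r"
      then obtain h where h: "h \<in> carrier G" "act n g x = act n h r" by blast
      have "x = act n (inv g) (act n g x)"
        using \<open>g \<in> carrier G\<close> \<open>x \<in> X n\<close> by (simp add: act_mult[symmetric] act_one)
      also have "\<dots> = act n (inv g \<otimes> h) r"
        using h r \<open>g \<in> carrier G\<close> by (simp add: act_mult)
      finally show "\<exists>h\<in>carrier G. x = act n h r" using h \<open>g \<in> carrier G\<close> by blast
    next
      assume "\<exists>h\<in>carrier G. x = act n h r"
      then obtain h where h: "h \<in> carrier G" "x = act n h r" by blast
      then have "act n g x = act n (g \<otimes> h) r" using r \<open>g \<in> carrier G\<close> by (simp add: act_mult)
      then show "\<exists>h\<in>carrier G. act n g x = act n h r" using h \<open>g \<in> carrier G\<close> by blast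
    qed
    then have "(\<lambda>r. r \<in> X n \<and> (\<exists>h\<in>carrier G. act n g x = act n h r)) =
        (\<lambda>r. r \<in> X n \<and> (\<exists>h\<in>carrier G. x = act n h r))" by (intro ext) blast
    then show ?thesis unfolding rep_def by (rule arg_cong)
  qed
  have \<gamma>_act: "\<gamma> (act n g x) = g \<otimes> \<gamma> x" if g: "g \<in> carrier G" and x: "x \<in> X n" for g x
  proof -
    let ?h = "\<gamma> (act n g x)"
    have h: "?h \<in> carrier G" "act n ?h (rep x) = act n g x"
      using \<gamma>[of "act n g x"] act_closed[OF g x] rep_act[OF g x] by auto
    have c: "g \<otimes> \<gamma> x \<in> carrier G" "act n (g \<otimes> \<gamma> x) (rep x) = act n g x"
      using g \<gamma>[OF x] rep[OF x] by (auto simp: act_mult)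
    have "act n (inv (g \<otimes> \<gamma> x) \<otimes> ?h) (rep x) = act n (inv (g \<otimes> \<gamma> x)) (act n (g \<otimes> \<gamma> x) (rep x))"
      using h c rep[OF x] by (simp add: act_mult)
    also have "\<dots> = rep x" using c(1) rep[OF x] by (simp add: act_mult[symmetric] act_one)
    finally have e: "act n (inv (g \<otimes> \<gamma> x) \<otimes> ?h) (rep x) = rep x" .
    have "inv (g \<otimes> \<gamma> x) \<otimes> ?h = \<one>"
      by (rule act_free[OF _ _ e]) (use h(1) c(1) rep[OF x] in simp_all)
    then have "(g \<otimes> \<gamma> x) \<otimes> (inv (g \<otimes> \<gamma> x) \<otimes> ?h) = g \<otimes> \<gamma> x" using c(1) by simp
    then show ?thesis using h(1) c(1) by (simp add: m_assoc[symmetric])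
  qed
  have y: "(SOME y. y \<in> Y \<and> P (rep x) y) \<in> Y \<and> P (rep x) (SOME y. y \<in> Y \<and> P (rep x) y)" if "x \<in> X n" for x
    by (rule someI_ex) (use ex rep[OF that] in blast)
  show thesis
  proof
    fix x assume x: "x \<in> X n"
    show "F x \<in> Y" using y[OF x] \<gamma>[OF x] B_closed by (auto simp: F_def)
    have "P (act n (\<gamma> x) (rep x)) (F x)"
      unfolding F_def using y[OF x] \<gamma>[OF x] rep[OF x] by (intro P_act) auto
    then show "P x (F x)" using \<gamma>[OF x] by simp
    fix g assume g: "g \<in> carrier G"
    show "F (act n g x) = B g (F x)"
      unfolding F_def rep_act[OF g x] \<gamma>_act[OF g x] using g \<gamma>[OF x] y[OF x] by (intro B_mult) auto
  qed
qed

definition is_cycle :: "nat \<Rightarrow> ('x \<Rightarrow>\<^sub>0 int) \<Rightarrow> bool" where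
  "is_cycle n c \<longleftrightarrow> (case n of 0 \<Rightarrow> True | Suc m \<Rightarrow> bd m c = 0)"

text \<open>Instead of the homotopy formula, which refers to the previous degree, only its consequence for
  cycles is recorded here; it is all that the induction step needs.\<close>

definition homotopy_at :: "'g \<Rightarrow> nat \<Rightarrow> ('x \<Rightarrow> 'x \<Rightarrow>\<^sub>0 int) \<Rightarrow> bool" where
  "homotopy_at z n K \<longleftrightarrow>
     (\<forall>x\<in>X n. K x \<in> chains (Suc n)) \<and>
     (\<forall>g\<in>carrier G. \<forall>x\<in>X n. K (act n g x) = act_chain (Suc n) g (K x)) \<and>
     (\<forall>c\<in>chains n. is_cycle n c \<longrightarrow> bd n (frag_extend K c) = act_chain n z c - c)"

definition homotopy_step :: "'g \<Rightarrow> nat \<Rightarrow> ('x \<Rightarrow> 'x \<Rightarrow>\<^sub>0 int) \<Rightarrow> ('x \<Rightarrow> 'x \<Rightarrow>\<^sub>0 int) \<Rightarrow> bool" where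
  "homotopy_step z n K K' \<longleftrightarrow>
     (\<forall>x\<in>X (Suc n). bd (Suc n) (K' x) =
        frag_of (act (Suc n) z x) - frag_of x - frag_extend K (bd n (frag_of x)))"

lemma extend_equivariant:
  assumes K: "\<And>g x. g \<in> carrier G \<Longrightarrow> x \<in> X n \<Longrightarrow> K (act n g x) = act_chain m g (K x)"
    and "g \<in> carrier G" "c \<in> chains n"
  shows "frag_extend K (act_chain n g c) = act_chain m g (frag_extend K c)"
  using assms(3) by (induction c rule: chain_induct) (auto simp: frag_extend_diff act_chain_diff K assms(2))

text \<open>The comparison theorem for the resolution, applied to translation by \<open>z\<close> and the identity.
  Centrality of \<open>z\<close> is what makes translation by \<open>z\<close> equivariant.\<close>

lemma homotopy_exists:
  assumes z: "z \<in> carrier G" "\<And>g. g \<in> carrier G \<Longrightarrow> z \<otimes> g = g \<otimes> z"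
  obtains K where "\<And>n. homotopy_at z n (K n)" "\<And>n. homotopy_step z n (K n) (K (Suc n))"
proof -
  have act_z: "act n z (act n g x) = act n g (act n z x)" if "g \<in> carrier G" "x \<in> X n" for g x n
    using that z act_mult by metis
  have start: "\<exists>K. homotopy_at z 0 K"
  proof -
    obtain K where K: "\<And>x. x \<in> X 0 \<Longrightarrow> K x \<in> chains (Suc 0)"
      "\<And>x. x \<in> X 0 \<Longrightarrow> bd 0 (K x) = frag_of (act 0 z x) - frag_of x"
      "\<And>g x. g \<in> carrier G \<Longrightarrow> x \<in> X 0 \<Longrightarrow> K (act 0 g x) = act_chain (Suc 0) g (K x)"
    proof (rule equivariant_choice[where n = 0 and Y = "chains (Suc 0)" and B = "act_chain (Suc 0)"
          and P = "\<lambda>x y. bd 0 y = frag_of (act 0 z x) - frag_of x"])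
      show "\<exists>y\<in>chains (Suc 0). bd 0 y = frag_of (act 0 z x) - frag_of x" if "x \<in> X 0" for x
        using chain_acyclic_0[OF that act_closed[OF z(1) that]] by blast
    qed (auto simp: bd_act act_chain_diff act_z chains_act[simplified] act_chain_mult)
    have "bd 0 (frag_extend K c) = act_chain 0 z c - c" if "c \<in> chains 0" for c
      using that by (induction c rule: chain_induct) (auto simp: frag_extend_diff chain_bd_diff act_chain_diff K)
    then have "homotopy_at z 0 K"
      unfolding homotopy_at_def by (intro conjI ballI impI K) blast+
    then show ?thesis by (intro exI[of _ K])
  qed
  have step: "\<exists>K'. homotopy_at z (Suc n) K' \<and> homotopy_step z n K K'" if K: "homotopy_at z n K" for n K
  proof -
    define t where "t x = frag_of (act (Suc n) z x) - frag_of x - frag_extend K (bd n (frag_of x))" for x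
    have K1: "\<And>x. x \<in> X n \<Longrightarrow> K x \<in> chains (Suc n)"
      and K2: "\<And>g x. g \<in> carrier G \<Longrightarrow> x \<in> X n \<Longrightarrow> K (act n g x) = act_chain (Suc n) g (K x)"
      and K3: "\<And>c. c \<in> chains n \<Longrightarrow> is_cycle n c \<Longrightarrow> bd n (frag_extend K c) = act_chain n z c - c"
      using K by (auto simp: homotopy_at_def)
    have bdx: "bd n (frag_of x) \<in> chains n" if "x \<in> X (Suc n)" for x
      using that by (intro chains_bd) auto
    have t_chain: "t x \<in> chains (Suc n)" if "x \<in> X (Suc n)" for x
      unfolding t_def
      by (intro chains_diff chains_extend[OF K1 bdx[OF that]]) (use that z in \<open>auto simp: act_closed\<close>)
    have t_cycle: "bd n (t x) = 0" if x: "x \<in> X (Suc n)" for x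
    proof -
      have "is_cycle n (bd n (frag_of x))"
        using x by (cases n) (auto simp: is_cycle_def bd_bd)
      then have "bd n (frag_extend K (bd n (frag_of x))) =
          act_chain n z (bd n (frag_of x)) - bd n (frag_of x)"
        using K3 bdx[OF x] by blast
      moreover have "bd n (frag_of (act (Suc n) z x)) = act_chain n z (bd n (frag_of x))"
        using bd_act[OF z(1), of "frag_of x" n] x by simp
      ultimately show ?thesis by (simp add: t_def chain_bd_diff)
    qed
    have t_act: "t (act (Suc n) g x) = act_chain (Suc n) g (t x)" if g: "g \<in> carrier G" and x: "x \<in> X (Suc n)" for g x
    proof -
      have "bd n (frag_of (act (Suc n) g x)) = act_chain n g (bd n (frag_of x))"
        using bd_act[OF g, of "frag_of x" n] x by simp
      then have "frag_extend K (bd n (frag_of (act (Suc n) g x))) =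
          act_chain (Suc n) g (frag_extend K (bd n (frag_of x)))"
        using extend_equivariant[of n K "Suc n", OF K2 g bdx[OF x]] by simp
      then show ?thesis using g x by (simp add: t_def act_chain_diff act_z)
    qed
    obtain K' where K': "\<And>x. x \<in> X (Suc n) \<Longrightarrow> K' x \<in> chains (Suc (Suc n))"
      "\<And>x. x \<in> X (Suc n) \<Longrightarrow> bd (Suc n) (K' x) = t x"
      "\<And>g x. g \<in> carrier G \<Longrightarrow> x \<in> X (Suc n) \<Longrightarrow> K' (act (Suc n) g x) = act_chain (Suc (Suc n)) g (K' x)"
    proof (rule equivariant_choice[where n = "Suc n" and Y = "chains (Suc (Suc n))" and B = "act_chain (Suc (Suc n))"
          and P = "\<lambda>x y. bd (Suc n) y = t x"])
      show "\<exists>y\<in>chains (Suc (Suc n)). bd (Suc n) y = t x" if "x \<in> X (Suc n)" for x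
        using chain_acyclic_Suc[of "t x" n] t_chain[OF that] t_cycle[OF that] by blast
    qed (auto simp: bd_act t_act chains_act[simplified] act_chain_mult)
    have "bd (Suc n) (frag_extend K' c) =
        act_chain (Suc n) z c - c - frag_extend K (bd n c)" if "c \<in> chains (Suc n)" for c
      using that by (induction c rule: chain_induct)
        (auto simp: frag_extend_diff chain_bd_diff act_chain_diff K' t_def)
    then have "homotopy_at z (Suc n) K'"
      unfolding homotopy_at_def using K' by (auto simp: is_cycle_def)
    moreover have "homotopy_step z n K K'" using K' by (simp add: homotopy_step_def t_def)
    ultimately show ?thesis by blast
  qed
  from dependent_nat_choice[of "homotopy_at z" "homotopy_step z", OF start step]
  show thesis using that by blast
qed

lemma bd_frag_of: "x \<in> X (Suc n) \<Longrightarrow> bd n (frag_of x) \<in> chains n"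
  by (intro chains_bd) auto

lemma coboundary_pairing:
  assumes "abelian_group M" "f \<in> X n \<rightarrow> carrier M"
  shows "x \<in> X (Suc n) \<Longrightarrow> cobd M n f x = pairing M (X n) f (bd n (frag_of x))"
  by (rule coboundary_map_pairing) (use assms face_closed in auto)

lemma coboundary_closed:
  assumes "abelian_group M" "f \<in> X n \<rightarrow> carrier M" "x \<in> X (Suc n)"
  shows "cobd M n f x \<in> carrier M"
  using coboundary_pairing[OF assms] abelian_group.pairing_closed[OF assms(1,2)] bd_frag_of[OF assms(3)] by simp

lemma pairing_coboundary:
  assumes M: "abelian_group M" "f \<in> X n \<rightarrow> carrier M" and c: "c \<in> chains (Suc n)"
  shows "pairing M (X (Suc n)) (cobd M n f) c = pairing M (X n) f (bd n c)"
proof -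
  interpret M: abelian_group M by fact
  have d: "cobd M n f \<in> X (Suc n) \<rightarrow> carrier M"
    using coboundary_closed[OF M] by blast
  show ?thesis using c
  proof (induction c rule: chain_induct)
    case zero
    then show ?case by (simp add: M.pairing_0[OF d] M.pairing_0[OF M(2)])
  next
    case (diff a b)
    then show ?case using chains_bd[of a n] chains_bd[of b n]
      by (simp add: chain_bd_diff M.pairing_diff[OF d] M.pairing_diff[OF M(2)])
  next
    case (of x)
    then show ?case by (simp add: M.pairing_of[OF d] coboundary_pairing[OF M])
  qed
qed

lemma pairing_act:
  assumes M: "coefficient_action G M \<rho>" and f: "f \<in> X n \<rightarrow> carrier M"
    and f_act: "\<And>g x. g \<in> carrier G \<Longrightarrow> x \<in> X n \<Longrightarrow> f (act n g x) = \<rho> g (f x)"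
    and g: "g \<in> carrier G" and c: "c \<in> chains n"
  shows "pairing M (X n) f (act_chain n g c) = \<rho> g (pairing M (X n) f c)"
proof -
  interpret M: abelian_group M using M by (simp add: coefficient_action_def)
  let ?h = "\<lambda>x. f (act n g x)"
  have h: "?h \<in> X n \<rightarrow> carrier M" using f act_closed[OF g] by auto
  have "pairing M (X n) f (act_chain n g c) = pairing M (X n) ?h c"
    using c
  proof (induction c rule: chain_induct)
    case zero
    then show ?case by (simp add: M.pairing_0[OF f] M.pairing_0[OF h])
  next
    case (diff a b)
    then show ?case using chains_act[OF g, of a n] chains_act[OF g, of b n]
      by (simp add: act_chain_diff M.pairing_diff[OF f] M.pairing_diff[OF h])
  next
    case (of x)
    then show ?case by (simp add: M.pairing_of[OF f] M.pairing_of[OF h] act_closed[OF g])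
  qed
  also have "\<dots> = \<rho> g (pairing M (X n) f c)"
    by (rule pairing_natural[OF M.abelian_group_axioms M.abelian_group_axioms f])
       (use c M g f_act in \<open>auto simp: coefficient_action_def\<close>)
  finally show ?thesis .
qed

section \<open>Vanishing of cohomology\<close>

lemma cochain_closed: "f \<in> carrier (cochains M \<rho> n) \<Longrightarrow> f \<in> X n \<rightarrow> carrier M"
  by (auto simp: equivariant_cochains_def)

text \<open>Let \<open>v\<close> be the inverse of \<open>z - 1\<close> on the coefficients. By uniqueness \<open>v\<close> is additive and
  equivariant, so \<open>v \<circ> f\<close> is a cocycle, and the chain homotopy shows that
  \<open>f = (z - 1) (v \<circ> f)\<close> is a coboundary.\<close>

theorem cocycle_is_coboundary:
  assumes M: "coefficient_action G M \<rho>"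
    and z: "z \<in> carrier G" "\<And>g. g \<in> carrier G \<Longrightarrow> z \<otimes> g = g \<otimes> z"
    and solve: "\<And>b. b \<in> carrier M \<Longrightarrow> \<exists>!a. a \<in> carrier M \<and> \<rho> z a = a \<oplus>\<^bsub>M\<^esub> b"
    and f: "f \<in> carrier (cochains M \<rho> n)"
    and cocycle: "cobd M n f = \<zero>\<^bsub>cochains M \<rho> (Suc n)\<^esub>"
  shows "case n of 0 \<Rightarrow> f = \<zero>\<^bsub>cochains M \<rho> 0\<^esub>
    | Suc m \<Rightarrow> \<exists>e\<in>carrier (cochains M \<rho> m). cobd M m e = f"
proof -
  interpret M: abelian_group M using M by (simp add: coefficient_action_def)
  note \<rho>_closed = coefficient_actionD(2)[OF M] and \<rho>_add = coefficient_actionD(3)[OF M]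
    and \<rho>_mult = coefficient_actionD(4)[OF M]
  obtain K where K: "\<And>n. homotopy_at z n (K n)" "\<And>n. homotopy_step z n (K n) (K (Suc n))"
    using homotopy_exists[OF z] by blast
  have K1: "\<And>n x. x \<in> X n \<Longrightarrow> K n x \<in> chains (Suc n)"
    and K2: "\<And>n g x. g \<in> carrier G \<Longrightarrow> x \<in> X n \<Longrightarrow> K n (act n g x) = act_chain (Suc n) g (K n x)"
    using K(1) by (auto simp: homotopy_at_def)
  define v where "v b = (THE a. a \<in> carrier M \<and> \<rho> z a = a \<oplus>\<^bsub>M\<^esub> b)" for b
  have v: "v b \<in> carrier M" "\<rho> z (v b) = v b \<oplus>\<^bsub>M\<^esub> b" if "b \<in> carrier M" for b
    using theI'[OF solve[OF that]] by (auto simp: v_def)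
  have v_unique: "a = v b" if "a \<in> carrier M" "b \<in> carrier M" "\<rho> z a = a \<oplus>\<^bsub>M\<^esub> b" for a b
    using solve[OF that(2)] v[OF that(2)] that by blast
  have v_add: "v (a \<oplus>\<^bsub>M\<^esub> b) = v a \<oplus>\<^bsub>M\<^esub> v b" if "a \<in> carrier M" "b \<in> carrier M" for a b
    by (rule v_unique[symmetric]) (use that z in \<open>auto simp: v \<rho>_add M.a_ac\<close>)
  have v_act: "v (\<rho> g b) = \<rho> g (v b)" if "g \<in> carrier G" "b \<in> carrier M" for g b
  proof (rule v_unique[symmetric])
    have "\<rho> z (\<rho> g (v b)) = \<rho> g (\<rho> z (v b))" using that z v \<rho>_mult by metis
    then show "\<rho> z (\<rho> g (v b)) = \<rho> g (v b) \<oplus>\<^bsub>M\<^esub> \<rho> g b" using that by (simp add: v \<rho>_add)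
  qed (use that in \<open>auto simp: v \<rho>_closed\<close>)
  have v_0: "v \<zero>\<^bsub>M\<^esub> = \<zero>\<^bsub>M\<^esub>"
    using additive_zero[OF M.abelian_group_axioms, of v] v(1) v_add by blast
  have fX: "f \<in> X n \<rightarrow> carrier M" using f by (rule cochain_closed)
  have f_act: "f (act n g x) = \<rho> g (f x)" if "g \<in> carrier G" "x \<in> X n" for g x
    using f that by (auto simp: equivariant_cochains_def)
  \<comment> \<open>the cochain \<open>h\<close> satisfies \<open>z h - h = f\<close> and is again a cocycle\<close>
  define h where "h x = v (f x)" for x
  have hX: "h \<in> X n \<rightarrow> carrier M" using fX v(1) by (auto simp: h_def Pi_iff)
  have h_act: "h (act n g x) = \<rho> g (h x)" if "g \<in> carrier G" "x \<in> X n" for g x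
    using that by (simp add: h_def f_act v_act funcset_mem[OF fX])
  have pair_h: "pairing M (X n) h c = v (pairing M (X n) f c)" if "c \<in> chains n" for c
    by (rule pairing_natural[OF M.abelian_group_axioms M.abelian_group_axioms fX])
       (use that v(1) v_add in \<open>auto simp: h_def\<close>)
  have pair_act: "pairing M (X n) h (act_chain n g c) = \<rho> g (pairing M (X n) h c)"
    if "g \<in> carrier G" "c \<in> chains n" for g c
    using pairing_act[OF M hX h_act] that by blast
  have cyc: "pairing M (X n) h (bd n c) = \<zero>\<^bsub>M\<^esub>" if "c \<in> chains (Suc n)" for c
    using that
  proof (induction c rule: chain_induct)
    case zero
    then show ?case using hX by (simp add: M.pairing_0)
  next
    case (diff a b)
    then show ?case using hX chains_bd by (simp add: chain_bd_diff M.pairing_diff M.minus_eq)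
  next
    case (of x)
    have "pairing M (X n) f (bd n (frag_of x)) = \<zero>\<^bsub>M\<^esub>"
      using coboundary_map_pairing[of M f X n x face] fX of face_closed M.abelian_group_axioms
        fun_cong[OF cocycle, of x] by (simp add: equivariant_cochains_def)
    moreover have "bd n (frag_of x) \<in> chains n" using of by (intro chains_bd) auto
    ultimately show ?case by (simp add: pair_h v_0)
  qed
  have f_eq: "f x = pairing M (X n) h (frag_of (act n z x) - frag_of x)" if x: "x \<in> X n" for x
  proof -
    have c: "f x \<in> carrier M" "h x \<in> carrier M" using fX hX x by auto
    have "pairing M (X n) h (frag_of (act n z x) - frag_of x) = \<rho> z (h x) \<ominus>\<^bsub>M\<^esub> h x"
      using hX x z act_closed by (simp add: M.pairing_diff M.pairing_of h_act)
    also have "\<dots> = (f x \<oplus>\<^bsub>M\<^esub> h x) \<ominus>\<^bsub>M\<^esub> h x" using c v(2)[of "f x"] by (simp add: h_def M.a_comm)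
    finally show ?thesis using c by (simp add: M.minus_eq M.a_assoc M.r_neg)
  qed
  show ?thesis
  proof (cases n)
    case 0
    have "f x = \<zero>\<^bsub>M\<^esub>" if x: "x \<in> X 0" for x
    proof -
      have "bd 0 (frag_extend (K 0) (frag_of x)) = act_chain 0 z (frag_of x) - frag_of x"
        using K(1)[of 0, unfolded homotopy_at_def, THEN conjunct2, THEN conjunct2, THEN bspec, of "frag_of x"] x
        by (simp add: is_cycle_def)
      then show ?thesis using f_eq[of x] cyc[of "K 0 x"] K1[of x 0] x 0 by simp
    qed
    moreover have "f \<in> extensional (X 0)" using f 0 by (auto simp: equivariant_cochains_def PiE_def)
    ultimately have "f = (\<lambda>x\<in>X 0. \<zero>\<^bsub>M\<^esub>)" by (intro extensionalityI) auto
    then show ?thesis using 0 by (simp add: equivariant_cochains_def)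
  next
    case (Suc m)
    define e where "e = (\<lambda>y\<in>X m. pairing M (X n) h (K m y))"
    have eX: "e \<in> X m \<rightarrow> carrier M" using K1[of _ m] hX Suc by (auto simp: e_def intro!: M.pairing_closed)
    have "e \<in> carrier (cochains M \<rho> m)"
      using eX K1[of _ m] K2[of _ _ m] pair_act Suc
      by (auto simp: equivariant_cochains_def PiE_def e_def act_closed)
    moreover have "cobd M m e x = f x" if x: "x \<in> X n" for x
    proof -
      have bdx: "bd m (frag_of x) \<in> chains m" using x Suc by (intro chains_bd) auto
      have "pairing M (X m) e c = pairing M (X n) h (frag_extend (K m) c)" if "c \<in> chains m" for c
        using that
      proof (induction c rule: chain_induct)
        case (diff a b)
        have "frag_extend (K m) a \<in> chains n" "frag_extend (K m) b \<in> chains n"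
          using diff chains_extend[OF K1, of m] Suc by auto
        then show ?case using diff eX hX by (simp add: M.pairing_diff frag_extend_diff)
      next
        case (of y)
        then show ?case by (simp add: M.pairing_of[OF eX]) (simp add: e_def)
      qed (simp add: M.pairing_0[OF eX] M.pairing_0[OF hX])
      then have "cobd M m e x = pairing M (X n) h (frag_extend (K m) (bd m (frag_of x)))"
        using coboundary_map_pairing[of M e X m x face] eX x Suc face_closed M.abelian_group_axioms bdx by simp
      moreover have "bd n (K n x) = frag_of (act n z x) - frag_of x - frag_extend (K m) (bd m (frag_of x))"
        using K(2)[of m] x Suc by (simp add: homotopy_step_def)
      moreover have "frag_extend (K m) (bd m (frag_of x)) \<in> chains n"
        using chains_extend[OF K1 bdx] Suc by simp
      moreover have "frag_of (act n z x) - frag_of x \<in> chains n"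
        using x z act_closed by (intro chains_diff) auto
      ultimately have d: "f x \<ominus>\<^bsub>M\<^esub> cobd M m e x = \<zero>\<^bsub>M\<^esub>" "cobd M m e x \<in> carrier M"
        using cyc[of "K n x"] K1[OF x] f_eq[OF x] hX by (simp_all add: M.pairing_diff M.pairing_closed)
      have "f x = (f x \<ominus>\<^bsub>M\<^esub> cobd M m e x) \<oplus>\<^bsub>M\<^esub> cobd M m e x"
        using funcset_mem[OF fX x] d(2) by (simp add: M.minus_eq M.a_assoc M.l_neg)
      then show ?thesis using d by simp
    qed
    moreover have "cobd M m e \<in> extensional (X n)" "f \<in> extensional (X n)"
      using f Suc by (auto simp: coboundary_map_def equivariant_cochains_def PiE_def)
    ultimately show ?thesis using Suc by (auto intro!: bexI[of _ e] extensionalityI)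
  qed
qed

end

context free_acyclic_gset
begin

lemma mem_cochains:
  "f \<in> carrier (cochains M \<rho> n) \<longleftrightarrow>
     f \<in> X n \<rightarrow>\<^sub>E carrier M \<and> (\<forall>g\<in>carrier G. \<forall>x\<in>X n. f (act n g x) = \<rho> g (f x))"
  by (simp add: equivariant_cochains_def)

lemma cochains_simps:
  "\<zero>\<^bsub>cochains M \<rho> n\<^esub> = (\<lambda>x\<in>X n. \<zero>\<^bsub>M\<^esub>)"
  "f \<oplus>\<^bsub>cochains M \<rho> n\<^esub> h = (\<lambda>x\<in>X n. f x \<oplus>\<^bsub>M\<^esub> h x)"
  "r \<odot>\<^bsub>cochains M \<rho> n\<^esub> f = (\<lambda>x\<in>X n. r \<odot>\<^bsub>M\<^esub> f x)"
  by (simp_all add: equivariant_cochains_def)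

lemma cochains_group:
  assumes M: "coefficient_action G M \<rho>"
  shows "abelian_group (cochains M \<rho> n)" (is "abelian_group ?C")
    and cochains_neg: "\<And>f. f \<in> carrier (cochains M \<rho> n) \<Longrightarrow>
      \<ominus>\<^bsub>cochains M \<rho> n\<^esub> f = (\<lambda>x\<in>X n. \<ominus>\<^bsub>M\<^esub> f x)"
proof -
  interpret M: abelian_group M using M by (simp add: coefficient_action_def)
  note \<rho>_closed = coefficient_actionD(2)[OF M] and \<rho>_add = coefficient_actionD(3)[OF M]
  have \<rho>_0: "\<rho> g \<zero>\<^bsub>M\<^esub> = \<zero>\<^bsub>M\<^esub>" if "g \<in> carrier G" for g
    using additive_zero[OF M.abelian_group_axioms, of "\<rho> g"] \<rho>_closed[OF that] \<rho>_add[OF that] by blast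
  have \<rho>_neg: "\<rho> g (\<ominus>\<^bsub>M\<^esub> x) = \<ominus>\<^bsub>M\<^esub> \<rho> g x" if "g \<in> carrier G" "x \<in> carrier M" for g x
    using additive_minus[OF M.abelian_group_axioms, of "\<rho> g" "\<zero>\<^bsub>M\<^esub>" x] \<rho>_closed[OF that(1)] \<rho>_add[OF that(1)]
      \<rho>_0[OF that(1)] that by (simp add: M.minus_eq)
  have val: "f x \<in> carrier M" if "f \<in> carrier ?C" "x \<in> X n" for f x
    using that by (auto simp: mem_cochains)
  have zero: "\<zero>\<^bsub>?C\<^esub> \<in> carrier ?C" by (auto simp: mem_cochains cochains_simps act_closed \<rho>_0)
  have add: "f \<oplus>\<^bsub>?C\<^esub> h \<in> carrier ?C" if "f \<in> carrier ?C" "h \<in> carrier ?C" for f h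
    using that val by (auto simp: mem_cochains cochains_simps act_closed \<rho>_add)
  have neg: "(\<lambda>x\<in>X n. \<ominus>\<^bsub>M\<^esub> f x) \<in> carrier ?C" "(\<lambda>x\<in>X n. \<ominus>\<^bsub>M\<^esub> f x) \<oplus>\<^bsub>?C\<^esub> f = \<zero>\<^bsub>?C\<^esub>"
    if "f \<in> carrier ?C" for f
    using that val[OF that] by (auto simp: mem_cochains cochains_simps act_closed \<rho>_neg M.l_neg intro!: restrict_ext)
  show grp: "abelian_group ?C"
  proof (rule abelian_groupI)
    fix f assume f: "f \<in> carrier ?C"
    then have "f \<in> extensional (X n)" by (auto simp: mem_cochains PiE_def)
    then show "\<zero>\<^bsub>?C\<^esub> \<oplus>\<^bsub>?C\<^esub> f = f"
      by (intro extensionalityI[of _ "X n"]) (auto simp: cochains_simps val[OF f])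
    show "\<exists>h\<in>carrier ?C. h \<oplus>\<^bsub>?C\<^esub> f = \<zero>\<^bsub>?C\<^esub>" using neg[OF f] by blast
  qed (auto simp: zero add, (auto simp: cochains_simps val M.a_ac intro!: restrict_ext))
  fix f assume f: "f \<in> carrier ?C"
  then show "\<ominus>\<^bsub>?C\<^esub> f = (\<lambda>x\<in>X n. \<ominus>\<^bsub>M\<^esub> f x)"
    using neg[OF f] abelian_group.minus_equality[OF grp] by blast
qed

text \<open>Splitting the values of a cochain according to \<open>N = P True + P False\<close> can be done
  equivariantly because the action on simplices is free; hence the cochains with values in
  \<open>P True\<close> and in \<open>P False\<close> cover the cochains with values in \<open>N\<close>.\<close>

theorem equivariant_cohomology_shift:
  fixes R :: "('r, 'y) ring_scheme" and N :: "('r, 'm, 'u) module_scheme"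
  assumes N: "coefficient_action G N \<rho>"
    and smult_closed: "\<And>r x. r \<in> carrier R \<Longrightarrow> x \<in> carrier N \<Longrightarrow> r \<odot>\<^bsub>N\<^esub> x \<in> carrier N"
    and smult_add: "\<And>r x y. r \<in> carrier R \<Longrightarrow> x \<in> carrier N \<Longrightarrow> y \<in> carrier N \<Longrightarrow>
          r \<odot>\<^bsub>N\<^esub> (x \<oplus>\<^bsub>N\<^esub> y) = r \<odot>\<^bsub>N\<^esub> x \<oplus>\<^bsub>N\<^esub> r \<odot>\<^bsub>N\<^esub> y"
    and smult_act: "\<And>g r x. g \<in> carrier G \<Longrightarrow> r \<in> carrier R \<Longrightarrow> x \<in> carrier N \<Longrightarrow> \<rho> g (r \<odot>\<^bsub>N\<^esub> x) = r \<odot>\<^bsub>N\<^esub> \<rho> g x"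
    and P: "\<And>b. additive_subgroup (P b) N"
    and P_smult: "\<And>b r x. r \<in> carrier R \<Longrightarrow> x \<in> P b \<Longrightarrow> r \<odot>\<^bsub>N\<^esub> x \<in> P b"
    and P_act: "\<And>b g x. g \<in> carrier G \<Longrightarrow> x \<in> P b \<Longrightarrow> \<rho> g x \<in> P b"
    and cover: "\<And>x. x \<in> carrier N \<Longrightarrow> \<exists>y\<in>P True. \<exists>y'\<in>P False. x = y \<oplus>\<^bsub>N\<^esub> y'"
    and z: "z \<in> carrier G" "\<And>g. g \<in> carrier G \<Longrightarrow> z \<otimes> g = g \<otimes> z"
    and solve: "\<And>b c. c \<in> P b \<Longrightarrow> \<exists>!a. a \<in> P b \<and> \<rho> z a = a \<oplus>\<^bsub>N\<^esub> c"
    and \<rho>': "\<And>g x. g \<in> carrier G \<Longrightarrow> x \<in> P True \<inter> P False \<Longrightarrow> \<rho>' g x = \<rho> g x"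
  shows "module_isomorphic R
     (cohomology (cochains N \<rho>) (cobd N) i)
     (cohomology (cochains (N\<lparr>carrier := P True \<inter> P False\<rparr>) \<rho>')
        (cobd (N\<lparr>carrier := P True \<inter> P False\<rparr>)) (i + 1))"
proof -
  interpret N: abelian_group N using N by (simp add: coefficient_action_def)
  note NG = N.abelian_group_axioms
  let ?C = "cochains N \<rho>" and ?d = "cobd N"
  define F where "F Q n = carrier (cochains (N\<lparr>carrier := Q\<rparr>) \<rho> n)" for Q n
  have N_all: "additive_subgroup (carrier N) N"
    by (rule N.additive_subgroup_criterion) auto
  have val: "f x \<in> carrier N" if "f \<in> carrier (?C n)" "x \<in> X n" for f n x
    using that by (auto simp: mem_cochains)
  note \<rho>_closed = coefficient_actionD(2)[OF N] and \<rho>_add = coefficient_actionD(3)[OF N]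
  have FQ: "f \<in> F Q n \<longleftrightarrow> f \<in> carrier (?C n) \<and> (\<forall>x\<in>X n. f x \<in> Q)" if "additive_subgroup Q N" for Q n f
    using additive_subgroup.a_subset[OF that] unfolding F_def mem_cochains by (auto simp: PiE_iff)
  have d_rest: "cobd (N\<lparr>carrier := Q\<rparr>) n f = ?d n f"
    if Q: "additive_subgroup Q N" and f: "f \<in> X n \<rightarrow> Q" for Q n f
  proof -
    have fN: "f \<in> X n \<rightarrow> carrier N" using f additive_subgroup.a_subset[OF Q] by auto
    have f': "f \<in> X n \<rightarrow> carrier (N\<lparr>carrier := Q\<rparr>)" using f by simp
    have "cobd (N\<lparr>carrier := Q\<rparr>) n f x = ?d n f x" if x: "x \<in> X (Suc n)" for x
      using bd_frag_of[OF x] pairing_restrict[OF NG Q f]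
      by (simp add: coboundary_pairing[OF abelian_group_restrict[OF NG Q] f' x]
           coboundary_pairing[OF NG fN x])
    then show ?thesis by (intro extensionalityI[of _ "X (Suc n)"]) (auto simp: coboundary_map_def)
  qed
  have FD: "f \<in> X n \<rightarrow> Q" if "f \<in> F Q n" for f n Q using that by (auto simp: F_def mem_cochains)
  have dF: "?d n f \<in> F Q (Suc n)"
    if Q: "additive_subgroup Q N" and Q_act: "\<And>g x. g \<in> carrier G \<Longrightarrow> x \<in> Q \<Longrightarrow> \<rho> g x \<in> Q" and f: "f \<in> F Q n" for Q n f
  proof -
    have fC: "f \<in> carrier (?C n)" using f FQ[OF Q] by simp
    have f1: "f \<in> X n \<rightarrow> carrier N" using fC by (auto simp: mem_cochains)
    have "?d n f x \<in> Q" if "x \<in> X (Suc n)" for x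
      using coboundary_closed[OF abelian_group_restrict[OF NG Q], of f n x] FD[OF f] that
      by (simp add: d_rest[OF Q FD[OF f]])
    moreover have "?d n f (act (Suc n) g x) = \<rho> g (?d n f x)" if g: "g \<in> carrier G" and x: "x \<in> X (Suc n)" for g x
    proof -
      have "bd n (frag_of (act (Suc n) g x)) = act_chain n g (bd n (frag_of x))"
        using bd_act[OF g, of "frag_of x" n] x by simp
      then show ?thesis
        using pairing_act[OF N f1 _ g bd_frag_of[OF x]] fC
        by (simp add: coboundary_pairing[OF NG f1] act_closed[OF g] x mem_cochains)
    qed
    moreover have "?d n f \<in> extensional (X (Suc n))" by (simp add: coboundary_map_def)
    ultimately show ?thesis by (auto simp: F_def mem_cochains PiE_iff)
  qed
  have sub: "additive_subgroup (F Q n) (?C n)"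
    if Q: "additive_subgroup Q N" for Q n
  proof -
    interpret Q: additive_subgroup Q N by fact
    interpret C: abelian_group "?C n" by (rule cochains_group[OF N])
    show ?thesis
      by (rule C.additive_subgroup_criterion)
         (auto simp: FQ[OF Q], auto simp: cochains_neg[OF N] cochains_simps)
  qed
  have smultF: "r \<odot>\<^bsub>?C n\<^esub> f \<in> F Q n"
    if "additive_subgroup Q N" "\<And>x. x \<in> Q \<Longrightarrow> r \<odot>\<^bsub>N\<^esub> x \<in> Q" "r \<in> carrier R" "f \<in> F Q n" for Q r n f
    using that val by (auto simp: FQ) (auto simp: mem_cochains cochains_simps smult_closed smult_act act_closed)
  have acyclic: "case n of 0 \<Rightarrow> f = \<zero>\<^bsub>?C 0\<^esub> | Suc m \<Rightarrow> \<exists>e\<in>F Q m. ?d m e = f"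
    if Q: "additive_subgroup Q N" and Q_act: "\<And>g x. g \<in> carrier G \<Longrightarrow> x \<in> Q \<Longrightarrow> \<rho> g x \<in> Q"
      and solve: "\<And>b. b \<in> Q \<Longrightarrow> \<exists>!a. a \<in> Q \<and> \<rho> z a = a \<oplus>\<^bsub>N\<^esub> b"
      and f: "f \<in> F Q n" and cocycle: "?d n f = \<zero>\<^bsub>?C (Suc n)\<^esub>" for Q n f
  proof -
    let ?Q = "N\<lparr>carrier := Q\<rparr>"
    have "coefficient_action G ?Q \<rho>"
      using N Q_act abelian_group_restrict[OF NG Q]
      by (simp add: coefficient_action_def additive_subgroup.a_Hcarr[OF Q])
    moreover have "cobd ?Q n f = \<zero>\<^bsub>cochains ?Q \<rho> (Suc n)\<^esub>"
      using cocycle by (simp add: d_rest[OF Q FD[OF f]] cochains_simps)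
    moreover have "f \<in> carrier (cochains ?Q \<rho> n)" using f by (simp add: F_def)
    ultimately have "case n of 0 \<Rightarrow> f = \<zero>\<^bsub>cochains ?Q \<rho> 0\<^esub>
      | Suc m \<Rightarrow> \<exists>e\<in>F Q m. cobd ?Q m e = f"
      unfolding F_def using solve by (intro cocycle_is_coboundary[where z = z]) (simp_all add: z)
    then show ?thesis using d_rest[OF Q FD] by (auto simp: cochains_simps split: nat.splits)
  qed
  interpret acyclic_cover R ?C ?d "\<lambda>b. F (P b)"
  proof (rule acyclic_cover.intro)
    fix n f
    show "abelian_group (?C n)" by (rule cochains_group[OF N])
    show d: "?d n f \<in> carrier (?C (Suc n))" if "f \<in> carrier (?C n)"
      using dF[OF N_all \<rho>_closed, of f n] that FQ[OF N_all] val by auto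
    show "?d (Suc n) (?d n f) = \<zero>\<^bsub>?C (Suc (Suc n))\<^esub>" if f: "f \<in> carrier (?C n)"
    proof -
      have f1: "f \<in> X n \<rightarrow> carrier N" using f val by blast
      have f2: "?d n f \<in> X (Suc n) \<rightarrow> carrier N" using d[OF f] val by blast
      have "?d (Suc n) (?d n f) x = \<zero>\<^bsub>N\<^esub>" if x: "x \<in> X (Suc (Suc n))" for x
        by (simp only: coboundary_pairing[OF NG f2 x]
            pairing_coboundary[OF NG f1 bd_frag_of[OF x]] bd_bd[OF x] N.pairing_0[OF f1])
      then show ?thesis
        by (intro extensionalityI[of _ "X (Suc (Suc n))"]) (auto simp: cochains_simps, simp add: coboundary_map_def)
    qed
    show "\<exists>e\<in>F (P True) n. \<exists>e'\<in>F (P False) n. f = e \<oplus>\<^bsub>?C n\<^esub> e'" if f: "f \<in> carrier (?C n)"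
    proof -
      interpret P1: additive_subgroup "P True" N by (rule P)
      interpret P2: additive_subgroup "P False" N by (rule P)
      have f_act: "f (act n g x) = \<rho> g (f x)" if "g \<in> carrier G" "x \<in> X n" for g x
        using f that by (auto simp: mem_cochains)
      obtain e where e: "\<And>x. x \<in> X n \<Longrightarrow> e x \<in> P True" "\<And>x. x \<in> X n \<Longrightarrow> f x \<ominus>\<^bsub>N\<^esub> e x \<in> P False"
        "\<And>g x. g \<in> carrier G \<Longrightarrow> x \<in> X n \<Longrightarrow> e (act n g x) = \<rho> g (e x)"
      proof (rule equivariant_choice[where n = n and Y = "P True" and B = \<rho> and P = "\<lambda>x y. f x \<ominus>\<^bsub>N\<^esub> y \<in> P False"])
        fix x assume x: "x \<in> X n"
        then obtain y y' where y: "y \<in> P True" "y' \<in> P False" "f x = y \<oplus>\<^bsub>N\<^esub> y'" using cover val[OF f] by blast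
        then have yN: "y \<in> carrier N" "y' \<in> carrier N" by auto
        then have "f x \<ominus>\<^bsub>N\<^esub> y = y'"
          unfolding y(3) N.a_comm[OF yN] by (simp add: N.minus_eq N.a_assoc N.r_neg)
        then show "\<exists>y\<in>P True. f x \<ominus>\<^bsub>N\<^esub> y \<in> P False" using y by blast
        fix g y assume g: "g \<in> carrier G" and y: "y \<in> P True" "f x \<ominus>\<^bsub>N\<^esub> y \<in> P False"
        have "f (act n g x) \<ominus>\<^bsub>N\<^esub> \<rho> g y = \<rho> g (f x \<ominus>\<^bsub>N\<^esub> y)"
          using additive_minus[OF NG, of "\<rho> g" "f x" y] \<rho>_closed[OF g] \<rho>_add[OF g] val[OF f x] y
          by (simp add: f_act g x)
        then show "f (act n g x) \<ominus>\<^bsub>N\<^esub> \<rho> g y \<in> P False" using P_act[OF g y(2)] by simp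
      qed (use P_act N in \<open>auto simp: coefficient_action_def\<close>)
      let ?e = "\<lambda>x\<in>X n. e x" and ?e' = "\<lambda>x\<in>X n. f x \<ominus>\<^bsub>N\<^esub> e x"
      have "?e \<in> F (P True) n" using e act_closed by (auto simp: F_def mem_cochains)
      moreover have "f (act n g x) \<ominus>\<^bsub>N\<^esub> e (act n g x) = \<rho> g (f x \<ominus>\<^bsub>N\<^esub> e x)"
        if g: "g \<in> carrier G" and x: "x \<in> X n" for g x
        using additive_minus[OF NG, of "\<rho> g" "f x" "e x"] \<rho>_closed[OF g] \<rho>_add[OF g] val[OF f x] e x
        by (simp add: f_act g)
      then have "?e' \<in> F (P False) n" using e act_closed by (auto simp: F_def mem_cochains)
      moreover have "f = ?e \<oplus>\<^bsub>?C n\<^esub> ?e'"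
      proof (rule extensionalityI[of _ "X n"])
        show "f \<in> extensional (X n)" using f by (auto simp: mem_cochains PiE_def)
        fix x assume x: "x \<in> X n"
        then show "f x = (?e \<oplus>\<^bsub>?C n\<^esub> ?e') x"
          using val[OF f x] P1.a_Hcarr[OF e(1)[OF x]] by (simp add: cochains_simps N.minus_eq N.a_lcomm[of "e x" "f x"] N.r_neg)
      qed (simp add: cochains_simps)
      ultimately show ?thesis by blast
    qed
  next
    fix n f h assume fh: "f \<in> carrier (?C n)" "h \<in> carrier (?C n)"
    have "?d n (f \<oplus>\<^bsub>?C n\<^esub> h) x = (?d n f \<oplus>\<^bsub>?C (Suc n)\<^esub> ?d n h) x" if x: "x \<in> X (Suc n)" for x
    proof -
      have fc: "f (face (Suc n) k x) \<in> carrier N" "h (face (Suc n) k x) \<in> carrier N" if "k \<le> Suc n" for k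
        using val fh face_closed[OF x that] by auto
      then have "(\<Oplus>\<^bsub>N\<^esub>k\<in>{..Suc n}. add_pow N ((-1::int) ^ k) ((f \<oplus>\<^bsub>?C n\<^esub> h) (face (Suc n) k x))) =
          (\<Oplus>\<^bsub>N\<^esub>k\<in>{..Suc n}. add_pow N ((-1::int) ^ k) (f (face (Suc n) k x)) \<oplus>\<^bsub>N\<^esub>
            add_pow N ((-1::int) ^ k) (h (face (Suc n) k x)))"
        using face_closed[OF x] by (intro N.finsum_cong') (auto simp: cochains_simps N.add.int_pow_distrib)
      also have "\<dots> = ?d n f x \<oplus>\<^bsub>N\<^esub> ?d n h x"
        using fc x by (subst N.finsum_addf) (auto simp: coboundary_map_def)
      finally show ?thesis using x by (simp add: coboundary_map_def cochains_simps)
    qed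
    then show "?d n (f \<oplus>\<^bsub>?C n\<^esub> h) = ?d n f \<oplus>\<^bsub>?C (Suc n)\<^esub> ?d n h"
      by (intro extensionalityI[of _ "X (Suc n)"]) (auto simp: coboundary_map_def cochains_simps)
  next
    fix n r f assume r: "r \<in> carrier R" and f: "f \<in> carrier (?C n)"
    show "r \<odot>\<^bsub>?C n\<^esub> f \<in> carrier (?C n)"
      using smultF[OF N_all, of r f n] smult_closed r f FQ[OF N_all] val by auto
    have fX: "f \<in> X n \<rightarrow> carrier N" "r \<odot>\<^bsub>?C n\<^esub> f \<in> X n \<rightarrow> carrier N"
      using val f r by (auto simp: cochains_simps smult_closed)
    have "?d n (r \<odot>\<^bsub>?C n\<^esub> f) x = (r \<odot>\<^bsub>?C (Suc n)\<^esub> ?d n f) x" if x: "x \<in> X (Suc n)" for x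
    proof -
      have "pairing N (X n) (r \<odot>\<^bsub>?C n\<^esub> f) (bd n (frag_of x)) =
          r \<odot>\<^bsub>N\<^esub> pairing N (X n) f (bd n (frag_of x))"
        by (rule pairing_natural[OF NG NG fX(1)])
           (use bd_frag_of[OF x] r smult_closed smult_add in \<open>auto simp: cochains_simps\<close>)
      then show ?thesis
        by (simp only: coboundary_pairing[OF NG fX(2) x])
           (simp add: cochains_simps coboundary_pairing[OF NG fX(1) x] x)
    qed
    then show "?d n (r \<odot>\<^bsub>?C n\<^esub> f) = r \<odot>\<^bsub>?C (Suc n)\<^esub> ?d n f"
      by (intro extensionalityI[of _ "X (Suc n)"]) (auto simp: coboundary_map_def cochains_simps)
  next
    fix n r f h assume "r \<in> carrier R" "f \<in> carrier (?C n)" "h \<in> carrier (?C n)"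
    then show "r \<odot>\<^bsub>?C n\<^esub> (f \<oplus>\<^bsub>?C n\<^esub> h) = r \<odot>\<^bsub>?C n\<^esub> f \<oplus>\<^bsub>?C n\<^esub> r \<odot>\<^bsub>?C n\<^esub> h"
      using val by (auto simp: cochains_simps smult_add intro!: restrict_ext)
  next
    fix b n show "additive_subgroup (F (P b) n) (?C n)" by (rule sub[OF P])
  next
    fix b n r f assume "r \<in> carrier R" "f \<in> F (P b) n"
    then show "r \<odot>\<^bsub>?C n\<^esub> f \<in> F (P b) n" using smultF[OF P P_smult] by blast
  next
    fix b n f assume "f \<in> F (P b) n"
    then show "?d n f \<in> F (P b) (Suc n)" using dF[OF P P_act] by blast
  next
    fix b f assume "f \<in> F (P b) 0" "?d 0 f = \<zero>\<^bsub>?C (Suc 0)\<^esub>"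
    then show "f = \<zero>\<^bsub>?C 0\<^esub>" using acyclic[OF P[of b] P_act solve, of f 0] by auto
  next
    fix b n f assume "f \<in> F (P b) (Suc n)" "?d (Suc n) f = \<zero>\<^bsub>?C (Suc (Suc n))\<^esub>"
    then show "\<exists>e\<in>F (P b) n. ?d n e = f" using acyclic[OF P[of b] P_act solve, of f "Suc n"] by auto
  qed
  have PP: "additive_subgroup (P True \<inter> P False) N"
  proof -
    interpret P1: additive_subgroup "P True" N by (rule P)
    interpret P2: additive_subgroup "P False" N by (rule P)
    show ?thesis by (rule N.additive_subgroup_criterion) auto
  qed
  have "cochains (N\<lparr>carrier := P True \<inter> P False\<rparr>) \<rho>' n = (?C n)\<lparr>carrier := F (P True) n \<inter> F (P False) n\<rparr>" for n
  proof -
    have "carrier (cochains (N\<lparr>carrier := P True \<inter> P False\<rparr>) \<rho>' n) = F (P True) n \<inter> F (P False) n"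
      using \<rho>' unfolding F_def by (auto simp: mem_cochains PiE_iff)
    then show ?thesis by (simp add: equivariant_cochains_def)
  qed
  then have "cochains (N\<lparr>carrier := P True \<inter> P False\<rparr>) \<rho>' = (\<lambda>n. (?C n)\<lparr>carrier := F (P True) n \<inter> F (P False) n\<rparr>)"
    by (rule ext)
  moreover have "cobd (N\<lparr>carrier := P True \<inter> P False\<rparr>) n f = ?d n f" if "f \<in> F (P True) n \<inter> F (P False) n" for n f
    using that FD by (intro d_rest[OF PP]) blast
  ultimately show ?thesis
    using cohomology_shift[of "cobd (N\<lparr>carrier := P True \<inter> P False\<rparr>)" i] by simp
qed

end

section \<open>The standard resolution\<close>

text \<open>The boundary of the augmented complex, in which the empty tuple is the only simplex of degree
  \<open>-1\<close>; including it makes the cone formula \<open>list_bd_Cons\<close> uniform in the length.\<close>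

definition list_bd :: "'x list \<Rightarrow> 'x list \<Rightarrow>\<^sub>0 int" where
  "list_bd xs = (\<Sum>k<length xs. frag_cmul ((-1) ^ k) (frag_of (take k xs @ drop (Suc k) xs)))"

definition list_cone :: "'x \<Rightarrow> ('x list \<Rightarrow>\<^sub>0 int) \<Rightarrow> 'x list \<Rightarrow>\<^sub>0 int" where
  "list_cone g = frag_extend (\<lambda>xs. frag_of (g # xs))"

lemma list_bd_Cons: "list_bd (g # xs) = frag_of xs - list_cone g (list_bd xs)"
proof -
  have "list_cone g (list_bd xs) =
      (\<Sum>k<length xs. frag_cmul ((-1) ^ k) (frag_of (g # take k xs @ drop (Suc k) xs)))"
    by (simp add: list_cone_def list_bd_def frag_extend_sum o_def frag_extend_cmul)
  moreover have "list_bd (g # xs) = frag_of xs +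
      (\<Sum>k<length xs. - frag_cmul ((-1) ^ k) (frag_of (g # take k xs @ drop (Suc k) xs)))"
    unfolding list_bd_def by (simp add: sum.lessThan_Suc_shift del: sum.lessThan_Suc)
  ultimately show ?thesis by (simp add: sum_negf[symmetric])
qed

lemma list_bd_cone: "frag_extend list_bd (list_cone g c) = c - list_cone g (frag_extend list_bd c)"
  using subset_UNIV
  by (induction c rule: frag_induction) (auto simp: list_cone_def frag_extend_diff list_bd_Cons)

lemma list_bd_bd: "frag_extend list_bd (list_bd xs) = 0"
proof (induction xs)
  case (Cons g xs)
  then show ?case by (simp add: list_bd_Cons frag_extend_diff list_bd_cone) (simp add: list_cone_def)
qed (simp add: list_bd_def)

lemma (in group) free_acyclic_tuples:
  "free_acyclic_gset G (group_tuples G) (\<lambda>n g. map (\<lambda>h. g \<otimes> h)) (\<lambda>n k gs. take k gs @ drop (Suc k) gs)"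
proof -
  let ?face = "\<lambda>(n::nat) k gs. take k gs @ drop (Suc k) gs"
  have bd: "chain_bd ?face n c = frag_extend list_bd c" if "Poly_Mapping.keys c \<subseteq> group_tuples G (Suc n)" for n c
    unfolding chain_bd_def
  proof (rule frag_extend_eq)
    fix xs assume "xs \<in> Poly_Mapping.keys c"
    then have "length xs = Suc (Suc n)" using that by (auto simp: group_tuples_def)
    then show "(\<Sum>k\<le>Suc n. frag_cmul ((-1) ^ k) (frag_of (take k xs @ drop (Suc k) xs))) = list_bd xs"
      by (simp only: list_bd_def lessThan_Suc_atMost)
  qed
  have face_closed: "?face (Suc n) k xs \<in> group_tuples G n" if "xs \<in> group_tuples G (Suc n)" "k \<le> Suc n" for n k xs
  proof -
    have "set (take k xs @ drop (Suc k) xs) \<subseteq> set xs" by (auto dest: in_set_takeD in_set_dropD)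
    then show ?thesis using that by (auto simp: group_tuples_def in_lists_conv_set simp del: set_append)
  qed
  have bd_closed: "Poly_Mapping.keys (list_bd xs) \<subseteq> group_tuples G n" if "xs \<in> group_tuples G (Suc n)" for xs n
  proof -
    have "Poly_Mapping.keys (list_bd xs) \<subseteq>
        (\<Union>k<length xs. Poly_Mapping.keys (frag_cmul ((-1) ^ k) (frag_of (take k xs @ drop (Suc k) xs))))"
      unfolding list_bd_def by (rule keys_sum)
    also have "\<dots> \<subseteq> group_tuples G n"
    proof (intro UN_least)
      fix k assume "k \<in> {..<length xs}"
      then have "k \<le> Suc n" using that by (simp add: group_tuples_def)
      then show "Poly_Mapping.keys (frag_cmul ((-1) ^ k) (frag_of (take k xs @ drop (Suc k) xs))) \<subseteq> group_tuples G n"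
        using face_closed[OF that] by (auto split: if_splits)
    qed
    finally show ?thesis .
  qed
  show ?thesis
  proof (rule free_acyclic_gset.intro[OF group_axioms], rule free_acyclic_gset_axioms.intro)
    fix n g x assume gx: "g \<in> carrier G" "x \<in> group_tuples G n"
    show "map ((\<otimes>) g) x \<in> group_tuples G n" using gx by (auto simp: group_tuples_def)
    assume e: "map ((\<otimes>) g) x = x"
    obtain y ys where y: "x = y # ys" "y \<in> carrier G" using gx by (cases x) (auto simp: group_tuples_def)
    then have "g \<otimes> y = y" using e by simp
    then show "g = \<one>" using gx y by (simp add: r_cancel_one')
  next
    fix n g h x assume "g \<in> carrier G" "h \<in> carrier G" "x \<in> group_tuples G n"
    then show "map ((\<otimes>) (g \<otimes> h)) x = map ((\<otimes>) g) (map ((\<otimes>) h) x)"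
      by (auto simp: group_tuples_def m_assoc)
  next
    fix n x assume "x \<in> group_tuples G n"
    then show "map ((\<otimes>) \<one>) x = x" by (auto simp: group_tuples_def intro: map_idI)
  next
    fix n k x assume "x \<in> group_tuples G (Suc n)" "k \<le> Suc n"
    then show "take k x @ drop (Suc k) x \<in> group_tuples G n"
      by (rule face_closed)
  next
    fix n k g x
    show "take k (map ((\<otimes>) g) x) @ drop (Suc k) (map ((\<otimes>) g) x) = map ((\<otimes>) g) (take k x @ drop (Suc k) x)"
      by (simp add: take_map drop_map)
  next
    fix n x assume x: "x \<in> group_tuples G (Suc (Suc n))"
    have "chain_bd ?face (Suc n) (frag_of x) = list_bd x" using bd[of "frag_of x" "Suc n"] x by simp
    then show "chain_bd ?face n (chain_bd ?face (Suc n) (frag_of x)) = 0"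
      using bd[OF bd_closed[OF x]] list_bd_bd by simp
  next
    fix x y assume "x \<in> group_tuples G 0" "y \<in> group_tuples G 0"
    then obtain a b where ab: "x = [a]" "y = [b]" "a \<in> carrier G" "b \<in> carrier G"
      by (auto simp: group_tuples_def length_Suc_conv)
    have "chain_bd ?face 0 (frag_of [a, b]) = list_bd [a, b]"
      using bd[of "frag_of [a, b]" 0] ab by (simp add: group_tuples_def)
    then have "chain_bd ?face 0 (frag_of [a, b]) = frag_of y - frag_of x"
      by (simp add: list_bd_def ab lessThan_Suc)
    moreover have "Poly_Mapping.keys (frag_of [a, b]) \<subseteq> group_tuples G (Suc 0)"
      using ab by (simp add: group_tuples_def)
    ultimately show "\<exists>c. Poly_Mapping.keys c \<subseteq> group_tuples G (Suc 0) \<and> chain_bd ?face 0 c = frag_of y - frag_of x"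
      by blast
  next
    fix n c assume c: "Poly_Mapping.keys c \<subseteq> group_tuples G (Suc n)" "chain_bd ?face n c = 0"
    have k: "Poly_Mapping.keys (list_cone \<one> c) \<subseteq> group_tuples G (Suc (Suc n))"
    proof -
      have "Poly_Mapping.keys (list_cone \<one> c) \<subseteq> (\<Union>x\<in>Poly_Mapping.keys c. {\<one> # x})"
        using keys_frag_extend[of "\<lambda>xs. frag_of (\<one> # xs)" c] by (simp add: list_cone_def)
      also have "\<dots> \<subseteq> group_tuples G (Suc (Suc n))" using c(1) by (force simp: group_tuples_def)
      finally show ?thesis .
    qed
    have "chain_bd ?face (Suc n) (list_cone \<one> c) = c"
      using c bd[OF k] bd[OF c(1)] by (simp add: list_bd_cone) (simp add: list_cone_def)
    then show "\<exists>e. Poly_Mapping.keys e \<subseteq> group_tuples G (Suc (Suc n)) \<and> chain_bd ?face (Suc n) e = c"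
      using k by blast
  qed
qed

section \<open>Singular chains of a universal covering\<close>

lemma chain_bd_singular: "chain_bd singular_face n = chain_boundary (Suc n)"
  by (intro ext) (simp add: chain_bd_def chain_boundary_def)

lemma contractible_cycle_is_boundary:
  assumes "contractible_space E" "singular_chain (Suc n) E c" "chain_boundary (Suc n) c = 0"
  shows "\<exists>e. singular_chain (Suc (Suc n)) E e \<and> chain_boundary (Suc (Suc n)) e = c"
proof -
  let ?H = "singular_relboundary_set (Suc n) E {}" and ?Z = "relcycle_group (Suc n) E {}"
  have "trivial_group (homology_group (int (Suc n)) E)"
    using trivial_reduced_homology_group_contractible_space[OF assms(1), of "int (Suc n)"]
    by (simp add: un_reduced_homology_group)
  then have "trivial_group (?Z Mod ?H)" by (simp only: nontrivial_relative_homology_group)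
  then have "carrier (?Z Mod ?H) = {?H}" by (simp add: trivial_group_def FactGroup_def)
  moreover have c: "c \<in> carrier ?Z" using assms(2,3) by (simp add: singular_cycle)
  then have "?H #>\<^bsub>?Z\<^esub> c \<in> carrier (?Z Mod ?H)" by (auto simp: FactGroup_def RCOSETS_def)
  moreover have "c \<in> ?H #>\<^bsub>?Z\<^esub> c"
    using c group.rcos_self[OF _ _ subgroup_singular_relboundary_relcycle] by auto
  ultimately have "singular_relboundary (Suc n) E {} c" by auto
  then show ?thesis by (simp add: singular_boundary)
qed

text \<open>A path, viewed as a singular simplex of dimension \<open>1\<close> by means of the second barycentric
  coordinate.\<close>

lemma path_connected_points_homologous:
  assumes "path_connected_space E" "singular_simplex 0 E x" "singular_simplex 0 E y"
  shows "\<exists>c. singular_chain (Suc 0) E c \<and> chain_boundary (Suc 0) c = frag_of y - frag_of x"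
proof -
  define v :: "nat \<Rightarrow> real" where "v = (\<lambda>j. if j = 0 then 1 else 0)"
  have s0: "standard_simplex 0 = {v}" by (simp add: standard_simplex_0 v_def)
  have "x v \<in> topspace E" "y v \<in> topspace E"
    using assms(2,3) by (auto simp: singular_simplex_def continuous_map_def s0 Pi_iff)
  then obtain g where g: "pathin E g" "g 0 = x v" "g 1 = y v"
    using assms(1) by (auto simp: path_connected_space_def)
  define \<sigma> where "\<sigma> = restrict (g \<circ> (\<lambda>t. t 1)) (standard_simplex (Suc 0))"
  have "continuous_map (subtopology (powertop_real UNIV) (standard_simplex (Suc 0))) (top_of_set {0..1}) (\<lambda>t. t 1)"
    using standard_simplex_01[of "Suc 0"]
    by (auto simp: continuous_map_in_subtopology intro!: continuous_map_from_subtopology continuous_map_product_projection)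
  then have \<sigma>: "singular_simplex (Suc 0) E \<sigma>"
    using g(1) unfolding singular_simplex_def \<sigma>_def pathin_def
    by (auto intro: continuous_map_eq[OF continuous_map_compose])
  have v_in: "simplical_face k v \<in> standard_simplex (Suc 0)" if "k \<le> 1" for k
    using simplical_face_in_standard_simplex[of 1 k v] that by (simp add: s0)
  have "singular_face (Suc 0) 0 \<sigma> = y"
  proof (rule extensionalityI[of _ "{v}"])
    show "y \<in> extensional {v}" using assms(3) by (simp add: singular_simplex_def s0)
  qed (use v_in[of 0] g in \<open>auto simp: singular_face_def s0 \<sigma>_def simplical_face_def v_def\<close>)
  moreover have "singular_face (Suc 0) 1 \<sigma> = x"
  proof (rule extensionalityI[of _ "{v}"])
    show "x \<in> extensional {v}" using assms(2) by (simp add: singular_simplex_def s0)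
  qed (use v_in[of 1] g in \<open>auto simp: singular_face_def s0 \<sigma>_def simplical_face_def v_def\<close>)
  ultimately have "chain_boundary (Suc 0) (frag_of \<sigma>) = frag_of y - frag_of x"
    by (simp add: chain_boundary_of)
  then show ?thesis using \<sigma> by (metis singular_chain_of)
qed

lemma free_acyclic_singular:
  assumes "classifying_space G B E p \<phi>"
  shows "free_acyclic_gset G (\<lambda>n. singular_simplex_set n E) (\<lambda>n g. simplex_map n (\<phi> g)) singular_face"
proof -
  have con: "contractible_space E" and ga: "group_action G (topspace E) \<phi>"
    and cont: "\<And>g. g \<in> carrier G \<Longrightarrow> continuous_map E E (\<phi> g)"
    and disc: "\<And>e. e \<in> topspace E \<Longrightarrow> \<exists>U. openin E U \<and> e \<in> U \<and>
        (\<forall>g\<in>carrier G. g \<noteq> \<one>\<^bsub>G\<^esub> \<longrightarrow> \<phi> g ` U \<inter> U = {})"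
    using assms by (auto simp: classifying_space_def)
  interpret group_action G "topspace E" \<phi> by (rule ga)
  have grp: "group G" using group_hom by (simp add: group_hom_def)
  have pc: "path_connected_space E" by (rule contractible_imp_path_connected_space[OF con])
  show ?thesis
  proof (rule free_acyclic_gset.intro[OF grp], rule free_acyclic_gset_axioms.intro)
    fix n g x assume gx: "g \<in> carrier G" "x \<in> singular_simplex_set n E"
    show "simplex_map n (\<phi> g) x \<in> singular_simplex_set n E"
      using gx by (simp add: singular_simplex_simplex_map[OF _ cont])
    assume e: "simplex_map n (\<phi> g) x = x"
    obtain v where v: "v \<in> standard_simplex n" using nonempty_standard_simplex by blast
    then have "x v \<in> topspace E" using gx by (auto simp: singular_simplex_def continuous_map_def Pi_iff)
    from disc[OF this] obtain U where U: "x v \<in> U" "\<forall>g\<in>carrier G. g \<noteq> \<one>\<^bsub>G\<^esub> \<longrightarrow> \<phi> g ` U \<inter> U = {}"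
      by (elim exE conjE) (rule that)
    have "\<phi> g (x v) = x v" using fun_cong[OF e, of v] v by (simp add: simplex_map_def)
    then have "x v \<in> \<phi> g ` U \<inter> U" using U by (metis IntI image_eqI)
    then show "g = \<one>\<^bsub>G\<^esub>" using U gx by blast
  next
    fix n g h x assume a: "g \<in> carrier G" "h \<in> carrier G" "x \<in> singular_simplex_set n E"
    have "simplex_map n (\<phi> (g \<otimes>\<^bsub>G\<^esub> h)) x = simplex_map n (\<phi> g \<circ> \<phi> h) x"
      using a composition_rule by (intro simplex_map_eq[of n E]) auto
    then show "simplex_map n (\<phi> (g \<otimes>\<^bsub>G\<^esub> h)) x = simplex_map n (\<phi> g) (simplex_map n (\<phi> h) x)"
      by (simp add: simplex_map_compose)
  next
    fix n x assume "x \<in> singular_simplex_set n E"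
    then show "simplex_map n (\<phi> \<one>\<^bsub>G\<^esub>) x = x"
      by (intro simplex_map_id_gen[of n E]) (simp_all flip: id_eq_one)
  next
    fix n k x assume "x \<in> singular_simplex_set (Suc n) E" "k \<le> Suc n"
    then show "singular_face (Suc n) k x \<in> singular_simplex_set n E"
      using singular_simplex_singular_face[of "Suc n" E x k] by simp
  next
    fix n k g x assume "k \<le> Suc n"
    then show "singular_face (Suc n) k (simplex_map (Suc n) (\<phi> g) x) = simplex_map n (\<phi> g) (singular_face (Suc n) k x)"
      by (simp add: singular_face_simplex_map) (auto simp: simplex_map_def singular_face_def)
  next
    fix n x assume "x \<in> singular_simplex_set (Suc (Suc n)) E"
    then show "chain_bd singular_face n (chain_bd singular_face (Suc n) (frag_of x)) = 0"
      by (simp add: chain_bd_singular chain_boundary_boundary_alt[of "Suc n" E] singular_chain_of)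
  next
    fix x y assume "x \<in> singular_simplex_set 0 E" "y \<in> singular_simplex_set 0 E"
    then show "\<exists>c. Poly_Mapping.keys c \<subseteq> singular_simplex_set (Suc 0) E \<and> chain_bd singular_face 0 c = frag_of y - frag_of x"
      using path_connected_points_homologous[OF pc] by (simp add: chain_bd_singular singular_chain_def)
  next
    fix n c assume "Poly_Mapping.keys c \<subseteq> singular_simplex_set (Suc n) E" "chain_bd singular_face n c = 0"
    then show "\<exists>e. Poly_Mapping.keys e \<subseteq> singular_simplex_set (Suc (Suc n)) E \<and> chain_bd singular_face (Suc n) e = c"
      using contractible_cycle_is_boundary[OF con, of n c] by (simp add: chain_bd_singular singular_chain_def)
  qed
qed

section \<open>Laurent series in both directions\<close>

definition shift :: "int \<Rightarrow> (int \<Rightarrow> 'a) \<Rightarrow> int \<Rightarrow> 'a" where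
  "shift d x = (\<lambda>i. x (i - d))"

lemma shift_0 [simp]: "shift 0 x = x"
  and shift_shift [simp]: "shift d (shift e x) = shift (d + e) x"
  by (auto simp: shift_def algebra_simps)

text \<open>For \<open>e = 1\<close> and \<open>e = -1\<close> this is \<open>A((q))\<close> and \<open>A((q\<^bsup>-1\<^esup>))\<close>.\<close>

definition laurent_series :: "('a, 'y) ring_scheme \<Rightarrow> int \<Rightarrow> (int \<Rightarrow> 'a) set" where
  "laurent_series A e = {a. (\<forall>i. a i \<in> carrier A) \<and> (\<exists>n. \<forall>i. e * i < n \<longrightarrow> a i = \<zero>\<^bsub>A\<^esub>)}"

lemma laurent_seriesD:
  assumes "a \<in> laurent_series A e"
  obtains n where "\<And>i. a i \<in> carrier A" "\<And>i. e * i < n \<Longrightarrow> a i = \<zero>\<^bsub>A\<^esub>"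
  using assms by (auto simp: laurent_series_def)

lemma laurent_seriesI:
  "(\<And>i. a i \<in> carrier A) \<Longrightarrow> (\<And>i. e * i < n \<Longrightarrow> a i = \<zero>\<^bsub>A\<^esub>) \<Longrightarrow> a \<in> laurent_series A e"
  by (auto simp: laurent_series_def)

lemma laurent_poly_carrier:
  "carrier (laurent_poly_ring A) = laurent_series A 1 \<inter> laurent_series A (-1)"
proof (intro equalityI subsetI)
  fix a assume "a \<in> carrier (laurent_poly_ring A)"
  then have a: "\<And>i. a i \<in> carrier A" "finite {i. a i \<noteq> \<zero>\<^bsub>A\<^esub>}" by (auto simp: laurent_poly_ring_def)
  from bdd_below_finite[OF a(2)] obtain m where m: "\<And>i. a i \<noteq> \<zero>\<^bsub>A\<^esub> \<Longrightarrow> m \<le> i" by (auto simp: bdd_below_def)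
  from bdd_above_finite[OF a(2)] obtain n where n: "\<And>i. a i \<noteq> \<zero>\<^bsub>A\<^esub> \<Longrightarrow> i \<le> n" by (auto simp: bdd_above_def)
  have "a \<in> laurent_series A 1" using m by (intro laurent_seriesI[of _ _ _ m]) (force simp: a(1))+
  moreover have "a \<in> laurent_series A (-1)" using n by (intro laurent_seriesI[of _ _ _ "- n"]) (force simp: a(1))+
  ultimately show "a \<in> laurent_series A 1 \<inter> laurent_series A (-1)" by blast
next
  fix a assume a: "a \<in> laurent_series A 1 \<inter> laurent_series A (-1)"
  obtain m where m: "\<And>i. a i \<in> carrier A" "\<And>i. 1 * i < m \<Longrightarrow> a i = \<zero>\<^bsub>A\<^esub>" using a laurent_seriesD by blast
  obtain n where n: "\<And>i. (-1) * i < n \<Longrightarrow> a i = \<zero>\<^bsub>A\<^esub>" using a laurent_seriesD by blast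
  have "i \<in> {m..- n}" if "a i \<noteq> \<zero>\<^bsub>A\<^esub>" for i using m(2)[of i] n[of i] that by force
  then have "{i. a i \<noteq> \<zero>\<^bsub>A\<^esub>} \<subseteq> {m..- n}" by blast
  then show "a \<in> carrier (laurent_poly_ring A)" using m(1) finite_subset by (auto simp: laurent_poly_ring_def)
qed

lemma laurent_poly_module_restrict:
  "laurent_poly_module A = (biinfinite_series_module A)\<lparr>carrier := laurent_series A 1 \<inter> laurent_series A (-1)\<rparr>"
  by (simp add: laurent_poly_module_def laurent_poly_carrier)

lemma biinfinite_simps [simp]:
  "a \<in> carrier (biinfinite_series_module A) \<longleftrightarrow> (\<forall>i. a i \<in> carrier A)"
  "\<zero>\<^bsub>biinfinite_series_module A\<^esub> = (\<lambda>i. \<zero>\<^bsub>A\<^esub>)"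
  "a \<oplus>\<^bsub>biinfinite_series_module A\<^esub> b = (\<lambda>i. a i \<oplus>\<^bsub>A\<^esub> b i)"
  "r \<odot>\<^bsub>biinfinite_series_module A\<^esub> a = laurent_mult A r a"
  by (simp_all add: biinfinite_series_module_def)

context cring
begin

abbreviation (input) "BI \<equiv> biinfinite_series_module R"

lemma biinfinite_group: "abelian_group (BI)"
proof (rule abelian_groupI)
  fix x assume "x \<in> carrier (BI)"
  then show "\<exists>y\<in>carrier (BI). y \<oplus>\<^bsub>BI\<^esub> x = \<zero>\<^bsub>BI\<^esub>"
    by (intro bexI[of _ "\<lambda>i. \<ominus> x i"]) (auto simp: l_neg)
qed (auto simp: a_ac)

lemma biinfinite_neg:
  assumes "x \<in> carrier (BI)"
  shows "\<ominus>\<^bsub>BI\<^esub> x = (\<lambda>i. \<ominus> x i)"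
  using assms by (intro abelian_group.minus_equality[OF biinfinite_group]) (auto simp: l_neg)

lemma laurent_series_subgroup: "additive_subgroup (laurent_series R e) (BI)"
proof (rule abelian_group.additive_subgroup_criterion[OF biinfinite_group])
  fix x y assume "x \<in> laurent_series R e" "y \<in> laurent_series R e"
  then obtain n m where xy: "\<And>i. x i \<in> carrier R" "\<And>i. e * i < n \<Longrightarrow> x i = \<zero>"
    "\<And>i. y i \<in> carrier R" "\<And>i. e * i < m \<Longrightarrow> y i = \<zero>" by (metis laurent_seriesD)
  then show "x \<oplus>\<^bsub>BI\<^esub> y \<in> laurent_series R e"
    by (intro laurent_seriesI[of _ _ _ "min n m"]) auto
next
  fix x assume x: "x \<in> laurent_series R e"
  then have "\<ominus>\<^bsub>BI\<^esub> x = (\<lambda>i. \<ominus> x i)"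
    by (intro biinfinite_neg) (auto simp: laurent_series_def)
  then show "\<ominus>\<^bsub>BI\<^esub> x \<in> laurent_series R e"
    using x by (auto simp: laurent_series_def)
qed (auto simp: laurent_series_def)

lemma laurent_series_cover:
  assumes "x \<in> carrier (BI)"
  shows "\<exists>y\<in>laurent_series R 1. \<exists>y'\<in>laurent_series R (-1). x = y \<oplus>\<^bsub>BI\<^esub> y'"
proof (intro bexI)
  show "x = (\<lambda>i. if i < 0 then \<zero> else x i) \<oplus>\<^bsub>BI\<^esub> (\<lambda>i. if i < 0 then x i else \<zero>)"
    using assms by auto
  show "(\<lambda>i. if i < 0 then \<zero> else x i) \<in> laurent_series R 1"
    using assms by (intro laurent_seriesI[of _ _ _ 0]) auto
  show "(\<lambda>i. if i < 0 then x i else \<zero>) \<in> laurent_series R (-1)"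
    using assms by (intro laurent_seriesI[of _ _ _ 1]) auto
qed

lemma laurent_mult_closed:
  assumes "r \<in> carrier (laurent_poly_ring R)" "\<forall>i. x i \<in> carrier R"
  shows "laurent_mult R r x i \<in> carrier R"
  using assms unfolding laurent_mult_def by (intro finsum_closed) (auto simp: laurent_poly_ring_def)

lemma laurent_mult_add:
  assumes "r \<in> carrier (laurent_poly_ring R)" "\<forall>i. x i \<in> carrier R" "\<forall>i. y i \<in> carrier R"
  shows "laurent_mult R r (\<lambda>i. x i \<oplus> y i) = (\<lambda>i. laurent_mult R r x i \<oplus> laurent_mult R r y i)"
proof
  fix i
  have r: "r j \<in> carrier R" for j using assms(1) by (simp add: laurent_poly_ring_def)
  show "laurent_mult R r (\<lambda>i. x i \<oplus> y i) i = laurent_mult R r x i \<oplus> laurent_mult R r y i"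
    using assms(2,3) r by (simp add: laurent_mult_def r_distr finsum_addf Pi_iff)
qed

lemma laurent_mult_zero:
  assumes "r \<in> carrier (laurent_poly_ring R)" "\<And>j. r j \<noteq> \<zero> \<Longrightarrow> x (i - j) = \<zero>"
  shows "laurent_mult R r x i = \<zero>"
proof -
  have "laurent_mult R r x i = (\<Oplus>j\<in>{j. r j \<noteq> \<zero>}. \<zero>)"
    unfolding laurent_mult_def using assms by (intro finsum_cong') (auto simp: laurent_poly_ring_def)
  then show ?thesis by simp
qed

lemma laurent_series_mult:
  assumes r: "r \<in> carrier (laurent_poly_ring R)" and x: "x \<in> laurent_series R e"
  shows "laurent_mult R r x \<in> laurent_series R e"
proof -
  obtain n where n: "\<And>i. x i \<in> carrier R" "\<And>i. e * i < n \<Longrightarrow> x i = \<zero>" by (rule laurent_seriesD[OF x]) blast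
  have "finite ((\<lambda>j. e * j) ` {j. r j \<noteq> \<zero>})" using r by (simp add: laurent_poly_ring_def)
  from bdd_below_finite[OF this] obtain m where m: "\<And>j. r j \<noteq> \<zero> \<Longrightarrow> m \<le> e * j" by (auto simp: bdd_below_def)
  show ?thesis
  proof (rule laurent_seriesI)
    show "laurent_mult R r x i \<in> carrier R" for i using laurent_mult_closed[OF r] n(1) by blast
    show "laurent_mult R r x i = \<zero>" if i: "e * i < n + m" for i
    proof (rule laurent_mult_zero[OF r])
      fix j assume "r j \<noteq> \<zero>"
      then have "e * (i - j) < n" using m[of j] i by (simp add: right_diff_distrib)
      then show "x (i - j) = \<zero>" by (rule n(2))
    qed
  qed
qed

text \<open>In the zero ring \<open>q\<close> has empty support, so that case is separate.\<close>

lemma laurent_mult_q: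
  assumes x: "\<forall>i. x i \<in> carrier R"
  shows "laurent_mult R (laurent_q R) x = shift 1 x"
proof
  fix i
  show "laurent_mult R (laurent_q R) x i = shift 1 x i"
  proof (cases "\<one> = \<zero>")
    case True
    have "y = \<zero>" if "y \<in> carrier R" for y using l_one[OF that] l_null[OF that] True by simp
    then have "x (i - 1) = \<zero>" using x by blast
    then show ?thesis using True by (simp add: laurent_mult_def laurent_q_def shift_def)
  next
    case False
    then have "{j. laurent_q R j \<noteq> \<zero>} = {1}" by (auto simp: laurent_q_def)
    then show ?thesis using x by (simp add: laurent_mult_def) (simp add: laurent_q_def shift_def)
  qed
qed

end

lemma shift_laurent_series:
  assumes "x \<in> laurent_series A e" shows "shift d x \<in> laurent_series A e"
proof -
  obtain n where "\<And>i. x i \<in> carrier A" "\<And>i. e * i < n \<Longrightarrow> x i = \<zero>\<^bsub>A\<^esub>" by (rule laurent_seriesD[OF assms]) blast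
  then show ?thesis
    by (intro laurent_seriesI[of _ _ _ "n + e * d"]) (auto simp: shift_def right_diff_distrib)
qed

lemma laurent_series_reflect:
  "(\<lambda>i. a (- i)) \<in> laurent_series A e \<longleftrightarrow> a \<in> laurent_series A (- e)"
proof -
  have r: "(\<forall>i. P (- i)) \<longleftrightarrow> (\<forall>i. P i)" for P :: "int \<Rightarrow> bool" by (metis minus_minus)
  show ?thesis
    unfolding laurent_series_def
    using r[of "\<lambda>i. a i \<in> carrier A"] r[of "\<lambda>i. e * - i < _ \<longrightarrow> a i = \<zero>\<^bsub>A\<^esub>"] by simp
qed

text \<open>The coefficients of \<open>b / (q\<^bsup>L\<^esup> - 1) = - (b + q\<^bsup>L\<^esup> b + q\<^bsup>2L\<^esup> b + \<dots>)\<close> for a series \<open>b\<close> that starts in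
  degree \<open>n\<close>.\<close>

function geometric_solution :: "('a, 'y) ring_scheme \<Rightarrow> int \<Rightarrow> int \<Rightarrow> (int \<Rightarrow> 'a) \<Rightarrow> int \<Rightarrow> 'a" where
  "geometric_solution A n L b i =
     (if i < n \<or> L \<le> 0 then \<zero>\<^bsub>A\<^esub> else geometric_solution A n L b (i - L) \<ominus>\<^bsub>A\<^esub> b i)"
  by auto
termination
  by (relation "measure (\<lambda>(A, n, L, b, i). nat (i - n + 1))") auto

declare geometric_solution.simps [simp del]

context cring
begin

lemma shift_equation_pos:
  assumes L: "L > 0" and b: "b \<in> laurent_series R 1"
  shows "\<exists>!a. a \<in> laurent_series R 1 \<and> shift L a = a \<oplus>\<^bsub>BI\<^esub> b"
proof -
  obtain n where bR: "\<And>i. b i \<in> carrier R" and n: "\<And>i. i < n \<Longrightarrow> b i = \<zero>"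
    using laurent_seriesD[OF b] by (metis mult_1)
  let ?a = "geometric_solution R n L b"
  have closed: "?a i \<in> carrier R" for i
  proof (induction "nat (i - n + 1)" arbitrary: i rule: less_induct)
    case less
    then show ?case
      using L bR by (subst geometric_solution.simps) auto
  qed
  have zero: "?a i = \<zero>" if "i < n" for i using that by (subst geometric_solution.simps) simp
  have eq: "?a (i - L) = ?a i \<oplus> b i" for i
  proof (cases "i < n")
    case True
    then show ?thesis using L zero n by simp
  next
    case False
    then have "?a i = ?a (i - L) \<ominus> b i" using L by (subst geometric_solution.simps) simp
    then show ?thesis using closed bR by (simp add: minus_eq a_assoc l_neg)
  qed
  show ?thesis
  proof (rule ex1I)
    show "?a \<in> laurent_series R 1 \<and> shift L ?a = ?a \<oplus>\<^bsub>BI\<^esub> b"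
      using closed zero eq by (auto simp: laurent_series_def shift_def)
  next
    fix a assume a: "a \<in> laurent_series R 1 \<and> shift L a = a \<oplus>\<^bsub>BI\<^esub> b"
    then obtain m where aR: "\<And>i. a i \<in> carrier R" and m: "\<And>i. i < m \<Longrightarrow> a i = \<zero>"
      by (auto simp: laurent_series_def)
    have a_eq: "a (i - L) = a i \<oplus> b i" for i
      using fun_cong[OF conjunct2[OF a], of i] by (simp add: shift_def)
    have "a i = ?a i" for i
    proof (induction "nat (i - min n m + 1)" arbitrary: i rule: less_induct)
      case less
      show ?case
      proof (cases "i < min n m")
        case True
        then show ?thesis using zero m by simp
      next
        case False
        then have "a (i - L) = ?a (i - L)" using L by (intro less) auto
        then have "a i \<oplus> b i = ?a i \<oplus> b i" using a_eq eq by metis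
        then show ?thesis using aR closed bR by simp
      qed
    qed
    then show "a = ?a" by blast
  qed
qed

text \<open>The substitution \<open>q \<mapsto> q\<^bsup>-1\<^esup>\<close> reduces this to \<open>shift_equation_pos\<close>: dividing by \<open>q\<^bsup>-L\<^esup> - 1\<close> is
  dividing by \<open>q\<^bsup>L\<^esup> - 1\<close> up to the unit \<open>- q\<^bsup>L\<^esup>\<close>, which is the shift in \<open>b'\<close>.\<close>

lemma shift_equation_neg:
  assumes L: "L > 0" and b: "b \<in> laurent_series R (-1)"
  shows "\<exists>!a. a \<in> laurent_series R (-1) \<and> shift L a = a \<oplus>\<^bsub>BI\<^esub> b"
proof -
  define b' where "b' = (\<lambda>j. \<ominus> b (L - j))"
  have refl: "(\<lambda>i. a (- i)) \<in> laurent_series R 1 \<longleftrightarrow> a \<in> laurent_series R (-1)" for a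
    by (rule laurent_series_reflect)
  have bR: "b i \<in> carrier R" for i using b by (auto simp: laurent_series_def)
  have eq: "shift L a = a \<oplus>\<^bsub>BI\<^esub> b \<longleftrightarrow>
      shift L (\<lambda>i. a (- i)) = (\<lambda>i. a (- i)) \<oplus>\<^bsub>BI\<^esub> b'"
    if a: "\<And>i. a i \<in> carrier R" for a
  proof -
    have e: "a i = a (i + L) \<oplus> b (i + L) \<longleftrightarrow> a (i + L) = a i \<oplus> \<ominus> b (i + L)" for i
    proof -
      have "a (i + L) \<oplus> b (i + L) \<oplus> \<ominus> b (i + L) = a (i + L)" "a i \<oplus> \<ominus> b (i + L) \<oplus> b (i + L) = a i"
        using a bR by (simp_all add: a_assoc r_neg l_neg)
      then show ?thesis by metis
    qed
    have reindex: "(\<forall>i. Q i) \<longleftrightarrow> (\<forall>j. Q (- j + L))" for Q :: "int \<Rightarrow> bool"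
    proof
      assume *: "\<forall>j. Q (- j + L)"
      show "\<forall>i. Q i"
      proof
        fix i show "Q i" using spec[OF *, of "L - i"] by simp
      qed
    qed simp
    have "shift L a = a \<oplus>\<^bsub>BI\<^esub> b \<longleftrightarrow> (\<forall>i. a (i - L) = a i \<oplus> b i)"
      by (simp add: fun_eq_iff shift_def)
    also have "\<dots> \<longleftrightarrow> (\<forall>j. a (- j) = a (- j + L) \<oplus> b (- j + L))"
      using reindex[of "\<lambda>i. a (i - L) = a i \<oplus> b i"] by simp
    also have "\<dots> \<longleftrightarrow> (\<forall>j. a (- j + L) = a (- j) \<oplus> \<ominus> b (- j + L))" by (simp only: e)
    finally show ?thesis by (simp add: fun_eq_iff shift_def b'_def)
  qed
  have "b' \<in> laurent_series R 1"
  proof -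
    obtain n where "\<And>i. b i \<in> carrier R" and n: "\<And>i. (-1) * i < n \<Longrightarrow> b i = \<zero>"
      by (rule laurent_seriesD[OF b]) blast
    show ?thesis
      unfolding b'_def by (intro laurent_seriesI[of _ _ _ "n + L"]) (simp_all add: bR n)
  qed
  from shift_equation_pos[OF L this] obtain c where c: "c \<in> laurent_series R 1" "shift L c = c \<oplus>\<^bsub>BI\<^esub> b'"
    and unique: "\<And>a. a \<in> laurent_series R 1 \<Longrightarrow> shift L a = a \<oplus>\<^bsub>BI\<^esub> b' \<Longrightarrow> a = c"
    by blast
  have closed: "a i \<in> carrier R" if "a \<in> laurent_series R (-1)" for a i using that by (auto simp: laurent_series_def)
  show ?thesis
  proof (rule ex1I)
    have m: "(\<lambda>i. c (- i)) \<in> laurent_series R (-1)" using refl[of "\<lambda>i. c (- i)"] c by simp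
    then show "(\<lambda>i. c (- i)) \<in> laurent_series R (-1) \<and>
        shift L (\<lambda>i. c (- i)) = (\<lambda>i. c (- i)) \<oplus>\<^bsub>BI\<^esub> b"
      using eq[of "\<lambda>i. c (- i)"] closed[OF m] c(2) by simp
  next
    fix a assume a: "a \<in> laurent_series R (-1) \<and> shift L a = a \<oplus>\<^bsub>BI\<^esub> b"
    then have "(\<lambda>i. a (- i)) = c" using eq[of a] closed[of a] refl[of a] by (intro unique) auto
    then show "a = (\<lambda>i. c (- i))" by auto
  qed
qed

end

section \<open>Local systems over Artin groups\<close>

definition word_degree :: "'s gword \<Rightarrow> int" where
  "word_degree u = (\<Sum>(s, b)\<leftarrow>u. if b then 1 else -1)"

text \<open>If every generator shifts by one place, then a group element acts through the exponent sum of
  any word that represents it.\<close>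

lemma shift_action:
  assumes act: "group_action (presented_group S R) M \<rho>"
    and gen: "\<And>s x. s \<in> S \<Longrightarrow> x \<in> M \<Longrightarrow> \<rho> (pres_gen S R s) x = shift 1 x"
    and u: "u \<in> lists (S \<times> UNIV)" and x: "x \<in> M"
  shows "\<rho> (pres_class S R u) x = shift (word_degree u) x"
proof -
  interpret group_action "presented_group S R" M \<rho> by (rule act)
  have cl: "pres_class S R v \<in> carrier (presented_group S R)" if "v \<in> lists (S \<times> UNIV)" for v
    using that by (auto simp: carrier_presented_group)
  have one: "\<rho> (pres_class S R []) y = y" if "y \<in> M" for y
    using fun_cong[OF id_eq_one, of y] that by (simp add: one_presented_group)
  have letter: "\<rho> (pres_class S R [(s, b)]) y = shift (if b then 1 else -1) y" if s: "s \<in> S" and y: "y \<in> M" for s b y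
  proof (cases b)
    case True
    then show ?thesis using gen s y by (simp add: pres_gen_def)
  next
    case False
    let ?y = "\<rho> (pres_class S R [(s, False)]) y"
    have "?y \<in> M" using element_image[OF cl y HOL.refl, of "[(s, False)]"] s by simp
    have "pres_class S R [(s, True), (s, False)] = pres_class S R []"
      using s pres_rel.cancel[of "[]" S "[]" s True R] by (subst pres_class_eq_iff) auto
    then have "shift 1 ?y = y"
      using composition_rule[OF y cl cl, of "[(s, True)]" "[(s, False)]"] s one[OF y] gen[OF s \<open>?y \<in> M\<close>]
      by (simp add: mult_presented_group pres_gen_def)
    then have "shift (-1) (shift 1 ?y) = shift (-1) y" by simp
    then show ?thesis using False by simp
  qed
  show ?thesis
    using u
  proof (induction u rule: list.induct)
    case Nil
    then show ?case using one x by (simp add: word_degree_def)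
  next
    case (Cons a u)
    obtain s b where a: "a = (s, b)" "s \<in> S" using Cons.prems by auto
    have "\<rho> (pres_class S R (a # u)) x = \<rho> (pres_class S R [a]) (\<rho> (pres_class S R u) x)"
      using composition_rule[OF x cl cl, of "[a]" u] Cons.prems by (simp add: mult_presented_group)
    also have "\<dots> = shift (if b then 1 else -1) (\<rho> (pres_class S R u) x)"
      unfolding a(1) using element_image[OF cl x HOL.refl] Cons.prems by (intro letter a) auto
    finally show ?case using Cons by (simp add: a word_degree_def)
  qed
qed

lemma central_pres_class:
  assumes grp: "group (presented_group S R)" and u: "u \<in> lists (S \<times> UNIV)"
    and comm: "\<And>s. s \<in> S \<Longrightarrow> ([(s, True)] @ u, u @ [(s, True)]) \<in> pres_rel S R"
    and g: "g \<in> carrier (presented_group S R)"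
  shows "pres_class S R u \<otimes>\<^bsub>presented_group S R\<^esub> g = g \<otimes>\<^bsub>presented_group S R\<^esub> pres_class S R u"
proof -
  let ?P = "presented_group S R"
  interpret group ?P by fact
  have cl: "pres_class S R v \<in> carrier ?P" if "v \<in> lists (S \<times> UNIV)" for v
    using that by (auto simp: carrier_presented_group)
  have letter: "pres_class S R u \<otimes>\<^bsub>?P\<^esub> pres_class S R [(s, b)] = pres_class S R [(s, b)] \<otimes>\<^bsub>?P\<^esub> pres_class S R u"
    if s: "s \<in> S" for s b
  proof -
    have T: "pres_class S R u \<otimes>\<^bsub>?P\<^esub> pres_class S R [(s, True)] = pres_class S R [(s, True)] \<otimes>\<^bsub>?P\<^esub> pres_class S R u"
      using comm[OF s] u s by (simp add: mult_presented_group pres_class_eq_iff pres_rel.sym)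
    have "pres_class S R [(s, False), (s, True)] = pres_class S R []"
      using s pres_rel.cancel[of "[]" S "[]" s False R] by (subst pres_class_eq_iff) auto
    then have F: "pres_class S R [(s, False)] = inv\<^bsub>?P\<^esub> pres_class S R [(s, True)]"
      using s cl by (intro inv_equality[symmetric]) (auto simp: mult_presented_group one_presented_group)
    show ?thesis
    proof (cases b)
      case True
      then show ?thesis using T by simp
    next
      case False
      have "inv\<^bsub>?P\<^esub> x \<otimes>\<^bsub>?P\<^esub> y = y \<otimes>\<^bsub>?P\<^esub> inv\<^bsub>?P\<^esub> x"
        if "x \<in> carrier ?P" "y \<in> carrier ?P" "y \<otimes>\<^bsub>?P\<^esub> x = x \<otimes>\<^bsub>?P\<^esub> y" for x y
        using that by (metis inv_solve_left inv_solve_right m_assoc m_closed inv_closed)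
      from this[OF _ cl[OF u] T] have "pres_class S R [(s, False)] \<otimes>\<^bsub>?P\<^esub> pres_class S R u =
          pres_class S R u \<otimes>\<^bsub>?P\<^esub> pres_class S R [(s, False)]"
        unfolding F using cl[of "[(s, True)]"] s by simp
      then show ?thesis using False by simp
    qed
  qed
  obtain v where v: "v \<in> lists (S \<times> UNIV)" "g = pres_class S R v" using g by (auto simp: carrier_presented_group)
  have "pres_class S R u \<otimes>\<^bsub>?P\<^esub> pres_class S R v = pres_class S R v \<otimes>\<^bsub>?P\<^esub> pres_class S R u"
    using v(1)
  proof (induction v rule: list.induct)
    case Nil
    show ?case using u by (simp add: mult_presented_group)
  next
    case (Cons a v)
    obtain s b where a: "a = (s, b)" "s \<in> S" using Cons.prems by auto
    have v: "v \<in> lists (S \<times> UNIV)" using Cons.prems by simp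
    have e: "pres_class S R (a # v) = pres_class S R [a] \<otimes>\<^bsub>?P\<^esub> pres_class S R v"
      using Cons.prems by (simp add: mult_presented_group)
    show ?case
      unfolding e using letter[OF a(2), of b] Cons.IH v cl[OF u] cl[OF v] cl[of "[a]"] a
      by (metis Cons.prems m_assoc Cons_in_lists_iff lists.Nil)
  qed
  then show ?thesis using v by simp
qed

text \<open>The two assertions of the theorem are instances of this one; it is a separate statement because
  they need it for simplices of different types.\<close>

lemma artin_cohomology_shift:
  fixes W :: "('w, 'z) monoid_scheme" and A :: "('a, 'y) ring_scheme"
  assumes cox: "coxeter_system W S" "finite (carrier W)" "irreducible_coxeter W S"
    and A: "cring A"
    and \<rho>: "linear_action (artin_group W S) (laurent_poly_ring A) (laurent_poly_module A) \<rho>"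
    and \<rho>_gen: "\<forall>s\<in>S. \<forall>x\<in>carrier (laurent_poly_module A).
           \<rho> (artin_gen W S s) x = laurent_q A \<odot>\<^bsub>laurent_poly_module A\<^esub> x"
    and \<rho>': "linear_action (artin_group W S) (laurent_poly_ring A) (biinfinite_series_module A) \<rho>'"
    and \<rho>'_gen: "\<forall>s\<in>S. \<forall>x\<in>carrier (biinfinite_series_module A).
           \<rho>' (artin_gen W S s) x = laurent_q A \<odot>\<^bsub>biinfinite_series_module A\<^esub> x"
    and X: "free_acyclic_gset (artin_group W S) X act face"
  shows "module_isomorphic (laurent_poly_ring A)
     (cohomology (equivariant_cochains (artin_group W S) X act (biinfinite_series_module A) \<rho>')
        (coboundary_map X face (biinfinite_series_module A)) i)
     (cohomology (equivariant_cochains (artin_group W S) X act (laurent_poly_module A) \<rho>)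
        (coboundary_map X face (laurent_poly_module A)) (i + 1))"
proof -
  let ?B = "biinfinite_series_module A" and ?G = "artin_group W S" and ?R = "artin_relations W S"
  interpret A: cring A by fact
  interpret B: abelian_group ?B by (rule A.biinfinite_group)
  interpret W: coxeter W S
    using cox by (auto simp: coxeter_def coxeter_axioms_def coxeter_system_def)
  interpret X: free_acyclic_gset ?G X act face by (rule X)
  have G: "?G = presented_group S ?R" by (simp add: artin_group_def)
  have act': "group_action ?G (carrier ?B) \<rho>'" and act: "group_action ?G (carrier (laurent_poly_module A)) \<rho>"
    using \<rho> \<rho>' by (auto simp: linear_action_def)
  have S: "S \<noteq> {}" using cox(3) by (simp add: irreducible_coxeter_def)
  obtain w where w: "w \<in> lists S" "w \<noteq> []" "\<And>s. s \<in> S \<Longrightarrow> W.artin_eq ([s] @ w) (w @ [s])"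
    using W.central_positive_word[OF S] by blast
  define z where "z = pres_class S ?R (W.pos w)"
  have wl: "W.pos w \<in> lists (S \<times> UNIV)" by (rule W.pos_lists[OF w(1)])
  have z: "z \<in> carrier ?G" using wl by (auto simp: z_def G carrier_presented_group)
  have z_comm: "z \<otimes>\<^bsub>?G\<^esub> g = g \<otimes>\<^bsub>?G\<^esub> z" if "g \<in> carrier ?G" for g
    unfolding z_def G
    using that X.is_group w(3) by (intro central_pres_class wl) (auto simp: G W.artin_eq_def)
  have shift': "\<rho>' (pres_class S ?R u) x = shift (word_degree u) x"
    if "u \<in> lists (S \<times> UNIV)" "x \<in> carrier ?B" for u x
    using act' \<rho>'_gen that unfolding G
    by (intro shift_action[of S ?R "carrier ?B"]) (auto simp: artin_gen_def A.laurent_mult_q)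
  have shift: "\<rho> (pres_class S ?R u) x = shift (word_degree u) x"
    if "u \<in> lists (S \<times> UNIV)" "x \<in> carrier (laurent_poly_module A)" for u x
    using act \<rho>_gen that unfolding G
    by (intro shift_action[of S ?R "carrier (laurent_poly_module A)"])
       (auto simp: artin_gen_def A.laurent_mult_q laurent_poly_module_restrict laurent_series_def)
  have word: "\<exists>u\<in>lists (S \<times> UNIV). g = pres_class S ?R u" if "g \<in> carrier ?G" for g
    using that by (auto simp: G carrier_presented_group)
  have L: "word_degree (W.pos w) > 0"
  proof -
    have "word_degree (W.pos v) = int (length v)" for v
      by (induction v) (auto simp: word_degree_def)
    then show ?thesis using w(2) by simp
  qed
  have sub: "x \<in> carrier ?B" if "x \<in> laurent_series A e" for x e
    using that by (auto simp: laurent_series_def)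
  have z_shift: "\<rho>' z x = shift (word_degree (W.pos w)) x" if "x \<in> carrier ?B" for x
    unfolding z_def using shift'[OF wl that] .
  have coeff: "coefficient_action ?G ?B \<rho>'"
    unfolding coefficient_action_def
    using \<rho>' B.abelian_group_axioms group_action.element_image[OF act' _ _ HOL.refl] group_action.composition_rule[OF act']
    by (auto simp: linear_action_def simp del: biinfinite_simps)
  define P where "P b = laurent_series A (if b then 1 else -1)" for b
  have "module_isomorphic (laurent_poly_ring A)
     (cohomology (equivariant_cochains ?G X act ?B \<rho>') (coboundary_map X face ?B) i)
     (cohomology (equivariant_cochains ?G X act (?B\<lparr>carrier := P True \<inter> P False\<rparr>) \<rho>)
        (coboundary_map X face (?B\<lparr>carrier := P True \<inter> P False\<rparr>)) (i + 1))"
  proof (rule X.equivariant_cohomology_shift[OF coeff _ _ _ _ _ _ _ z z_comm])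
    fix r x y assume "r \<in> carrier (laurent_poly_ring A)"
    then show "x \<in> carrier ?B \<Longrightarrow> r \<odot>\<^bsub>?B\<^esub> x \<in> carrier ?B"
      "x \<in> carrier ?B \<Longrightarrow> y \<in> carrier ?B \<Longrightarrow> r \<odot>\<^bsub>?B\<^esub> (x \<oplus>\<^bsub>?B\<^esub> y) = r \<odot>\<^bsub>?B\<^esub> x \<oplus>\<^bsub>?B\<^esub> r \<odot>\<^bsub>?B\<^esub> y"
      "x \<in> P b \<Longrightarrow> r \<odot>\<^bsub>?B\<^esub> x \<in> P b" for b
      by (simp_all add: P_def A.laurent_mult_closed A.laurent_mult_add A.laurent_series_mult)
  next
    fix g r x assume "g \<in> carrier ?G" "r \<in> carrier (laurent_poly_ring A)" "x \<in> carrier ?B"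
    then show "\<rho>' g (r \<odot>\<^bsub>?B\<^esub> x) = r \<odot>\<^bsub>?B\<^esub> \<rho>' g x"
      using \<rho>' unfolding linear_action_def by blast
  next
    show "additive_subgroup (P b) ?B" for b unfolding P_def by (rule A.laurent_series_subgroup)
    show "\<exists>y\<in>P True. \<exists>y'\<in>P False. x = y \<oplus>\<^bsub>?B\<^esub> y'" if "x \<in> carrier ?B" for x
      using A.laurent_series_cover[OF that] by (simp only: P_def if_True if_False)
  next
    fix g x assume "g \<in> carrier ?G"
    then obtain u where u: "u \<in> lists (S \<times> UNIV)" "g = pres_class S ?R u" using word by blast
    show "\<rho>' g x \<in> P b" if "x \<in> P b" for b
      using that shift'[OF u(1) sub] unfolding P_def u(2) by (simp only:) (rule shift_laurent_series)
    show "\<rho> g x = \<rho>' g x" if "x \<in> P True \<inter> P False"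
      using that shift[OF u(1), of x] shift'[OF u(1), of x] sub[of x 1] u(2)
      by (simp add: P_def laurent_poly_module_restrict)
  next
    fix b c assume c: "c \<in> P b"
    have "\<exists>!a. a \<in> P b \<and> shift (word_degree (W.pos w)) a = a \<oplus>\<^bsub>?B\<^esub> c"
      using A.shift_equation_pos[OF L, of c] A.shift_equation_neg[OF L, of c] c by (cases b) (simp_all add: P_def)
    moreover have "a \<in> P b \<and> \<rho>' z a = a \<oplus>\<^bsub>?B\<^esub> c \<longleftrightarrow>
        a \<in> P b \<and> shift (word_degree (W.pos w)) a = a \<oplus>\<^bsub>?B\<^esub> c" for a
      using z_shift[OF sub] by (auto simp: P_def)
    ultimately show "\<exists>!a. a \<in> P b \<and> \<rho>' z a = a \<oplus>\<^bsub>?B\<^esub> c" by simp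
  qed
  then show ?thesis by (simp only: laurent_poly_module_restrict P_def if_True if_False)
qed

theorem mainTheorem2:
  fixes W :: "('w, 'z) monoid_scheme" and S :: "'w set"
    and A :: "('a, 'y) ring_scheme"
    and \<rho> \<rho>' :: "'w gword set \<Rightarrow> (int \<Rightarrow> 'a) \<Rightarrow> int \<Rightarrow> 'a"
  assumes "coxeter_system W S"
    and "finite (carrier W)"
    and "irreducible_coxeter W S"
    and "cring A"
    and "linear_action (artin_group W S) (laurent_poly_ring A) (laurent_poly_module A) \<rho>"
    and "\<forall>s\<in>S. \<forall>x\<in>carrier (laurent_poly_module A).
           \<rho> (artin_gen W S s) x = laurent_q A \<odot>\<^bsub>laurent_poly_module A\<^esub> x"
    and "linear_action (artin_group W S) (laurent_poly_ring A) (biinfinite_series_module A) \<rho>'"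
    and "\<forall>s\<in>S. \<forall>x\<in>carrier (biinfinite_series_module A).
           \<rho>' (artin_gen W S s) x = laurent_q A \<odot>\<^bsub>biinfinite_series_module A\<^esub> x"
  shows "(\<forall>(X :: 'x topology) (E :: 'e topology) p \<phi>.
            classifying_space (artin_group W S) X E p \<phi> \<longrightarrow>
            (\<forall>i :: int.
               module_isomorphic (laurent_poly_ring A)
                 (local_cohomology (artin_group W S) E \<phi> (biinfinite_series_module A) \<rho>' i)
                 (local_cohomology (artin_group W S) E \<phi> (laurent_poly_module A) \<rho> (i + 1))))
       \<and> (\<forall>i :: int.
            module_isomorphic (laurent_poly_ring A)
              (group_cohomology (artin_group W S) (biinfinite_series_module A) \<rho>' i)
              (group_cohomology (artin_group W S) (laurent_poly_module A) \<rho> (i + 1)))"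
proof -
  have "group (artin_group W S)"
    using assms(5) by (auto simp: linear_action_def group_action_def group_hom_def)
  then have "free_acyclic_gset (artin_group W S) (group_tuples (artin_group W S))
      (\<lambda>n g. map (\<lambda>h. g \<otimes>\<^bsub>artin_group W S\<^esub> h)) (\<lambda>n k gs. take k gs @ drop (Suc k) gs)"
    by (rule group.free_acyclic_tuples)
  then show ?thesis
    unfolding local_cohomology_def group_cohomology_def
    by (intro conjI allI impI) (rule artin_cohomology_shift[OF assms], erule free_acyclic_singular,
        rule artin_cohomology_shift[OF assms])
qed

end
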